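(* Let $\Omega\subset\mathbb R^n$, $n\ge2$, be a bounded domain with smooth boundary. Let \[ q_X(x)=q_0(x)+\sum_{j=1}^dX_jV_j(x), \] where $q_0,V_1,\dots,V_d\in C^\infty(\overline\Omega;\mathbb R)$ are known, and where the law of the random vector $X=(X_1,\dots,X_d)\in\mathbb R^d$ is compactly supported and satisfies $q_X\ge0$ almost surely. Assume that there is a nonempty open set $U\Subset\Omega$ such that, for every $k\ge1$, the functions \[ V^\alpha=V_1^{\alpha_1}\cdots V_d^{\alpha_d},\qquad \alpha\in\mathbb N_0^d,\ |\alpha|=k, \] are linearly independent on $U$. Then the averaged Green's operator $\mathbb EG_{q_X}$ determines all mixed moments $\mathbb EX^\alpha$, and consequently it determines the law of $X$.
   Context: For a nonnegative $q\in C^\infty(\overline\Omega;\mathbb R)$, $G_q=(-\Delta_D+q)^{-1}$ is the Dirichlet Green's operator on $L^2(\Omega)$. $\mathbb EG_{q_X}$ is the weak expectation: $\langle(\mathbb EG_{q_X})f,g\rangle=\mathbb E\langle G_{q_X}f,g\rangle$ for $f,g\in L^2(\Omega)$. "Determines" means: for fixed $q_0,V_1,\dots,V_d$, if $X$ and $\widetilde X$ are two random vectors satisfying the hypotheses and $\mathbb EG_{q_X}=\mathbb EG_{q_{\widetilde X}}$, then $\mathbb EX^\alpha=\mathbb E\widetilde X^\alpha$ for all multi-indices $\alpha$, and $\operatorname{Law}(X)=\operatorname{Law}(\widetilde X)$. *)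

theory Defs
  imports "HOL-Probability.Probability"
begin

subsection \<open>Smooth functions\<close>

definition partial_deriv :: "'n::finite \<Rightarrow> (real^'n \<Rightarrow> real) \<Rightarrow> real^'n \<Rightarrow> real" where
  "partial_deriv i f x = frechet_derivative f (at x) (axis i 1)"

text \<open>The head of the list is the outermost derivative; \<open>iter_partial [] f = f\<close>.\<close>

definition iter_partial :: "'n::finite list \<Rightarrow> (real^'n \<Rightarrow> real) \<Rightarrow> real^'n \<Rightarrow> real" where
  "iter_partial is f = foldr partial_deriv is f"

text \<open>Only meant for open \<open>S\<close>. Differentiability of every iterated partial derivative also gives
  continuity of every iterated partial derivative, so this is \<open>C\<^sup>\<infinity>(S)\<close>.\<close>

definition smooth_on :: "(real^'n::finite) set \<Rightarrow> (real^'n \<Rightarrow> real) \<Rightarrow> bool" where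
  "smooth_on S f \<longleftrightarrow> (\<forall>is. \<forall>x\<in>S. iter_partial is f differentiable (at x))"

text \<open>\<open>C\<^sup>\<infinity>\<close> up to the boundary of an open set \<open>\<Omega>\<close>: smooth in \<open>\<Omega>\<close>, and every derivative extends
  continuously to the closure. The values of \<open>f\<close> outside the closure are irrelevant.\<close>

definition smooth_closure :: "(real^'n::finite) set \<Rightarrow> (real^'n \<Rightarrow> real) \<Rightarrow> bool" where
  "smooth_closure \<Omega> f \<longleftrightarrow>
     smooth_on \<Omega> f \<and> continuous_on (closure \<Omega>) f \<and>
     (\<forall>is. \<exists>g. continuous_on (closure \<Omega>) g \<and> (\<forall>x\<in>\<Omega>. g x = iter_partial is f x))"

text \<open>Near each boundary point the domain is the sublevel set of a smooth function with
  non-vanishing gradient; by the implicit function theorem it is, locally, the region on one side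
  of a smooth graph.\<close>

definition smooth_bounded_domain :: "(real^'n::finite) set \<Rightarrow> bool" where
  "smooth_bounded_domain \<Omega> \<longleftrightarrow>
     open \<Omega> \<and> connected \<Omega> \<and> \<Omega> \<noteq> {} \<and> bounded \<Omega> \<and>
     (\<forall>p\<in>frontier \<Omega>. \<exists>r>0. \<exists>\<rho>. smooth_on (ball p r) \<rho> \<and>
        (\<forall>x\<in>ball p r. \<exists>i. partial_deriv i \<rho> x \<noteq> 0) \<and>
        \<Omega> \<inter> ball p r = {x \<in> ball p r. \<rho> x < 0})"


subsection \<open>The Dirichlet Laplacian and Green's operators\<close>

text \<open>Elements of \<open>L\<^sup>2(\<Omega>)\<close> (real-valued) are represented by functions; equality in
  \<open>L\<^sup>2(\<Omega>)\<close> is equality almost everywhere on \<open>\<Omega>\<close>.\<close>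

definition L2 :: "(real^'n::finite) set \<Rightarrow> (real^'n \<Rightarrow> real) set" where
  "L2 \<Omega> = {f \<in> borel_measurable (lebesgue_on \<Omega>). integrable (lebesgue_on \<Omega>) (\<lambda>x. (f x)\<^sup>2)}"

definition L2_inner :: "(real^'n::finite) set \<Rightarrow> (real^'n \<Rightarrow> real) \<Rightarrow> (real^'n \<Rightarrow> real) \<Rightarrow> real" where
  "L2_inner \<Omega> f g = (\<integral>x. f x * g x \<partial>lebesgue_on \<Omega>)"

definition L2_norm :: "(real^'n::finite) set \<Rightarrow> (real^'n \<Rightarrow> real) \<Rightarrow> real" where
  "L2_norm \<Omega> f = sqrt (L2_inner \<Omega> f f)"

definition test_functions :: "(real^'n::finite) set \<Rightarrow> (real^'n \<Rightarrow> real) set" where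
  "test_functions \<Omega> =
     {\<phi>. smooth_on UNIV \<phi> \<and> compact (closure {x. \<phi> x \<noteq> 0}) \<and> closure {x. \<phi> x \<noteq> 0} \<subseteq> \<Omega>}"

definition weak_partial ::
    "(real^'n::finite) set \<Rightarrow> 'n \<Rightarrow> (real^'n \<Rightarrow> real) \<Rightarrow> (real^'n \<Rightarrow> real) \<Rightarrow> bool" where
  "weak_partial \<Omega> i u v \<longleftrightarrow>
     (\<forall>\<phi>\<in>test_functions \<Omega>. L2_inner \<Omega> u (partial_deriv i \<phi>) = - L2_inner \<Omega> v \<phi>)"

text \<open>\<open>H\<^sub>0\<^sup>1(\<Omega>)\<close>: the closure of the test functions in \<open>H\<^sup>1(\<Omega>)\<close>; here \<open>v i\<close> is the weak
  \<open>i\<close>-th derivative of \<open>u\<close>, and convergence is in the \<open>H\<^sup>1\<close> norm.\<close>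

definition H10 :: "(real^'n::finite) set \<Rightarrow> (real^'n \<Rightarrow> real) set" where
  "H10 \<Omega> =
     {u \<in> L2 \<Omega>. \<exists>v. (\<forall>i. v i \<in> L2 \<Omega> \<and> weak_partial \<Omega> i u (v i)) \<and>
        (\<exists>\<phi>. (\<forall>k::nat. \<phi> k \<in> test_functions \<Omega>) \<and>
             (\<lambda>k. L2_norm \<Omega> (\<lambda>x. \<phi> k x - u x)) \<longlonglongrightarrow> 0 \<and>
             (\<forall>i. (\<lambda>k. L2_norm \<Omega> (\<lambda>x. partial_deriv i (\<phi> k) x - v i x)) \<longlonglongrightarrow> 0))}"

definition laplacian :: "(real^'n::finite \<Rightarrow> real) \<Rightarrow> real^'n \<Rightarrow> real" where
  "laplacian f x = (\<Sum>i\<in>UNIV. partial_deriv i (partial_deriv i f) x)"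

text \<open>The graph of the Dirichlet Laplacian \<open>\<Delta>\<^sub>D\<close>: its operator domain is
  \<open>{u \<in> H\<^sub>0\<^sup>1(\<Omega>). \<Delta>u \<in> L\<^sup>2(\<Omega>)}\<close>, and \<open>h = \<Delta>u\<close> holds in the sense of distributions.\<close>

definition dirichlet_laplacian ::
    "(real^'n::finite) set \<Rightarrow> (real^'n \<Rightarrow> real) \<Rightarrow> (real^'n \<Rightarrow> real) \<Rightarrow> bool" where
  "dirichlet_laplacian \<Omega> u h \<longleftrightarrow>
     u \<in> H10 \<Omega> \<and> h \<in> L2 \<Omega> \<and>
     (\<forall>\<phi>\<in>test_functions \<Omega>. L2_inner \<Omega> u (laplacian \<phi>) = L2_inner \<Omega> h \<phi>)"

text \<open>\<open>G\<^sub>q = (-\<Delta>\<^sub>D + q)\<^sup>-\<^sup>1\<close>. For \<open>f \<in> L\<^sup>2(\<Omega>)\<close> and bounded \<open>q \<ge> 0\<close> on bounded \<open>\<Omega>\<close> the solution \<open>u\<close>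
  exists and is unique as an element of \<open>L\<^sup>2(\<Omega>)\<close>; the choice operator only selects a
  representative.\<close>

definition green ::
    "(real^'n::finite) set \<Rightarrow> (real^'n \<Rightarrow> real) \<Rightarrow> (real^'n \<Rightarrow> real) \<Rightarrow> (real^'n \<Rightarrow> real)" where
  "green \<Omega> q f =
     (SOME u. \<exists>h. dirichlet_laplacian \<Omega> u h \<and> (AE x in lebesgue_on \<Omega>. - h x + q x * u x = f x))"


subsection \<open>Random potentials and the averaged Green's operator\<close>

definition potential ::
    "(real^'n \<Rightarrow> real) \<Rightarrow> ('d::finite \<Rightarrow> real^'n \<Rightarrow> real) \<Rightarrow> real^'d \<Rightarrow> real^'n::finite \<Rightarrow> real" where
  "potential q0 V c x = q0 x + (\<Sum>j\<in>UNIV. c $ j * V j x)"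

text \<open>The weak expectation of a random operator \<open>G\<close> on \<open>L\<^sup>2(\<Omega>)\<close>: the operator \<open>A\<close> with
  \<open>\<langle>A f, g\<rangle> = E \<langle>G f, g\<rangle>\<close> for all \<open>f, g \<in> L\<^sup>2(\<Omega>)\<close>. As in \<open>green\<close>, the choice operator selects a
  representative of \<open>A f\<close>. The expectation is taken over the completion of \<open>M\<close> because \<open>G\<close> is only
  meaningful almost surely: Green's operators are unspecified on the null event where \<open>q\<^sub>X \<ge> 0\<close>
  fails, and for an incomplete \<open>M\<close> arbitrary values there could destroy measurability.\<close>

definition weak_expectation ::
    "'a measure \<Rightarrow> (real^'n::finite) set \<Rightarrow> ('a \<Rightarrow> (real^'n \<Rightarrow> real) \<Rightarrow> (real^'n \<Rightarrow> real)) \<Rightarrow>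
     (real^'n \<Rightarrow> real) \<Rightarrow> (real^'n \<Rightarrow> real)" where
  "weak_expectation M \<Omega> G f =
     (SOME h. h \<in> L2 \<Omega> \<and>
        (\<forall>g\<in>L2 \<Omega>. L2_inner \<Omega> h g = (\<integral>\<omega>. L2_inner \<Omega> (G \<omega> f) g \<partial>completion M)))"

definition averaged_green ::
    "'a measure \<Rightarrow> ('a \<Rightarrow> real^'d) \<Rightarrow> (real^'n::finite) set \<Rightarrow> (real^'n \<Rightarrow> real) \<Rightarrow>
     ('d::finite \<Rightarrow> real^'n \<Rightarrow> real) \<Rightarrow> (real^'n \<Rightarrow> real) \<Rightarrow> (real^'n \<Rightarrow> real)" where
  "averaged_green M X \<Omega> q0 V =
     weak_expectation M \<Omega> (\<lambda>\<omega>. green \<Omega> (potential q0 V (X \<omega>)))"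

definition L2_operator_eq ::
    "(real^'n::finite) set \<Rightarrow> ((real^'n \<Rightarrow> real) \<Rightarrow> (real^'n \<Rightarrow> real)) \<Rightarrow>
     ((real^'n \<Rightarrow> real) \<Rightarrow> (real^'n \<Rightarrow> real)) \<Rightarrow> bool" where
  "L2_operator_eq \<Omega> A B \<longleftrightarrow> (\<forall>f\<in>L2 \<Omega>. AE x in lebesgue_on \<Omega>. A f x = B f x)"

definition admissible ::
    "(real^'n::finite) set \<Rightarrow> (real^'n \<Rightarrow> real) \<Rightarrow> ('d::finite \<Rightarrow> real^'n \<Rightarrow> real) \<Rightarrow>
     'a measure \<Rightarrow> ('a \<Rightarrow> real^'d) \<Rightarrow> bool" where
  "admissible \<Omega> q0 V M X \<longleftrightarrow>
     prob_space M \<and> X \<in> borel_measurable M \<and>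
     (\<exists>K. compact K \<and> (AE c in distr M borel X. c \<in> K)) \<and>
     (AE \<omega> in M. \<forall>x\<in>closure \<Omega>. 0 \<le> potential q0 V (X \<omega>) x)"


subsection \<open>Monomials and linear independence\<close>

definition monomial :: "('d::finite \<Rightarrow> real) \<Rightarrow> ('d \<Rightarrow> nat) \<Rightarrow> real" where
  "monomial a \<alpha> = (\<Prod>j\<in>UNIV. a j ^ \<alpha> j)"

definition multi_indices :: "nat \<Rightarrow> ('d::finite \<Rightarrow> nat) set" where
  "multi_indices k = {\<alpha>. (\<Sum>j\<in>UNIV. \<alpha> j) = k}"

text \<open>Linear independence of the restrictions to \<open>U\<close> of a finite family, as a family: in
  particular members with different indices must be different functions on \<open>U\<close>.\<close>

definition lin_indep_on :: "'x set \<Rightarrow> 'i set \<Rightarrow> ('i \<Rightarrow> 'x \<Rightarrow> real) \<Rightarrow> bool" where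
  "lin_indep_on U I F \<longleftrightarrow>
     (\<forall>c. (\<forall>x\<in>U. (\<Sum>i\<in>I. c i * F i x) = 0) \<longrightarrow> (\<forall>i\<in>I. c i = 0))"

lemma finite_multi_indices: "finite (multi_indices k :: ('d::finite \<Rightarrow> nat) set)"
proof (rule finite_subset)
  show "(multi_indices k :: ('d \<Rightarrow> nat) set) \<subseteq> PiE UNIV (\<lambda>_. {..k})"
    by (auto simp: multi_indices_def PiE_def intro!: member_le_sum)
  show "finite (PiE (UNIV :: 'd set) (\<lambda>_. {..k}))"
    by (intro finite_PiE) auto
qed

end

theory Submission
  imports Defs
begin

text \<open>Test the Green's operators on oscillating functions \<open>\<phi> = a(x) cos (\<kappa> x\<^sub>i + \<theta>)\<close>, \<open>\<kappa> \<rightarrow> \<infinity>\<close>.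
  In the resolvent equation \<open>G (-\<Delta>\<phi> + q\<^sub>0 \<phi> + \<Sum>\<^sub>j X\<^sub>j V\<^sub>j \<phi>) = \<phi>\<close> the leading part of \<open>-\<Delta>\<phi>\<close> is \<open>\<kappa>\<^sup>2 \<phi>\<close>,
  so every factor \<open>X\<^sub>j V\<^sub>j\<close> costs \<open>\<kappa>\<^sup>-\<^sup>2\<close> and every derivative that falls on the amplitude costs at
  least \<open>\<kappa>\<^sup>-\<^sup>1\<close>. Multiply by monomials in \<open>X\<close> and take the difference of the expectations for two
  random vectors with equal averages. If their moments of order less than \<open>k\<close> agree, iterating the
  equation gives, up to sign,
  \<open>0 = \<kappa>\<^sup>-\<^sup>2\<^sup>k\<^sup>-\<^sup>2 \<langle>\<Sum> (k!/\<alpha>!) (E X\<^sup>\<alpha> - E X'\<^sup>\<alpha>) V\<^sup>\<alpha> \<phi>, \<psi>\<rangle> + O(\<kappa>\<^sup>-\<^sup>2\<^sup>k\<^sup>-\<^sup>3)\<close>, the sum being over \<open>|\<alpha>| = k\<close>.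
  Hence the sum vanishes on \<open>\<Omega>\<close>, and linear independence shows that the moments of order \<open>k\<close> agree.
  Laws with compact support are determined by their moments by the Stone-Weierstrass theorem.\<close>

text \<open>Equality of the averages concerns only the form without any factor \<open>X_j\<close>,
  while the resolvent equation is not closed: the form for a list of indices involves the forms for
  lists longer by one, about which only boundedness is known. Cutting off works because each step is
  worth two powers of \<kappa>. For any list, boundedness and the equation already give
  \<open>O(\<kappa>^-2)\<close>; going back from length \<open>k\<close> to the empty list gains two
  powers each time, since the moments met on the way vanish, and the unknown forms of length
  \<open>k + 1\<close> stay below the leading order. Derivatives of the amplitude cause no loss,
  because the same equation applies to them and they are again test functions; so nothing beyond
  \<open>L^2\<close> bounds of Green's operators is required. The obstacle before all this is that
  \<open>green\<close> and \<open>weak_expectation\<close> are defined by choice. Existence,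
  uniqueness up to null sets, a bound uniform in the potential and measurability in the parameters
  have to be established, and afterwards both are handled only through inner products, where the
  choice of a representative disappears.\<close>

section \<open>Semi-inner products and the Riesz representation\<close>

lemma quadratic_nonneg_imp_discriminant_le:
  fixes a b c :: real
  assumes "\<And>t. 0 \<le> a * t\<^sup>2 + 2 * b * t + c"
  shows "b\<^sup>2 \<le> a * c"
proof -
  have c: "0 \<le> c" using assms[of 0] by simp
  have a: "0 \<le> a"
  proof (rule ccontr)
    assume "\<not> 0 \<le> a"
    hence neg: "a < 0" by simp
    \<comment> \<open>Chosen so that \<open>a * t = a - 2 * |b| - c\<close> with
      \<open>t \<ge> 1\<close>: the quadratic term then absorbs both remaining terms and leaves a
      negative value.\<close>
    define t where "t = 1 + (2 * \<bar>b\<bar> + c) * (1 / (- a))"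
    have t: "t \<ge> 1" using neg c by (simp add: t_def divide_nonneg_neg divide_nonpos_neg zero_le_divide_iff)
    have at: "a * t = a - 2 * \<bar>b\<bar> - c"
      using neg by (simp add: t_def field_simps)
    have "a * t\<^sup>2 + 2 * b * t + c = t * (a * t) + 2 * b * t + c"
      by (simp add: power2_eq_square)
    also have "\<dots> = t * a - 2 * \<bar>b\<bar> * t - c * t + 2 * b * t + c"
      unfolding at by (simp add: algebra_simps)
    also have "\<dots> < 0"
    proof -
      have "t * a < 0" using neg t by (simp add: mult_pos_neg)
      moreover have "b * t \<le> \<bar>b\<bar> * t" using t by (intro mult_right_mono) auto
      moreover have "c * 1 \<le> c * t" using t c by (intro mult_left_mono) auto
      ultimately show ?thesis by linarith
    qed
    finally show False using assms[of t] by simp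
  qed
  show ?thesis
  proof (cases "a = 0")
    case True
    have "b = 0"
    proof (rule ccontr)
      assume "b \<noteq> 0"
      \<comment> \<open>At this point the linear function \<open>2 * b * t + c\<close> takes the
        value -1.\<close>
      thus False using assms[of "- (c + 1) / (2 * b)"] True by (simp add: field_simps)
    qed
    thus ?thesis using True by simp
  next
    case False
    hence "a > 0" using a by simp
    moreover have "0 \<le> a * (- b / a)\<^sup>2 + 2 * b * (- b / a) + c" by (rule assms)
    ultimately show ?thesis by (simp add: field_simps power2_eq_square)
  qed
qed

text \<open>Definiteness is left out because elements of \<open>L^2\<close> are represented by
  functions, and a function vanishing almost everywhere has norm zero. The two instances are
  \<open>L2 \<Omega>\<close> with its inner product and the test functions with the energy form of
  the Dirichlet problem; the second is not complete.\<close>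

locale semi_inner =
  fixes S :: "('x \<Rightarrow> real) set" and B :: "('x \<Rightarrow> real) \<Rightarrow> ('x \<Rightarrow> real) \<Rightarrow> real"
  assumes zero: "(\<lambda>x. 0) \<in> S"
    and add: "\<And>u v. u \<in> S \<Longrightarrow> v \<in> S \<Longrightarrow> (\<lambda>x. u x + v x) \<in> S"
    and scale: "\<And>c u. u \<in> S \<Longrightarrow> (\<lambda>x. c * u x) \<in> S"
    and B_commute: "\<And>u v. u \<in> S \<Longrightarrow> v \<in> S \<Longrightarrow> B u v = B v u"
    and B_add: "\<And>u v w. u \<in> S \<Longrightarrow> v \<in> S \<Longrightarrow> w \<in> S \<Longrightarrow> B (\<lambda>x. u x + v x) w = B u w + B v w"
    and B_scale: "\<And>c u w. u \<in> S \<Longrightarrow> w \<in> S \<Longrightarrow> B (\<lambda>x. c * u x) w = c * B u w"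
    and B_nonneg: "\<And>u. u \<in> S \<Longrightarrow> 0 \<le> B u u"
begin

lemma diff: "u \<in> S \<Longrightarrow> v \<in> S \<Longrightarrow> (\<lambda>x. u x - v x) \<in> S"
  using add[of u "\<lambda>x. -1 * v x"] scale[of v "-1"] by simp

lemma B_add_right: "u \<in> S \<Longrightarrow> v \<in> S \<Longrightarrow> w \<in> S \<Longrightarrow> B w (\<lambda>x. u x + v x) = B w u + B w v"
  using B_commute[of w "\<lambda>x. u x + v x"] B_commute[of w u] B_commute[of w v] by (simp add: B_add add)

lemma B_scale_right: "u \<in> S \<Longrightarrow> w \<in> S \<Longrightarrow> B w (\<lambda>x. c * u x) = c * B w u"
  using B_commute[of w "\<lambda>x. c * u x"] B_commute[of w u] by (simp add: B_scale scale)

lemma B_line: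
  assumes "u \<in> S" "v \<in> S"
  shows "B (\<lambda>x. u x + t * v x) (\<lambda>x. u x + t * v x) = B v v * t\<^sup>2 + 2 * B u v * t + B u u"
  using assms
  by (simp add: B_add B_add_right B_scale B_scale_right add scale B_commute[of v u]
      algebra_simps power2_eq_square)

lemma cauchy_schwarz:
  assumes "u \<in> S" "v \<in> S"
  shows "\<bar>B u v\<bar> \<le> sqrt (B u u) * sqrt (B v v)"
proof -
  have "(B u v)\<^sup>2 \<le> B v v * B u u"
  proof (rule quadratic_nonneg_imp_discriminant_le)
    fix t
    show "0 \<le> B v v * t\<^sup>2 + 2 * B u v * t + B u u"
      using B_nonneg[OF add[OF assms(1) scale[OF assms(2), of t]]] by (simp add: B_line assms)
  qed
  hence "sqrt ((B u v)\<^sup>2) \<le> sqrt (B v v * B u u)" by (rule real_sqrt_le_mono)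
  thus ?thesis by (simp add: real_sqrt_mult mult.commute)
qed

lemma triangle:
  assumes "u \<in> S" "v \<in> S"
  shows "sqrt (B (\<lambda>x. u x + v x) (\<lambda>x. u x + v x)) \<le> sqrt (B u u) + sqrt (B v v)"
proof (rule real_le_lsqrt)
  have "B (\<lambda>x. u x + v x) (\<lambda>x. u x + v x) = B v v + 2 * B u v + B u u"
    using B_line[OF assms, of 1] by simp
  also have "\<dots> \<le> B v v + 2 * (sqrt (B u u) * sqrt (B v v)) + B u u"
    using cauchy_schwarz[OF assms] by simp
  also have "\<dots> = (sqrt (B u u) + sqrt (B v v))\<^sup>2"
    using B_nonneg assms by (simp add: power2_sum)
  finally show "B (\<lambda>x. u x + v x) (\<lambda>x. u x + v x) \<le> (sqrt (B u u) + sqrt (B v v))\<^sup>2" .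
qed (use B_nonneg assms in auto)

text \<open>The Riesz representation theorem without completeness: the minimising sequence of
  \<open>B u u - 2 l u\<close> is Cauchy by the parallelogram law, and represents \<open>l\<close> in the limit.\<close>

lemma riesz_sequence:
  assumes l_add: "\<And>u v. u \<in> S \<Longrightarrow> v \<in> S \<Longrightarrow> l (\<lambda>x. u x + v x) = l u + l v"
    and l_scale: "\<And>c u. u \<in> S \<Longrightarrow> l (\<lambda>x. c * u x) = c * l u"
    and l_bound: "\<And>u. u \<in> S \<Longrightarrow> \<bar>l u\<bar> \<le> C * sqrt (B u u)"
  shows "\<exists>u :: nat \<Rightarrow> 'x \<Rightarrow> real. (\<forall>k. u k \<in> S) \<and>
    (\<forall>m n. B (\<lambda>x. u m x - u n x) (\<lambda>x. u m x - u n x) \<le> 2 * (1 / Suc m + 1 / Suc n)) \<and>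
    (\<forall>v\<in>S. (\<lambda>k. B (u k) v) \<longlonglongrightarrow> l v)"
proof -
  \<comment> \<open>The energy functional: if \<open>B u v = l v\<close> for all \<open>v\<close>,
    then \<open>J\<close> differs from the squared distance to \<open>u\<close> by a
    constant.\<close>
  define J where "J u = B u u - 2 * l u" for u
  define d where "d = Inf (J ` S)"
  have J_lower: "- (C\<^sup>2) \<le> J u" if "u \<in> S" for u
  proof -
    have "0 \<le> (sqrt (B u u) - C)\<^sup>2" by simp
    also have "\<dots> = B u u - 2 * (C * sqrt (B u u)) + C\<^sup>2"
      using B_nonneg[OF that] by (simp add: power2_diff)
    also have "\<dots> \<le> B u u - 2 * l u + C\<^sup>2" using l_bound[OF that] by linarith
    finally show ?thesis by (simp add: J_def)
  qed
  have bdd: "bdd_below (J ` S)" using J_lower by (auto simp: bdd_below_def)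
  have d_le: "d \<le> J u" if "u \<in> S" for u
    unfolding d_def using that bdd by (intro cInf_lower) auto
  have "\<exists>u\<in>S. J u < d + 1 / Suc k" for k :: nat
    using cInf_lessD[of "J ` S" "d + 1 / Suc k"] zero by (auto simp: d_def)
  then obtain u where u: "\<And>k. u k \<in> S" "\<And>k::nat. J (u k) < d + 1 / Suc k" by metis
  have J_line: "J (\<lambda>x. w x + t * v x) = J w + B v v * t\<^sup>2 + 2 * (B w v - l v) * t"
    if "w \<in> S" "v \<in> S" for w v t
    using that by (simp add: J_def B_line l_add l_scale scale algebra_simps)
  show ?thesis
  proof (intro exI conjI allI ballI)
    show "u k \<in> S" for k by (rule u)
    show "B (\<lambda>x. u m x - u n x) (\<lambda>x. u m x - u n x) \<le> 2 * (1 / Suc m + 1 / Suc n)" for m n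
    proof -
      let ?w = "\<lambda>x. u m x - u n x"
      have w: "?w \<in> S" by (intro diff u)
      have "J (\<lambda>x. u n x + 1 * ?w x) = J (u n) + B ?w ?w + 2 * (B (u n) ?w - l ?w)"
        using J_line[OF u(1) w, of n 1] by simp
      hence 1: "J (u m) = J (u n) + B ?w ?w + 2 * (B (u n) ?w - l ?w)" by simp
      \<comment> \<open>This is the midpoint of \<open>u m\<close> and \<open>u n\<close>.
        Eliminating the linear term with the help of fact 1 gives
        \<open>B ?w ?w \<le> 2 * ((J (u m) - d) + (J (u n) - d))\<close>.\<close>
      have "d \<le> J (\<lambda>x. u n x + (1/2) * ?w x)" by (intro d_le add scale u w)
      also have "\<dots> = J (u n) + B ?w ?w / 4 + (B (u n) ?w - l ?w)"
        by (subst J_line[OF u(1) w]) (simp add: power2_eq_square)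
      finally show ?thesis using 1 u(2)[of m] u(2)[of n] by (simp add: distrib_left)
    qed
    show "(\<lambda>k. B (u k) v) \<longlonglongrightarrow> l v" if v: "v \<in> S" for v
    proof -
      have est: "\<bar>B (u k) v - l v\<bar> \<le> sqrt (B v v * (1 / Suc k))" for k
      proof -
        have "(B (u k) v - l v)\<^sup>2 \<le> B v v * (1 / Suc k)"
        proof (rule quadratic_nonneg_imp_discriminant_le)
          fix t
          \<comment> \<open>Along every line through \<open>u k\<close> the functional drops by at
            most \<open>1 / Suc k\<close>, so a quadratic in \<open>t\<close> is nonnegative and its
            discriminant bounds the defect \<open>B (u k) v - l v\<close>.\<close>
          have "d \<le> J (\<lambda>x. u k x + t * v x)" by (intro d_le add scale u v)
          thus "0 \<le> B v v * t\<^sup>2 + 2 * (B (u k) v - l v) * t + 1 / Suc k"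
            using u(2)[of k] by (subst (asm) J_line[OF u(1) v]) simp
        qed
        hence "sqrt ((B (u k) v - l v)\<^sup>2) \<le> sqrt (B v v * (1 / Suc k))" by (rule real_sqrt_le_mono)
        thus ?thesis by simp
      qed
      have "(\<lambda>k. sqrt (B v v * (1 / Suc k))) \<longlonglongrightarrow> sqrt (B v v * 0)"
        using LIMSEQ_inverse_real_of_nat unfolding inverse_eq_divide
        by (rule tendsto_real_sqrt[OF tendsto_mult_left])
      hence "(\<lambda>k. sqrt (B v v * (1 / Suc k))) \<longlonglongrightarrow> 0" by simp
      hence "(\<lambda>k. B (u k) v - l v) \<longlonglongrightarrow> 0"
        by (rule Lim_null_comparison[rotated]) (use est in \<open>simp only: real_norm_def eventually_True\<close>)
      thus ?thesis by (rule LIM_zero_cancel)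
    qed
  qed
qed

end

subsection \<open>Square integrable functions\<close>

lemma L2_measurable: "f \<in> L2 \<Omega> \<Longrightarrow> f \<in> borel_measurable (lebesgue_on \<Omega>)"
  by (simp add: L2_def)

lemma L2_mult_integrable:
  assumes "f \<in> L2 \<Omega>" "g \<in> L2 \<Omega>"
  shows "integrable (lebesgue_on \<Omega>) (\<lambda>x. f x * g x)"
proof (rule Bochner_Integration.integrable_bound)
  show "integrable (lebesgue_on \<Omega>) (\<lambda>x. (f x)\<^sup>2 + (g x)\<^sup>2)"
    using assms by (auto simp: L2_def)
  show "(\<lambda>x. f x * g x) \<in> borel_measurable (lebesgue_on \<Omega>)"
    using assms by (auto simp: L2_def)
  have "\<bar>a * b\<bar> \<le> a\<^sup>2 + b\<^sup>2" for a b :: real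
  proof -
    have "2 * (\<bar>a\<bar> * \<bar>b\<bar>) \<le> \<bar>a\<bar>\<^sup>2 + \<bar>b\<bar>\<^sup>2" using sum_squares_bound[of "\<bar>a\<bar>" "\<bar>b\<bar>"] by simp
    moreover have "0 \<le> \<bar>a\<bar> * \<bar>b\<bar>" by simp
    ultimately show ?thesis unfolding abs_mult power2_abs by linarith
  qed
  thus "AE x in lebesgue_on \<Omega>. norm (f x * g x) \<le> norm ((f x)\<^sup>2 + (g x)\<^sup>2)" by auto
qed

lemma L2_add: "f \<in> L2 \<Omega> \<Longrightarrow> g \<in> L2 \<Omega> \<Longrightarrow> (\<lambda>x. f x + g x) \<in> L2 \<Omega>"
  using L2_mult_integrable[of f \<Omega> g] by (auto simp: L2_def power2_sum mult.assoc)

lemma L2_scale: "f \<in> L2 \<Omega> \<Longrightarrow> (\<lambda>x. c * f x) \<in> L2 \<Omega>"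
  by (auto simp: L2_def power_mult_distrib)

lemma L2_zero: "(\<lambda>x. 0) \<in> L2 \<Omega>"
  by (auto simp: L2_def)

interpretation L2: semi_inner "L2 \<Omega>" "L2_inner \<Omega>" for \<Omega> :: "(real^'n::finite) set"
proof
  fix u v w :: "real^'n \<Rightarrow> real" and c
  show "L2_inner \<Omega> u v = L2_inner \<Omega> v u" by (simp add: L2_inner_def mult.commute)
  show "0 \<le> L2_inner \<Omega> u u" by (simp add: L2_inner_def)
  show "L2_inner \<Omega> (\<lambda>x. c * u x) w = c * L2_inner \<Omega> u w" by (simp add: L2_inner_def mult.assoc)
  show "L2_inner \<Omega> (\<lambda>x. u x + v x) w = L2_inner \<Omega> u w + L2_inner \<Omega> v w"
    if "u \<in> L2 \<Omega>" "v \<in> L2 \<Omega>" "w \<in> L2 \<Omega>"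
    using that by (simp add: L2_inner_def distrib_right L2_mult_integrable)
qed (auto intro: L2_add L2_scale L2_zero)

lemma L2_inner_diff:
  "u \<in> L2 \<Omega> \<Longrightarrow> v \<in> L2 \<Omega> \<Longrightarrow> w \<in> L2 \<Omega> \<Longrightarrow>
    L2_inner \<Omega> (\<lambda>x. u x - v x) w = L2_inner \<Omega> u w - L2_inner \<Omega> v w"
  by (simp add: L2_inner_def left_diff_distrib L2_mult_integrable)

lemma L2_sum: "(\<And>i. i \<in> I \<Longrightarrow> f i \<in> L2 \<Omega>) \<Longrightarrow> (\<lambda>x. \<Sum>i\<in>I. f i x) \<in> L2 \<Omega>"
  by (induction I rule: infinite_finite_induct) (auto intro: L2_add L2_zero)

lemma L2_inner_sum:
  "(\<And>i. i \<in> I \<Longrightarrow> f i \<in> L2 \<Omega>) \<Longrightarrow> g \<in> L2 \<Omega> \<Longrightarrow>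
    L2_inner \<Omega> (\<lambda>x. \<Sum>i\<in>I. f i x) g = (\<Sum>i\<in>I. L2_inner \<Omega> (f i) g)"
  by (simp add: L2_inner_def sum_distrib_right L2_mult_integrable)

lemma L2_norm_nonneg: "0 \<le> L2_norm \<Omega> f"
  by (simp add: L2_norm_def L2.B_nonneg L2_inner_def)

lemma L2_norm_power2: "(L2_norm \<Omega> f)\<^sup>2 = L2_inner \<Omega> f f"
  by (simp add: L2_norm_def L2_inner_def)

lemma L2_cauchy_schwarz:
  "f \<in> L2 \<Omega> \<Longrightarrow> g \<in> L2 \<Omega> \<Longrightarrow> \<bar>L2_inner \<Omega> f g\<bar> \<le> L2_norm \<Omega> f * L2_norm \<Omega> g"
  unfolding L2_norm_def by (rule L2.cauchy_schwarz)

lemma L2_triangle: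
  "f \<in> L2 \<Omega> \<Longrightarrow> g \<in> L2 \<Omega> \<Longrightarrow> L2_norm \<Omega> (\<lambda>x. f x + g x) \<le> L2_norm \<Omega> f + L2_norm \<Omega> g"
  unfolding L2_norm_def by (rule L2.triangle)

lemma L2_norm_minus_commute: "L2_norm \<Omega> (\<lambda>x. f x - g x) = L2_norm \<Omega> (\<lambda>x. g x - f x)"
  by (simp add: L2_norm_def L2_inner_def flip: power2_eq_square) (simp add: power2_commute)

lemma L2_inner_tendsto:
  assumes "\<And>k. f k \<in> L2 \<Omega>" "f' \<in> L2 \<Omega>" "(\<lambda>k. L2_norm \<Omega> (\<lambda>x. f k x - f' x)) \<longlonglongrightarrow> 0"
    and "g \<in> L2 \<Omega>"
  shows "(\<lambda>k. L2_inner \<Omega> (f k) g) \<longlonglongrightarrow> L2_inner \<Omega> f' g"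
proof -
  have "(\<lambda>k. L2_inner \<Omega> (f k) g - L2_inner \<Omega> f' g) \<longlonglongrightarrow> 0"
  proof (rule Lim_null_comparison)
    show "(\<lambda>k. L2_norm \<Omega> (\<lambda>x. f k x - f' x) * L2_norm \<Omega> g) \<longlonglongrightarrow> 0"
      using tendsto_mult_right[OF assms(3), of "L2_norm \<Omega> g"] by simp
    show "\<forall>\<^sub>F k in sequentially. norm (L2_inner \<Omega> (f k) g - L2_inner \<Omega> f' g)
        \<le> L2_norm \<Omega> (\<lambda>x. f k x - f' x) * L2_norm \<Omega> g"
      using L2_cauchy_schwarz[OF L2.diff[OF assms(1,2)] assms(4)]
      by (intro always_eventually allI) (simp add: L2_inner_diff assms)
  qed
  thus ?thesis by (simp add: LIM_zero_iff)
qed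

lemma L2_norm_tendsto:
  assumes "\<And>k. f k \<in> L2 \<Omega>" "f' \<in> L2 \<Omega>" "(\<lambda>k. L2_norm \<Omega> (\<lambda>x. f k x - f' x)) \<longlonglongrightarrow> 0"
  shows "(\<lambda>k. L2_norm \<Omega> (f k)) \<longlonglongrightarrow> L2_norm \<Omega> f'"
proof -
  have "(\<lambda>k. L2_norm \<Omega> (f k) - L2_norm \<Omega> f') \<longlonglongrightarrow> 0"
  proof (rule Lim_null_comparison[OF _ assms(3)], intro always_eventually allI)
    fix k
    have "L2_norm \<Omega> (f k) \<le> L2_norm \<Omega> (\<lambda>x. f k x - f' x) + L2_norm \<Omega> f'"
      using L2_triangle[OF L2.diff[OF assms(1,2)] assms(2), of k] by simp
    moreover have "L2_norm \<Omega> f' \<le> L2_norm \<Omega> (\<lambda>x. f k x - f' x) + L2_norm \<Omega> (f k)"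
      using L2_triangle[OF L2.diff[OF assms(2) assms(1)] assms(1), of k k]
      by (simp add: L2_norm_minus_commute[of _ "f k"])
    ultimately show "norm (L2_norm \<Omega> (f k) - L2_norm \<Omega> f') \<le> L2_norm \<Omega> (\<lambda>x. f k x - f' x)"
      by simp
  qed
  thus ?thesis by (simp add: LIM_zero_iff)
qed

lemma L2_bounded_mult:
  assumes "f \<in> L2 \<Omega>" "q \<in> borel_measurable (lebesgue_on \<Omega>)"
    and B: "\<And>x. x \<in> \<Omega> \<Longrightarrow> \<bar>q x\<bar> \<le> B"
  shows "(\<lambda>x. q x * f x) \<in> L2 \<Omega>" "L2_norm \<Omega> (\<lambda>x. q x * f x) \<le> B * L2_norm \<Omega> f"
proof -
  have sq: "(q x * f x)\<^sup>2 \<le> B\<^sup>2 * (f x)\<^sup>2" if "x \<in> \<Omega>" for x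
  proof -
    have "(q x)\<^sup>2 \<le> B\<^sup>2" using B[OF that] by (metis abs_ge_zero power2_abs power_mono)
    thus ?thesis by (simp add: power_mult_distrib mult_right_mono)
  qed
  have int: "integrable (lebesgue_on \<Omega>) (\<lambda>x. (q x * f x)\<^sup>2)"
  proof (rule Bochner_Integration.integrable_bound)
    show "integrable (lebesgue_on \<Omega>) (\<lambda>x. B\<^sup>2 * (f x)\<^sup>2)" using assms by (auto simp: L2_def)
    show "(\<lambda>x. (q x * f x)\<^sup>2) \<in> borel_measurable (lebesgue_on \<Omega>)" using assms by (auto simp: L2_def)
    show "AE x in lebesgue_on \<Omega>. norm ((q x * f x)\<^sup>2) \<le> norm (B\<^sup>2 * (f x)\<^sup>2)"
      using sq by (intro AE_I2) (auto simp: space_restrict_space)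
  qed
  thus "(\<lambda>x. q x * f x) \<in> L2 \<Omega>" using assms by (auto simp: L2_def)
  have le: "L2_inner \<Omega> (\<lambda>x. q x * f x) (\<lambda>x. q x * f x) \<le> B\<^sup>2 * L2_inner \<Omega> f f"
  proof -
    have "(\<integral>x. (q x * f x)\<^sup>2 \<partial>lebesgue_on \<Omega>) \<le> (\<integral>x. B\<^sup>2 * (f x)\<^sup>2 \<partial>lebesgue_on \<Omega>)"
      using assms int sq by (intro integral_mono) (auto simp: L2_def space_restrict_space)
    thus ?thesis by (simp add: L2_inner_def power2_eq_square)
  qed
  show "L2_norm \<Omega> (\<lambda>x. q x * f x) \<le> B * L2_norm \<Omega> f"
  \<comment> \<open>On the empty set the bound on \<open>q\<close> says nothing and \<open>B\<close>
    may be negative; both norms are zero there.\<close>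
  proof (cases "\<Omega> = {}")
    case True
    have "space (lebesgue_on \<Omega>) = {}" using True by (simp add: space_restrict_space)
    thus ?thesis by (simp add: L2_norm_def L2_inner_def integral_empty)
  next
    case False
    hence "0 \<le> B" using B by fastforce
    have "sqrt (L2_inner \<Omega> (\<lambda>x. q x * f x) (\<lambda>x. q x * f x)) \<le> sqrt (B\<^sup>2 * L2_inner \<Omega> f f)"
      using le by (rule real_sqrt_le_mono)
    thus ?thesis using \<open>0 \<le> B\<close> by (simp add: L2_norm_def real_sqrt_mult)
  qed
qed

section \<open>Completeness and the Riesz theorem on sets of finite measure\<close>

lemma L2_const:
  "finite_measure (lebesgue_on \<Omega>) \<Longrightarrow> (\<lambda>x. c) \<in> L2 \<Omega>"
  by (simp add: L2_def finite_measure.integrable_const)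

lemma L2_abs: "f \<in> L2 \<Omega> \<Longrightarrow> (\<lambda>x. \<bar>f x\<bar>) \<in> L2 \<Omega>"
  by (auto simp: L2_def)

lemma L2_norm_abs: "L2_norm \<Omega> (\<lambda>x. \<bar>f x\<bar>) = L2_norm \<Omega> f"
  by (simp add: L2_norm_def L2_inner_def)

lemma L2_integral_abs_le:
  assumes "finite_measure (lebesgue_on \<Omega>)" "f \<in> L2 \<Omega>"
  shows "integrable (lebesgue_on \<Omega>) (\<lambda>x. \<bar>f x\<bar>)"
    and "(\<integral>x. \<bar>f x\<bar> \<partial>lebesgue_on \<Omega>) \<le> L2_norm \<Omega> f * L2_norm \<Omega> (\<lambda>x. 1)"
  using L2_mult_integrable[OF L2_abs[OF assms(2)] L2_const[OF assms(1), of 1]]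
    L2_cauchy_schwarz[OF L2_abs[OF assms(2)] L2_const[OF assms(1), of 1]]
  by (auto simp: L2_norm_abs L2_inner_def)

text \<open>The Riesz-Fischer argument: along a rapidly Cauchy subsequence the increments have
  summable \<open>L^2\<close> norms, hence summable \<open>L^1\<close> norms because the measure is
  finite, so the subsequence converges almost everywhere. Fatou's lemma carries the Cauchy bound
  over to the limit, and the full sequence follows its subsequence.\<close>

lemma L2_complete:
  fixes f :: "nat \<Rightarrow> real^'n::finite \<Rightarrow> real"
  assumes fin: "finite_measure (lebesgue_on \<Omega>)" and f: "\<And>k. f k \<in> L2 \<Omega>"
    and cauchy: "\<And>e. 0 < e \<Longrightarrow> \<exists>K. \<forall>m\<ge>K. \<forall>n\<ge>K. L2_norm \<Omega> (\<lambda>x. f m x - f n x) < e"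
  obtains f' where "f' \<in> L2 \<Omega>" "(\<lambda>k. L2_norm \<Omega> (\<lambda>x. f k x - f' x)) \<longlonglongrightarrow> 0"
proof -
  let ?M = "lebesgue_on \<Omega>"
  have "\<exists>K. \<forall>m\<ge>K. \<forall>n\<ge>K. L2_norm \<Omega> (\<lambda>x. f m x - f n x) < (1/2)^j" for j :: nat
    by (rule cauchy) simp
  then obtain K where K: "\<And>j m n. K j \<le> m \<Longrightarrow> K j \<le> n \<Longrightarrow>
      L2_norm \<Omega> (\<lambda>x. f m x - f n x) < (1/2)^j" by metis
  \<comment> \<open>Partial sums give indices that dominate all earlier \<open>K j\<close> at once,
    without arranging \<open>K\<close> to be monotone.\<close>
  define s where "s j = (\<Sum>i\<le>j. K i)" for j
  have Ks: "K j \<le> s i" if "j \<le> i" for i j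
    unfolding s_def using that by (intro member_le_sum) auto
  define v where "v j = f (s j)" for j
  have v: "v j \<in> L2 \<Omega>" for j by (simp add: v_def f)
  have [measurable]: "v j \<in> borel_measurable ?M" for j by (rule L2_measurable[OF v])
  define w where "w j x = v (Suc j) x - v j x" for j x
  have w: "w j \<in> L2 \<Omega>" for j unfolding w_def by (intro L2.diff v)
  have [measurable]: "w j \<in> borel_measurable ?M" for j by (rule L2_measurable[OF w])
  define c where "c = L2_norm \<Omega> (\<lambda>x. 1)"
  have c: "0 \<le> c" by (simp add: c_def L2_norm_nonneg)
  have "(\<integral>\<^sup>+x. (\<Sum>j. ennreal \<bar>w j x\<bar>) \<partial>?M) = (\<Sum>j. \<integral>\<^sup>+x. ennreal \<bar>w j x\<bar> \<partial>?M)"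
    by (rule nn_integral_suminf) simp
  also have "\<dots> \<le> (\<Sum>j. ennreal ((1/2)^j * c))"
  proof (rule suminf_le)
    fix j
    have "L2_norm \<Omega> (w j) \<le> (1/2)^j"
      unfolding w_def v_def by (intro less_imp_le[OF K] Ks) auto
    hence "L2_norm \<Omega> (w j) * c \<le> (1/2)^j * c" by (rule mult_right_mono[OF _ c])
    hence "(\<integral>x. \<bar>w j x\<bar> \<partial>?M) \<le> (1/2)^j * c"
      using L2_integral_abs_le(2)[OF fin w, of j] unfolding c_def by (rule order_trans[rotated])
    thus "(\<integral>\<^sup>+x. ennreal \<bar>w j x\<bar> \<partial>?M) \<le> ennreal ((1/2)^j * c)"
      using L2_integral_abs_le(1)[OF fin w, of j]
      by (simp add: nn_integral_eq_integral ennreal_leI)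
  qed auto
  also have "\<dots> = ennreal (\<Sum>j. (1/2)^j * c)"
    using c by (intro suminf_ennreal2 summable_mult2 summable_geometric) auto
  also have "\<dots> < \<infinity>" by simp
  finally have "(\<integral>\<^sup>+x. (\<Sum>j. ennreal \<bar>w j x\<bar>) \<partial>?M) \<noteq> \<infinity>" by simp
  hence "AE x in ?M. (\<Sum>j. ennreal \<bar>w j x\<bar>) \<noteq> \<infinity>"
    by (intro nn_integral_PInf_AE) auto
  hence conv: "AE x in ?M. convergent (\<lambda>j. v j x)"
  proof eventually_elim
    case (elim x)
    have "summable (\<lambda>j. \<bar>w j x\<bar>)"
      using elim by (intro summable_suminf_not_top) auto
    hence "(\<lambda>n. \<Sum>j<n. w j x) \<longlonglongrightarrow> (\<Sum>j. w j x)"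
      by (rule summable_LIMSEQ[OF summable_rabs_cancel])
    moreover have "(\<Sum>j<n. w j x) = v n x - v 0 x" for n
      unfolding w_def by (rule sum_lessThan_telescope)
    ultimately have "(\<lambda>n. (v n x - v 0 x) + v 0 x) \<longlonglongrightarrow> (\<Sum>j. w j x) + v 0 x"
      by (intro tendsto_add) auto
    thus ?case by (auto simp: convergent_def)
  qed
  define u where "u x = lim (\<lambda>j. v j x)" for x
  have [measurable]: "u \<in> borel_measurable ?M" unfolding u_def by measurable
  have lim: "AE x in ?M. (\<lambda>j. v j x) \<longlonglongrightarrow> u x"
    using conv by eventually_elim (simp add: u_def convergent_LIMSEQ_iff)
  \<comment> \<open>The second index \<open>i\<close> of the Cauchy bound is sent to infinity while
    \<open>j\<close> stays fixed.\<close>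
  have fatou: "(\<integral>\<^sup>+x. ennreal ((v j x - u x)\<^sup>2) \<partial>?M) \<le> ennreal (((1/2)^j)\<^sup>2)" for j
  proof -
    have "(\<integral>\<^sup>+x. ennreal ((v j x - u x)\<^sup>2) \<partial>?M)
        = (\<integral>\<^sup>+x. liminf (\<lambda>i. ennreal ((v j x - v i x)\<^sup>2)) \<partial>?M)"
    proof (rule nn_integral_cong_AE, use lim in eventually_elim)
      case (elim x)
      have "(\<lambda>i. ennreal ((v j x - v i x)\<^sup>2)) \<longlonglongrightarrow> ennreal ((v j x - u x)\<^sup>2)"
        by (intro tendsto_ennrealI tendsto_power tendsto_diff tendsto_const elim)
      thus ?case by (intro sym[OF lim_imp_Liminf]) auto
    qed
    also have "\<dots> \<le> liminf (\<lambda>i. \<integral>\<^sup>+x. ennreal ((v j x - v i x)\<^sup>2) \<partial>?M)"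
      by (rule nn_integral_liminf) measurable
    also have "\<dots> \<le> ennreal (((1/2)^j)\<^sup>2)"
    proof (rule Liminf_le)
      show "\<forall>\<^sub>F i in sequentially. (\<integral>\<^sup>+x. ennreal ((v j x - v i x)\<^sup>2) \<partial>?M) \<le> ennreal (((1/2)^j)\<^sup>2)"
        using eventually_ge_at_top[of j]
      proof eventually_elim
        case (elim i)
        have d: "(\<lambda>x. v j x - v i x) \<in> L2 \<Omega>" by (intro L2.diff v)
        have "L2_norm \<Omega> (\<lambda>x. v j x - v i x) < (1/2)^j"
          unfolding v_def using elim by (intro K Ks) auto
        hence "(L2_norm \<Omega> (\<lambda>x. v j x - v i x))\<^sup>2 \<le> ((1/2)^j)\<^sup>2"
          by (intro power_mono L2_norm_nonneg) simp
        hence "(\<integral>x. (v j x - v i x)\<^sup>2 \<partial>?M) \<le> ((1/2)^j)\<^sup>2"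
          unfolding L2_norm_power2 L2_inner_def by (simp only: power2_eq_square)
        moreover have "integrable ?M (\<lambda>x. (v j x - v i x)\<^sup>2)" using d by (simp add: L2_def)
        ultimately show ?case by (simp add: nn_integral_eq_integral ennreal_leI)
      qed
    qed simp
    finally show ?thesis .
  qed
  have vu: "(\<lambda>x. v j x - u x) \<in> L2 \<Omega>" for j
  proof -
    have "integrable ?M (\<lambda>x. (v j x - u x)\<^sup>2)"
      using fatou[of j] by (intro integrableI_bounded) (auto simp: le_less_trans)
    thus ?thesis by (simp add: L2_def)
  qed
  have vu_norm: "L2_norm \<Omega> (\<lambda>x. v j x - u x) \<le> (1/2)^j" for j
  proof -
    have int: "integrable ?M (\<lambda>x. (v j x - u x)\<^sup>2)" using vu[of j] by (simp add: L2_def)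
    have "ennreal (\<integral>x. (v j x - u x)\<^sup>2 \<partial>?M) \<le> ennreal (((1/2)^j)\<^sup>2)"
      using fatou[of j] int by (simp add: nn_integral_eq_integral)
    hence "(\<integral>x. (v j x - u x)\<^sup>2 \<partial>?M) \<le> ((1/2)^j)\<^sup>2" by (subst (asm) ennreal_le_iff) auto
    hence "(L2_norm \<Omega> (\<lambda>x. v j x - u x))\<^sup>2 \<le> ((1/2)^j)\<^sup>2"
      unfolding L2_norm_power2 L2_inner_def by (simp only: power2_eq_square)
    thus ?thesis by (rule power2_le_imp_le) simp
  qed
  have u: "u \<in> L2 \<Omega>" using L2.diff[OF v[of 0] vu[of 0]] by simp
  show thesis
  proof (rule that[OF u], rule LIMSEQ_I)
    fix r :: real assume "0 < r"
    then obtain j where j: "(1/2)^j < r / 2" using real_arch_pow_inv[of "r/2" "1/2"] by auto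
    have "L2_norm \<Omega> (\<lambda>x. f k x - u x) < r" if "s j \<le> k" for k
    proof -
      have "L2_norm \<Omega> (\<lambda>x. (f k x - v j x) + (v j x - u x))
          \<le> L2_norm \<Omega> (\<lambda>x. f k x - v j x) + L2_norm \<Omega> (\<lambda>x. v j x - u x)"
        by (intro L2_triangle L2.diff f v vu)
      moreover have "L2_norm \<Omega> (\<lambda>x. f k x - v j x) < (1/2)^j"
        unfolding v_def using that Ks[of j j] by (intro K) auto
      ultimately show ?thesis using vu_norm[of j] j by simp
    qed
    thus "\<exists>no. \<forall>n\<ge>no. norm (L2_norm \<Omega> (\<lambda>x. f n x - u x) - 0) < r"
      by (auto simp: L2_norm_nonneg)
  qed
qed

text \<open>Links the quantitative bound produced by \<open>riesz_sequence\<close> to the hypothesis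
  of \<open>L2_complete\<close>.\<close>

lemma cauchy_seqI_inverse_Suc:
  fixes D :: "nat \<Rightarrow> nat \<Rightarrow> real"
  assumes "\<And>m n. (D m n)\<^sup>2 \<le> C * (1 / Suc m + 1 / Suc n)" and "0 < e"
  shows "\<exists>K. \<forall>m\<ge>K. \<forall>n\<ge>K. D m n < e"
proof -
  define C' where "C' = \<bar>C\<bar> + 1"
  have C': "0 < C'" "C \<le> C'" by (auto simp: C'_def)
  obtain K :: nat where "2 * C' / e\<^sup>2 < K" using reals_Archimedean2 by blast
  hence K: "2 * C' / e\<^sup>2 < Suc K" by simp
  have "D m n < e" if "K \<le> m" "K \<le> n" for m n
  proof (rule ccontr)
    assume "\<not> D m n < e"
    hence "e\<^sup>2 \<le> (D m n)\<^sup>2" using \<open>0 < e\<close> by (intro power_mono) auto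
    also have "\<dots> \<le> C * (1 / Suc m + 1 / Suc n)" by (rule assms)
    also have "\<dots> \<le> C' * (1 / Suc K + 1 / Suc K)"
      using that C' by (intro mult_mono add_mono divide_left_mono) auto
    finally have "e\<^sup>2 * Suc K \<le> 2 * C'" by (simp add: field_simps)
    moreover have "2 * C' < e\<^sup>2 * Suc K" using K \<open>0 < e\<close> by (simp add: field_simps)
    ultimately show False by simp
  qed
  thus ?thesis by blast
qed

text \<open>Provides the witness for the choice in \<open>weak_expectation\<close>: the expected
  inner product is a bounded linear functional of its second argument.\<close>

lemma L2_riesz:
  fixes \<Omega> :: "(real^'n::finite) set"
  assumes fin: "finite_measure (lebesgue_on \<Omega>)"
    and "\<And>u v. u \<in> L2 \<Omega> \<Longrightarrow> v \<in> L2 \<Omega> \<Longrightarrow> l (\<lambda>x. u x + v x) = l u + l v"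
    and "\<And>c u. u \<in> L2 \<Omega> \<Longrightarrow> l (\<lambda>x. c * u x) = c * l u"
    and "\<And>u. u \<in> L2 \<Omega> \<Longrightarrow> \<bar>l u\<bar> \<le> C * L2_norm \<Omega> u"
  shows "\<exists>h\<in>L2 \<Omega>. \<forall>g\<in>L2 \<Omega>. L2_inner \<Omega> h g = l g"
proof -
  obtain u :: "nat \<Rightarrow> real^'n \<Rightarrow> real" where u: "\<And>k. u k \<in> L2 \<Omega>"
    and d: "\<And>m n. L2_inner \<Omega> (\<lambda>x. u m x - u n x) (\<lambda>x. u m x - u n x) \<le> 2 * (1 / Suc m + 1 / Suc n)"
    and lim: "\<And>v. v \<in> L2 \<Omega> \<Longrightarrow> (\<lambda>k. L2_inner \<Omega> (u k) v) \<longlonglongrightarrow> l v"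
    using L2.riesz_sequence[of \<Omega> l C] assms(2-4) unfolding L2_norm_def by blast
  obtain h where h: "h \<in> L2 \<Omega>" "(\<lambda>k. L2_norm \<Omega> (\<lambda>x. u k x - h x)) \<longlonglongrightarrow> 0"
    by (rule L2_complete[OF fin u cauchy_seqI_inverse_Suc[OF d[folded L2_norm_power2]]])
  show ?thesis
  proof (rule bexI[OF _ h(1)], rule ballI)
    fix g assume g: "g \<in> L2 \<Omega>"
    show "L2_inner \<Omega> h g = l g"
      by (rule LIMSEQ_unique[OF L2_inner_tendsto[OF u h g] lim[OF g]])
  qed
qed

subsection \<open>Calculus of smooth functions\<close>

lemma partial_deriv_eqI:
  "(f has_derivative f') (at x) \<Longrightarrow> partial_deriv i f x = f' (axis i 1)"
  by (simp add: partial_deriv_def flip: frechet_derivative_at)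

lemma partial_deriv_const [simp]: "partial_deriv i (\<lambda>x. c) = (\<lambda>x. 0)"
  by (simp add: partial_deriv_def fun_eq_iff)

lemma partial_deriv_coord: "partial_deriv i (\<lambda>x :: real^'n::finite. x $ j) = (\<lambda>x. if i = j then 1 else 0)"
proof
  fix x :: "real^'n"
  have "((\<lambda>x. x $ j) has_derivative (\<lambda>h. h $ j)) (at x)"
    by (rule bounded_linear_imp_has_derivative[OF bounded_linear_vec_nth])
  thus "partial_deriv i (\<lambda>x. x $ j) x = (if i = j then 1 else 0)"
    by (auto simp: partial_deriv_eqI axis_def)
qed

lemma partial_deriv_add:
  assumes "f differentiable at x" "g differentiable at x"
  shows "partial_deriv i (\<lambda>x. f x + g x) x = partial_deriv i f x + partial_deriv i g x"
  using partial_deriv_eqI[OF has_derivative_add[OF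
        assms(1)[unfolded frechet_derivative_works] assms(2)[unfolded frechet_derivative_works]], of i]
  by (simp add: partial_deriv_def)

lemma partial_deriv_mult:
  assumes "f differentiable at x" "g differentiable at x"
  shows "partial_deriv i (\<lambda>x. f x * g x) x = f x * partial_deriv i g x + partial_deriv i f x * g x"
  using partial_deriv_eqI[OF has_derivative_mult[OF
        assms(1)[unfolded frechet_derivative_works] assms(2)[unfolded frechet_derivative_works]], of i]
  by (simp add: partial_deriv_def)

lemma partial_deriv_cmult:
  assumes "f differentiable at x"
  shows "partial_deriv i (\<lambda>x. c * f x) x = c * partial_deriv i f x"
  using partial_deriv_mult[OF differentiable_const assms] by simp

lemma has_derivative_real_comp:
  assumes "(h has_real_derivative h') (at (f x))" "f differentiable at x"
  shows "((\<lambda>x. h (f x)) has_derivative (\<lambda>v. h' * frechet_derivative f (at x) v)) (at x)"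
  using has_derivative_compose[OF assms(2)[unfolded frechet_derivative_works]
      assms(1)[unfolded has_field_derivative_def]] by simp

lemma partial_deriv_comp:
  assumes "(h has_real_derivative h') (at (f x))" "f differentiable at x"
  shows "partial_deriv i (\<lambda>x. h (f x)) x = h' * partial_deriv i f x"
  using partial_deriv_eqI[OF has_derivative_real_comp[OF assms], of i] by (simp add: partial_deriv_def)

lemma differentiable_cong_open:
  assumes "f differentiable at x" "open S" "x \<in> S" "\<And>x. x \<in> S \<Longrightarrow> f x = g x"
  shows "g differentiable at x" "partial_deriv i g x = partial_deriv i f x"
proof -
  show "g differentiable at x"
    using assms has_derivative_transform_within_open[of f _ x UNIV S g]
    by (auto simp: differentiable_def)
  show "partial_deriv i g x = partial_deriv i f x"
    using frechet_derivative_transform_within_open[OF assms] by (simp add: partial_deriv_def)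
qed

text \<open>A finite order to induct on. The rules for products and compositions express the
  derivatives of order \<open>n + 1\<close> of the result through functions of the same kind with
  \<open>n\<close> derivatives left.\<close>

definition diff_upto :: "nat \<Rightarrow> (real^'n::finite) set \<Rightarrow> (real^'n \<Rightarrow> real) \<Rightarrow> bool" where
  "diff_upto n S f \<longleftrightarrow> (\<forall>is. length is \<le> n \<longrightarrow> (\<forall>x\<in>S. iter_partial is f differentiable (at x)))"

lemma smooth_on_iff_diff_upto: "smooth_on S f \<longleftrightarrow> (\<forall>n. diff_upto n S f)"
  by (auto simp: smooth_on_def diff_upto_def)

lemma diff_upto_0: "diff_upto 0 S f \<longleftrightarrow> (\<forall>x\<in>S. f differentiable (at x))"
  by (simp add: diff_upto_def iter_partial_def)

lemma iter_partial_snoc: "iter_partial (is @ [i]) f = iter_partial is (partial_deriv i f)"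
  by (simp add: iter_partial_def)

text \<open>The innermost derivative, the last entry of the list, is peeled off. The induction
  hypothesis then applies to the partial derivatives of \<open>f\<close> themselves.\<close>

lemma diff_upto_Suc:
  "diff_upto (Suc n) S f \<longleftrightarrow> (\<forall>x\<in>S. f differentiable (at x)) \<and> (\<forall>i. diff_upto n S (partial_deriv i f))"
proof (intro iffI conjI allI)
  assume *: "diff_upto (Suc n) S f"
  show "\<forall>x\<in>S. f differentiable (at x)"
    using *[unfolded diff_upto_def, rule_format, of "[]"] by (simp add: iter_partial_def)
  show "diff_upto n S (partial_deriv i f)" for i
    using *[unfolded diff_upto_def, rule_format, of "_ @ [i]"]
    by (auto simp: diff_upto_def iter_partial_snoc)
next
  assume *: "(\<forall>x\<in>S. f differentiable (at x)) \<and> (\<forall>i. diff_upto n S (partial_deriv i f))"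
  show "diff_upto (Suc n) S f"
    unfolding diff_upto_def
  proof (intro allI impI ballI)
    fix "is" :: "'a list" and x
    assume l: "length is \<le> Suc n" and x: "x \<in> S"
    show "iter_partial is f differentiable (at x)"
    proof (cases "is" rule: rev_cases)
      case Nil
      thus ?thesis using * x by (simp add: iter_partial_def)
    next
      case (snoc js j)
      thus ?thesis using * x l by (simp add: iter_partial_snoc diff_upto_def)
    qed
  qed
qed

lemma diff_upto_differentiable: "diff_upto n S f \<Longrightarrow> x \<in> S \<Longrightarrow> f differentiable (at x)"
  by (cases n) (auto simp: diff_upto_0 diff_upto_Suc)

lemma diff_upto_mono: "diff_upto n S f \<Longrightarrow> m \<le> n \<Longrightarrow> diff_upto m S f"
  by (auto simp: diff_upto_def)

lemma diff_upto_Un: "diff_upto n S f \<Longrightarrow> diff_upto n T f \<Longrightarrow> diff_upto n (S \<union> T) f"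
  by (auto simp: diff_upto_def)

lemma diff_upto_subset: "diff_upto n S f \<Longrightarrow> T \<subseteq> S \<Longrightarrow> diff_upto n T f"
  by (auto simp: diff_upto_def)

lemma diff_upto_cong:
  assumes "open S"
  shows "diff_upto n S f \<Longrightarrow> (\<And>x. x \<in> S \<Longrightarrow> f x = g x) \<Longrightarrow> diff_upto n S g"
proof (induction n arbitrary: f g)
  case 0
  thus ?case using differentiable_cong_open(1)[OF _ assms] by (auto simp: diff_upto_0)
next
  case (Suc n)
  have f: "f differentiable (at x)" if "x \<in> S" for x
    using Suc.prems that by (auto simp: diff_upto_Suc)
  show ?case unfolding diff_upto_Suc
  proof (intro conjI ballI allI)
    show "g differentiable (at x)" if "x \<in> S" for x
      using differentiable_cong_open(1)[OF f[OF that] assms that] Suc.prems by auto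
    show "diff_upto n S (partial_deriv i g)" for i
    proof (rule Suc.IH)
      show "diff_upto n S (partial_deriv i f)" using Suc.prems by (simp add: diff_upto_Suc)
      show "partial_deriv i f x = partial_deriv i g x" if "x \<in> S" for x
        using differentiable_cong_open(2)[OF f[OF that] assms that, of g i] Suc.prems by auto
    qed
  qed
qed

lemma diff_upto_const: "diff_upto n S (\<lambda>x. c)"
  by (induction n arbitrary: c) (auto simp: diff_upto_0 diff_upto_Suc)

lemma diff_upto_add:
  assumes "open S"
  shows "diff_upto n S f \<Longrightarrow> diff_upto n S g \<Longrightarrow> diff_upto n S (\<lambda>x. f x + g x)"
proof (induction n arbitrary: f g)
  case 0
  thus ?case by (auto simp: diff_upto_0)
next
  case (Suc n)
  have fg: "f differentiable (at x)" "g differentiable (at x)" if "x \<in> S" for x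
    using Suc.prems that by (auto simp: diff_upto_Suc)
  have "diff_upto n S (partial_deriv i (\<lambda>x. f x + g x))" for i
  proof (rule diff_upto_cong[OF assms])
    show "diff_upto n S (\<lambda>x. partial_deriv i f x + partial_deriv i g x)"
      using Suc.prems by (intro Suc.IH) (auto simp: diff_upto_Suc)
  qed (simp add: partial_deriv_add fg)
  thus ?case by (auto simp: diff_upto_Suc fg)
qed

lemma diff_upto_mult:
  assumes "open S"
  shows "diff_upto n S f \<Longrightarrow> diff_upto n S g \<Longrightarrow> diff_upto n S (\<lambda>x. f x * g x)"
proof (induction n arbitrary: f g)
  case 0
  thus ?case by (auto simp: diff_upto_0)
next
  case (Suc n)
  have fg: "f differentiable (at x)" "g differentiable (at x)" if "x \<in> S" for x
    using Suc.prems that by (auto simp: diff_upto_Suc)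
  have fg': "diff_upto n S f" "diff_upto n S g"
    using Suc.prems diff_upto_mono[of "Suc n" S _ n] by auto
  have "diff_upto n S (partial_deriv i (\<lambda>x. f x * g x))" for i
  proof (rule diff_upto_cong[OF assms])
    show "diff_upto n S (\<lambda>x. f x * partial_deriv i g x + partial_deriv i f x * g x)"
      using Suc.prems by (intro diff_upto_add assms Suc.IH fg') (auto simp: diff_upto_Suc)
  qed (simp add: partial_deriv_mult fg)
  thus ?case by (auto simp: diff_upto_Suc fg)
qed

text \<open>\<open>H\<close> is a class of functions of one variable closed under differentiation.
  Such a class encodes smoothness of the outer function without iterated derivatives; it is used for
  the cosines with arbitrary phase and for the functions \<open>flat p\<close>.\<close>

lemma diff_upto_comp:
  assumes "open S"
    and H: "\<And>h. h \<in> H \<Longrightarrow> \<exists>h'\<in>H. \<forall>t. (h has_real_derivative h' t) (at t)"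
  shows "diff_upto n S f \<Longrightarrow> h \<in> H \<Longrightarrow> diff_upto n S (\<lambda>x. h (f x))"
proof (induction n arbitrary: h)
  case 0
  obtain h' where h': "\<And>t. (h has_real_derivative h' t) (at t)" using H[OF 0(2)] by blast
  thus ?case using 0 has_derivative_real_comp[OF h', of f]
    unfolding diff_upto_0 differentiable_def[of "\<lambda>x. h (f x)"] by blast
next
  case (Suc n)
  obtain h' where h': "h' \<in> H" "\<And>t. (h has_real_derivative h' t) (at t)"
    using H[OF Suc.prems(2)] by blast
  have f: "f differentiable (at x)" if "x \<in> S" for x
    using Suc.prems that by (auto simp: diff_upto_Suc)
  have f': "diff_upto n S f"
    using Suc.prems diff_upto_mono[of "Suc n" S _ n] by auto
  have "diff_upto n S (partial_deriv i (\<lambda>x. h (f x)))" for i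
  proof (rule diff_upto_cong[OF assms(1)])
    show "diff_upto n S (\<lambda>x. h' (f x) * partial_deriv i f x)"
      using Suc.prems by (intro diff_upto_mult[OF assms(1) Suc.IH[OF f' h'(1)]]) (auto simp: diff_upto_Suc)
  qed (simp add: partial_deriv_comp[OF h'(2)] f)
  moreover have "(\<lambda>x. h (f x)) differentiable (at x)" if "x \<in> S" for x
    using has_derivative_real_comp[OF h'(2) f[OF that]] by (auto simp: differentiable_def)
  ultimately show ?case by (auto simp: diff_upto_Suc)
qed

lemma smooth_on_differentiable: "smooth_on S f \<Longrightarrow> x \<in> S \<Longrightarrow> f differentiable (at x)"
  using diff_upto_differentiable smooth_on_iff_diff_upto by blast

lemma smooth_on_partial: "smooth_on S f \<Longrightarrow> smooth_on S (partial_deriv i f)"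
  unfolding smooth_on_iff_diff_upto using diff_upto_Suc by blast

lemma smooth_on_const: "smooth_on S (\<lambda>x. c)"
  by (simp add: smooth_on_iff_diff_upto diff_upto_const)

lemma smooth_on_add: "open S \<Longrightarrow> smooth_on S f \<Longrightarrow> smooth_on S g \<Longrightarrow> smooth_on S (\<lambda>x. f x + g x)"
  by (simp add: smooth_on_iff_diff_upto diff_upto_add)

lemma smooth_on_mult: "open S \<Longrightarrow> smooth_on S f \<Longrightarrow> smooth_on S g \<Longrightarrow> smooth_on S (\<lambda>x. f x * g x)"
  by (simp add: smooth_on_iff_diff_upto diff_upto_mult)

lemma smooth_on_cong:
  "open S \<Longrightarrow> smooth_on S f \<Longrightarrow> (\<And>x. x \<in> S \<Longrightarrow> f x = g x) \<Longrightarrow> smooth_on S g"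
  unfolding smooth_on_iff_diff_upto using diff_upto_cong by blast

lemma smooth_on_Un: "smooth_on S f \<Longrightarrow> smooth_on T f \<Longrightarrow> smooth_on (S \<union> T) f"
  by (simp add: smooth_on_iff_diff_upto diff_upto_Un)

lemma smooth_on_subset: "smooth_on S f \<Longrightarrow> T \<subseteq> S \<Longrightarrow> smooth_on T f"
  unfolding smooth_on_iff_diff_upto using diff_upto_subset by blast

lemma smooth_on_sum:
  "open S \<Longrightarrow> (\<And>i. i \<in> I \<Longrightarrow> smooth_on S (f i)) \<Longrightarrow> smooth_on S (\<lambda>x. \<Sum>i\<in>I. f i x)"
  by (induction I rule: infinite_finite_induct) (auto intro: smooth_on_const smooth_on_add)

lemma smooth_on_comp:
  assumes "open S" "smooth_on S f" "h \<in> H"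
    and "\<And>h. h \<in> H \<Longrightarrow> \<exists>h'\<in>H. \<forall>t. (h has_real_derivative h' t) (at t)"
  shows "smooth_on S (\<lambda>x. h (f x))"
  using assms diff_upto_comp[of S H] by (auto simp: smooth_on_iff_diff_upto)

lemma smooth_on_coord: "smooth_on S (\<lambda>x :: real^'n::finite. x $ j)"
  unfolding smooth_on_iff_diff_upto
proof
  fix n
  have "(\<lambda>x :: real^'n. x $ j) differentiable (at x)" for x
    using bounded_linear_imp_has_derivative[OF bounded_linear_vec_nth]
    by (auto simp: differentiable_def)
  thus "diff_upto n S (\<lambda>x. x $ j)"
    by (cases n) (auto simp: diff_upto_0 diff_upto_Suc partial_deriv_coord intro: diff_upto_const)
qed

lemma smooth_on_cos:
  assumes "open S" "smooth_on S f"
  shows "smooth_on S (\<lambda>x. cos (f x + \<theta>))"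
proof (rule smooth_on_comp[OF assms, where H = "range (\<lambda>(\<theta> :: real) t. cos (t + \<theta>))"])
  fix h assume "h \<in> range (\<lambda>(\<theta> :: real) t. cos (t + \<theta>))"
  then obtain \<theta> where h: "h = (\<lambda>t. cos (t + \<theta>))" by auto
  have "(h has_real_derivative cos (t + (\<theta> + pi / 2))) (at t)" for t
    unfolding h by (auto intro!: derivative_eq_intros simp: cos_add sin_add)
  thus "\<exists>h'\<in>range (\<lambda>(\<theta> :: real) t. cos (t + \<theta>)). \<forall>t. (h has_real_derivative h' t) (at t)"
    by (intro bexI[of _ "\<lambda>t. cos (t + (\<theta> + pi / 2))"]) auto
qed auto

section \<open>Flat functions and bump functions\<close>

definition flat :: "real poly \<Rightarrow> real \<Rightarrow> real" where
  "flat p t = (if 0 < t then poly p (1 / t) * exp (- (1 / t)) else 0)"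

lemma poly_exp_tendsto_0: "((\<lambda>s :: real. poly p s * exp (- s)) \<longlongrightarrow> 0) at_top"
proof -
  have "((\<lambda>s :: real. \<Sum>i\<le>degree p. coeff p i * (s ^ i / exp s)) \<longlongrightarrow> (\<Sum>i\<le>degree p. coeff p i * 0)) at_top"
    by (intro tendsto_sum tendsto_mult tendsto_const tendsto_power_div_exp_0)
  moreover have "(\<Sum>i\<le>degree p. coeff p i * (s ^ i / exp s)) = poly p s * exp (- s)" for s :: real
    by (simp add: poly_altdef sum_distrib_right exp_minus divide_inverse mult.assoc)
  ultimately show ?thesis by simp
qed

lemma flat_tendsto_0: "(flat p \<longlongrightarrow> 0) (at 0)"
proof -
  have "((\<lambda>t. poly p (inverse t) * exp (- inverse t)) \<longlongrightarrow> 0) (at_right 0)"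
    by (rule filterlim_compose[OF poly_exp_tendsto_0 filterlim_inverse_at_top_right])
  hence "(flat p \<longlongrightarrow> 0) (at_right 0)"
    by (rule Lim_transform_eventually)
      (auto simp: flat_def inverse_eq_divide eventually_at_right_less eventually_at_filter)
  moreover have "(flat p \<longlongrightarrow> 0) (at_left 0)"
    by (rule Lim_transform_eventually[OF tendsto_const])
      (auto simp: flat_def eventually_at_filter)
  ultimately show ?thesis by (simp add: filterlim_split_at)
qed

text \<open>Putting \<open>s = 1 / t\<close>, the derivative of \<open>p(s) exp(-s)\<close> in
  \<open>t\<close> is \<open>s^2 (p(s) - p'(s)) exp(-s)\<close>, which is again of this form. Thus
  the range of \<open>flat\<close> is closed under differentiation; for \<open>p = 1\<close> it
  contains the classical function \<open>exp(-1/t)\<close> extended by zero.\<close>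

lemma flat_has_derivative:
  "(flat p has_real_derivative flat (monom 1 2 * (p - pderiv p)) t) (at t)"
proof -
  consider "t < 0" | "t = 0" | "0 < t" by linarith
  thus ?thesis
  proof cases
    case 1
    have "((\<lambda>t. 0) has_real_derivative 0) (at t)" by simp
    hence "(flat p has_real_derivative 0) (at t)"
      by (rule has_field_derivative_transform_within_open[where S = "{..<0}"]) (use 1 in \<open>auto simp: flat_def\<close>)
    thus ?thesis using 1 by (simp add: flat_def)
  next
    case 2
    \<comment> \<open>Dividing by \<open>y\<close> multiplies the polynomial in \<open>1 / y\<close>
      by its variable, so the difference quotient at 0 is itself a flat function and tends to
      0.\<close>
    have "(\<lambda>y. (flat p y - flat p 0) / (y - 0)) = flat (pCons 0 p)"
      by (auto simp: flat_def fun_eq_iff)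
    thus ?thesis using 2 flat_tendsto_0[of "pCons 0 p"]
      by (simp add: has_field_derivative_iff) (simp add: flat_def)
  next
    case 3
    have "((\<lambda>t. poly p (1 / t) * exp (- (1 / t))) has_real_derivative
        poly (monom 1 2 * (p - pderiv p)) (1 / t) * exp (- (1 / t))) (at t)"
      using 3 by (auto intro!: derivative_eq_intros DERIV_chain2[OF poly_DERIV]
          simp: poly_monom power2_eq_square algebra_simps)
    hence "(flat p has_real_derivative poly (monom 1 2 * (p - pderiv p)) (1 / t) * exp (- (1 / t))) (at t)"
      by (rule has_field_derivative_transform_within_open[where S = "{0<..}"]) (use 3 in \<open>auto simp: flat_def\<close>)
    thus ?thesis using 3 by (simp add: flat_def)
  qed
qed

lemma smooth_on_flat: "open S \<Longrightarrow> smooth_on S f \<Longrightarrow> smooth_on S (\<lambda>x. flat p (f x))"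
  by (rule smooth_on_comp[where H = "range flat"]) (use flat_has_derivative in blast)+

lemma bump_exists:
  fixes p :: "real^'n::finite"
  assumes "0 < r"
  shows "\<exists>\<beta> :: real^'n \<Rightarrow> real.
    smooth_on UNIV \<beta> \<and> (\<forall>x. 0 \<le> \<beta> x) \<and> (\<forall>x. \<beta> x \<noteq> 0 \<longleftrightarrow> x \<in> ball p r)"
proof (intro exI conjI allI)
  \<comment> \<open>This is \<open>r^2 - |x - p|^2\<close>, written with sums and products of
    coordinates so that the closure rules for \<open>smooth_on\<close> apply.\<close>
  let ?s = "\<lambda>x :: real^'n. r\<^sup>2 + (-1) * (\<Sum>i\<in>UNIV. (x $ i + (- p $ i)) * (x $ i + (- p $ i)))"
  show "smooth_on UNIV (\<lambda>x. flat 1 (?s x))"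
    by (intro smooth_on_flat smooth_on_add smooth_on_mult smooth_on_sum smooth_on_const
        smooth_on_coord open_UNIV)
  show "0 \<le> flat 1 (?s x)" for x by (simp add: flat_def)
  show "flat 1 (?s x) \<noteq> 0 \<longleftrightarrow> x \<in> ball p r" for x
  proof -
    have "(dist p x)\<^sup>2 = (\<Sum>i\<in>UNIV. (x $ i + (- p $ i)) * (x $ i + (- p $ i)))"
      by (simp add: dist_norm norm_minus_commute[of p x] power2_norm_eq_inner inner_vec_def)
    moreover have "(dist p x)\<^sup>2 < r\<^sup>2 \<longleftrightarrow> dist p x < r"
      using power_mono_iff[of r "dist p x" 2] assms by (simp del: power_mono_iff flip: not_le)
    ultimately show ?thesis by (auto simp: flat_def)
  qed
qed

subsection \<open>Test functions\<close>

locale bounded_open =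
  fixes \<Omega> :: "(real^'n::finite) set"
  assumes open_\<Omega>: "open \<Omega>" and bounded_\<Omega>: "bounded \<Omega>"
begin

lemma finite_measure_\<Omega>: "finite_measure (lebesgue_on \<Omega>)"
  by (intro finite_measure_lebesgue_on lmeasurable_open open_\<Omega> bounded_\<Omega>)

lemma \<Omega>_sets: "\<Omega> \<in> sets lebesgue"
  using open_\<Omega> by (simp add: borel_open)

end

lemma test_function_smooth: "\<phi> \<in> test_functions \<Omega> \<Longrightarrow> smooth_on UNIV \<phi>"
  by (simp add: test_functions_def)

lemma test_function_differentiable: "\<phi> \<in> test_functions \<Omega> \<Longrightarrow> \<phi> differentiable (at x)"
  by (simp add: smooth_on_differentiable[OF test_function_smooth])

lemma test_function_continuous: "\<phi> \<in> test_functions \<Omega> \<Longrightarrow> continuous_on UNIV \<phi>"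
  by (simp add: continuous_at_imp_continuous_on differentiable_imp_continuous_within
      test_function_differentiable)

lemma test_function_outside: "\<phi> \<in> test_functions \<Omega> \<Longrightarrow> x \<notin> \<Omega> \<Longrightarrow> \<phi> x = 0"
  using closure_subset[of "{x. \<phi> x \<noteq> 0}"] by (auto simp: test_functions_def)

lemma test_functionI:
  assumes "\<phi> \<in> test_functions \<Omega>" "smooth_on UNIV g" "{x. g x \<noteq> 0} \<subseteq> closure {x. \<phi> x \<noteq> 0}"
  shows "g \<in> test_functions \<Omega>"
proof -
  have sub: "closure {x. g x \<noteq> 0} \<subseteq> closure {x. \<phi> x \<noteq> 0}"
    using assms(3) by (simp add: closure_minimal)
  hence "compact (closure {x. g x \<noteq> 0})"
    using assms(1) compact_Int_closed[of "closure {x. \<phi> x \<noteq> 0}" "closure {x. g x \<noteq> 0}"]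
    by (simp add: test_functions_def Int_absorb1)
  thus ?thesis using assms sub by (auto simp: test_functions_def)
qed

lemma test_function_zero: "(\<lambda>x. 0) \<in> test_functions \<Omega>"
  by (simp add: test_functions_def smooth_on_const)

lemma test_function_add:
  assumes "\<phi> \<in> test_functions \<Omega>" "\<psi> \<in> test_functions \<Omega>"
  shows "(\<lambda>x. \<phi> x + \<psi> x) \<in> test_functions \<Omega>"
proof -
  let ?K = "closure {x. \<phi> x \<noteq> 0} \<union> closure {x. \<psi> x \<noteq> 0}"
  have K: "compact ?K" "?K \<subseteq> \<Omega>" using assms by (auto simp: test_functions_def)
  have "{x. \<phi> x + \<psi> x \<noteq> 0} \<subseteq> {x. \<phi> x \<noteq> 0} \<union> {x. \<psi> x \<noteq> 0}" by auto
  hence "closure {x. \<phi> x + \<psi> x \<noteq> 0} \<subseteq> ?K" by (simp only: closure_Un[symmetric] closure_mono)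
  moreover from this have "compact (closure {x. \<phi> x + \<psi> x \<noteq> 0})"
    using compact_Int_closed[OF K(1) closed_closure, of "{x. \<phi> x + \<psi> x \<noteq> 0}"]
    by (simp add: Int_absorb1)
  ultimately show ?thesis
    using assms K by (auto simp: test_functions_def intro: smooth_on_add)
qed

text \<open>The factor is smooth only in \<Omega>, as are \<open>q0\<close>, the \<open>V j\<close>
  and the leading amplitudes. But \<Omega> and the complement of the support of \<phi> are open sets
  covering the space, and the product vanishes on the second.\<close>

lemma test_function_mult_smooth:
  assumes "\<phi> \<in> test_functions \<Omega>" "open \<Omega>" "smooth_on \<Omega> g"
  shows "(\<lambda>x. g x * \<phi> x) \<in> test_functions \<Omega>"
proof (rule test_functionI[OF assms(1)])
  let ?K = "closure {x. \<phi> x \<noteq> 0}"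
  have "smooth_on \<Omega> (\<lambda>x. g x * \<phi> x)"
    by (intro smooth_on_mult assms smooth_on_subset[OF test_function_smooth[OF assms(1)]]) auto
  moreover have "smooth_on (- ?K) (\<lambda>x. g x * \<phi> x)"
  proof (rule smooth_on_cong[OF _ smooth_on_const])
    show "0 = g x * \<phi> x" if "x \<in> - ?K" for x
      using that closure_subset[of "{x. \<phi> x \<noteq> 0}"] by auto
  qed auto
  moreover have "\<Omega> \<union> - ?K = UNIV" using assms(1) by (auto simp: test_functions_def)
  ultimately show "smooth_on UNIV (\<lambda>x. g x * \<phi> x)" by (metis smooth_on_Un)
qed (use closure_subset[of "{x. \<phi> x \<noteq> 0}"] in auto)

lemma test_function_mult:
  assumes "\<phi> \<in> test_functions \<Omega>" "smooth_on UNIV g"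
  shows "(\<lambda>x. g x * \<phi> x) \<in> test_functions \<Omega>"
  by (rule test_functionI[OF assms(1)])
    (use closure_subset[of "{x. \<phi> x \<noteq> 0}"] in
      \<open>auto intro!: smooth_on_mult assms(2) test_function_smooth[OF assms(1)]\<close>)

lemma test_function_cmult: "\<phi> \<in> test_functions \<Omega> \<Longrightarrow> (\<lambda>x. c * \<phi> x) \<in> test_functions \<Omega>"
  by (rule test_function_mult[OF _ smooth_on_const])

lemma test_function_diff:
  "\<phi> \<in> test_functions \<Omega> \<Longrightarrow> \<psi> \<in> test_functions \<Omega> \<Longrightarrow> (\<lambda>x. \<phi> x - \<psi> x) \<in> test_functions \<Omega>"
  using test_function_add[OF _ test_function_cmult[of \<psi> \<Omega> "-1"]] by simp

lemma test_function_sum: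
  "(\<And>i. i \<in> I \<Longrightarrow> f i \<in> test_functions \<Omega>) \<Longrightarrow> (\<lambda>x. \<Sum>i\<in>I. f i x) \<in> test_functions \<Omega>"
  by (induction I rule: infinite_finite_induct)
    (auto intro: test_function_zero test_function_add)

lemma test_function_partial:
  assumes "\<phi> \<in> test_functions \<Omega>"
  shows "partial_deriv i \<phi> \<in> test_functions \<Omega>"
proof (rule test_functionI[OF assms smooth_on_partial[OF test_function_smooth[OF assms]]], rule ccontr)
  assume "\<not> {x. partial_deriv i \<phi> x \<noteq> 0} \<subseteq> closure {x. \<phi> x \<noteq> 0}"
  then obtain x where x: "partial_deriv i \<phi> x \<noteq> 0" "x \<in> - closure {x. \<phi> x \<noteq> 0}" by auto
  have "partial_deriv i \<phi> x = partial_deriv i (\<lambda>x. 0) x"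
    by (rule differentiable_cong_open(2)[OF _ _ x(2)])
      (use closure_subset[of "{x. \<phi> x \<noteq> 0}"] in auto)
  thus False using x by simp
qed

lemma test_function_laplacian: "\<phi> \<in> test_functions \<Omega> \<Longrightarrow> laplacian \<phi> \<in> test_functions \<Omega>"
  unfolding laplacian_def[abs_def] by (intro test_function_sum test_function_partial)

lemma test_function_compact_support:
  assumes "\<phi> \<in> test_functions \<Omega>"
  obtains R where "0 < R" "\<And>x. \<phi> x \<noteq> 0 \<Longrightarrow> norm x \<le> R"
proof -
  have "bounded (closure {x. \<phi> x \<noteq> 0})"
    using assms by (simp add: test_functions_def compact_imp_bounded)
  then obtain R where "0 < R" "\<forall>x\<in>closure {x. \<phi> x \<noteq> 0}. norm x \<le> R" by (auto simp: bounded_pos)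
  thus thesis using that[of R] closure_subset[of "{x. \<phi> x \<noteq> 0}"] by auto
qed

lemma test_function_bounded:
  assumes "\<phi> \<in> test_functions \<Omega>"
  obtains B where "0 \<le> B" "\<And>x. \<bar>\<phi> x\<bar> \<le> B"
proof -
  let ?K = "closure {x. \<phi> x \<noteq> 0}"
  have "bounded (\<phi> ` ?K)"
    using assms test_function_continuous[OF assms]
    by (intro compact_imp_bounded compact_continuous_image)
      (auto simp: test_functions_def intro: continuous_on_subset)
  then obtain B where B: "0 < B" "\<forall>x\<in>?K. \<bar>\<phi> x\<bar> \<le> B" by (auto simp: bounded_pos)
  have "\<bar>\<phi> x\<bar> \<le> B" for x
    using B closure_subset[of "{x. \<phi> x \<noteq> 0}"] by (cases "\<phi> x = 0") auto
  thus thesis using B that[of B] by auto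
qed

lemma test_function_measurable: "\<phi> \<in> test_functions \<Omega> \<Longrightarrow> \<phi> \<in> borel_measurable borel"
  by (intro borel_measurable_continuous_onI test_function_continuous)

section \<open>Integration by parts and the Poincare inequality\<close>

lemma partial_deriv_line:
  fixes \<phi> :: "real^'n::finite \<Rightarrow> real"
  assumes "\<And>x. \<phi> differentiable (at x)"
  shows "((\<lambda>t. \<phi> (x + t *\<^sub>R axis i 1)) has_real_derivative partial_deriv i \<phi> (x + t *\<^sub>R axis i 1)) (at t)"
proof -
  have 1: "((\<lambda>t. x + t *\<^sub>R axis i 1) has_derivative (\<lambda>h. h *\<^sub>R axis i 1)) (at t)"
    by (auto intro!: derivative_eq_intros)
  have lin: "linear (frechet_derivative \<phi> (at (x + t *\<^sub>R axis i 1)))"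
    by (rule linear_frechet_derivative[OF assms])
  have "((\<lambda>t. \<phi> (x + t *\<^sub>R axis i 1)) has_derivative
      (\<lambda>h. frechet_derivative \<phi> (at (x + t *\<^sub>R axis i 1)) (h *\<^sub>R axis i 1))) (at t)"
    by (rule has_derivative_compose[OF 1 assms[unfolded frechet_derivative_works]])
  thus ?thesis
    unfolding has_field_derivative_def
    by (simp add: linear_scale[OF lin] partial_deriv_def mult.commute[of _ "frechet_derivative _ _ _"])
qed

text \<open>Translation invariance of the Lebesgue measure makes all difference quotients integrate to
  zero, which replaces the fundamental theorem of calculus and Fubini's theorem.\<close>

lemma integral_partial_deriv_eq_0:
  fixes \<phi> :: "real^'n::finite \<Rightarrow> real"
  assumes "\<phi> \<in> test_functions \<Omega>"
  shows "(\<integral>x. partial_deriv i \<phi> x \<partial>lborel) = 0"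
proof -
  let ?e = "axis i 1 :: real^'n"
  obtain R where R: "0 < R" "\<And>x. \<phi> x \<noteq> 0 \<Longrightarrow> norm x \<le> R"
    using test_function_compact_support[OF assms] by metis
  obtain B where B: "0 \<le> B" "\<And>x. \<bar>partial_deriv i \<phi> x\<bar> \<le> B"
    using test_function_bounded[OF test_function_partial[OF assms]] by metis
  obtain B0 where B0: "0 \<le> B0" "\<And>x. \<bar>\<phi> x\<bar> \<le> B0"
    using test_function_bounded[OF assms] by metis
  have [measurable]: "\<phi> \<in> borel_measurable borel" "partial_deriv i \<phi> \<in> borel_measurable borel"
    by (rule test_function_measurable[OF assms], rule test_function_measurable[OF test_function_partial[OF assms]])
  have deriv: "((\<lambda>t. \<phi> (x + t *\<^sub>R ?e)) has_real_derivative partial_deriv i \<phi> (x + t *\<^sub>R ?e)) (at t)"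
    for x t by (intro partial_deriv_line test_function_differentiable[OF assms])
  define g where "g k x = (\<phi> (x + (1 / Suc k) *\<^sub>R ?e) - \<phi> x) / (1 / Suc k)" for k :: nat and x
  have int: "integrable lborel \<phi>"
  proof (rule Bochner_Integration.integrable_bound)
    show "integrable lborel (\<lambda>x. B0 * indicator (cball 0 R) x :: real)"
      by (intro integrable_mult_right integrable_real_indicator)
        (use emeasure_bounded_finite[OF bounded_cball] in \<open>auto simp: less_top\<close>)
    show "AE x in lborel. norm (\<phi> x) \<le> norm (B0 * indicator (cball 0 R) x :: real)"
    proof (intro AE_I2)
      fix x show "norm (\<phi> x) \<le> norm (B0 * indicator (cball 0 R) x :: real)"
        using R(2)[of x] B0(1) B0(2)[of x] by (cases "\<phi> x = 0") auto
    qed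
  qed simp
  have int_shift: "integrable lborel (\<lambda>x. \<phi> (x + a)) \<and> (\<integral>x. \<phi> (x + a) \<partial>lborel) = (\<integral>x. \<phi> x \<partial>lborel)" for a
    using integrable_distr_eq[of "(+) a" lborel borel \<phi>] integral_distr[of "(+) a" lborel borel \<phi>] int
    by (simp add: lborel_distr_plus add.commute)
  have g0: "(\<integral>x. g k x \<partial>lborel) = 0" for k
    unfolding g_def using int int_shift by simp
  have "(\<lambda>k. \<integral>x. g k x \<partial>lborel) \<longlonglongrightarrow> (\<integral>x. partial_deriv i \<phi> x \<partial>lborel)"
  proof (rule integral_dominated_convergence)
    \<comment> \<open>The radius is enlarged by 1 because the steps of the difference quotients are
      at most 1.\<close>
    show "integrable lborel (\<lambda>x. B * indicator (cball 0 (R + 1)) x :: real)"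
      by (intro integrable_mult_right integrable_real_indicator)
        (use emeasure_bounded_finite[OF bounded_cball] in \<open>auto simp: less_top\<close>)
    show "AE x in lborel. (\<lambda>k. g k x) \<longlonglongrightarrow> partial_deriv i \<phi> x"
    proof (intro AE_I2)
      fix x
      have "((\<lambda>h. (\<phi> (x + h *\<^sub>R ?e) - \<phi> x) / h) \<longlongrightarrow> partial_deriv i \<phi> x) (at 0)"
        using deriv[of x 0] by (simp add: has_field_derivative_iff)
      moreover have "filterlim (\<lambda>k. 1 / real (Suc k)) (at 0) sequentially"
        unfolding filterlim_at using LIMSEQ_inverse_real_of_nat
        by (auto simp: inverse_eq_divide)
      ultimately show "(\<lambda>k. g k x) \<longlonglongrightarrow> partial_deriv i \<phi> x"
        unfolding g_def by (rule filterlim_compose)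
    qed
    show "AE x in lborel. norm (g k x) \<le> B * indicator (cball 0 (R + 1)) x" for k
    proof (intro AE_I2)
      fix x
      let ?h = "1 / real (Suc k)"
      have h: "0 < ?h" "?h \<le> 1" by auto
      \<comment> \<open>By the mean value theorem each difference quotient is a value of the partial
        derivative, hence bounded by \<open>B\<close> independently of \<open>k\<close>.\<close>
      obtain z where z: "\<phi> (x + ?h *\<^sub>R ?e) - \<phi> (x + 0 *\<^sub>R ?e) = (?h - 0) * partial_deriv i \<phi> (x + z *\<^sub>R ?e)"
        using MVT2[OF h(1) deriv] by blast
      hence "g k x = partial_deriv i \<phi> (x + z *\<^sub>R ?e)" using h by (simp add: g_def)
      hence "\<bar>g k x\<bar> \<le> B" using B by simp
      moreover have "g k x = 0" if "R + 1 < norm x"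
      proof -
        have "norm x \<le> norm (x + ?h *\<^sub>R ?e) + norm (?h *\<^sub>R ?e)"
          using norm_triangle_ineq4[of "x + ?h *\<^sub>R ?e" "?h *\<^sub>R ?e"] by simp
        also have "norm (?h *\<^sub>R ?e) \<le> 1" by simp
        finally have "R < norm (x + ?h *\<^sub>R ?e)" using that by linarith
        hence "\<phi> (x + ?h *\<^sub>R ?e) = 0" "\<phi> x = 0" using R that by (force simp: not_le[symmetric])+
        thus ?thesis by (simp add: g_def)
      qed
      ultimately show "norm (g k x) \<le> B * indicator (cball 0 (R + 1)) x"
        by (auto simp: indicator_def not_le)
    qed
  qed (simp_all add: g_def)
  thus ?thesis by (simp add: g0 LIMSEQ_const_iff)
qed

context bounded_open
begin

lemma integral_\<Omega>:
  fixes f :: "real^'n \<Rightarrow> real"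
  assumes "f \<in> borel_measurable borel" "\<And>x. x \<notin> \<Omega> \<Longrightarrow> f x = 0"
  shows "(\<integral>x. f x \<partial>lebesgue_on \<Omega>) = (\<integral>x. f x \<partial>lborel)"
proof -
  have "(\<integral>x. f x \<partial>lebesgue_on \<Omega>) = (\<integral>x. indicator \<Omega> x *\<^sub>R f x \<partial>lebesgue)"
    using \<Omega>_sets by (intro integral_restrict_space) auto
  also have "(\<lambda>x. indicator \<Omega> x *\<^sub>R f x) = f" by (rule ext) (use assms(2) in \<open>auto simp: indicator_def\<close>)
  finally show ?thesis using assms(1) by (simp add: integral_completion)
qed

lemma continuous_bounded_L2:
  assumes "continuous_on \<Omega> f" "\<And>x. x \<in> \<Omega> \<Longrightarrow> \<bar>f x\<bar> \<le> B"
  shows "f \<in> L2 \<Omega>"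
proof -
  have [measurable]: "f \<in> borel_measurable (lebesgue_on \<Omega>)"
    by (intro continuous_imp_measurable_on_sets_lebesgue assms \<Omega>_sets)
  have "integrable (lebesgue_on \<Omega>) (\<lambda>x. (f x)\<^sup>2)"
  proof (rule finite_measure.integrable_const_bound[OF finite_measure_\<Omega>, where B = "B\<^sup>2"])
    show "AE x in lebesgue_on \<Omega>. norm ((f x)\<^sup>2) \<le> B\<^sup>2"
      using assms(2) by (intro AE_I2) (auto simp: space_restrict_space abs_le_square_iff[symmetric] intro: order_trans[OF _ abs_ge_self])
  qed simp
  thus ?thesis by (simp add: L2_def)
qed

lemma test_function_L2: "\<phi> \<in> test_functions \<Omega> \<Longrightarrow> \<phi> \<in> L2 \<Omega>"
  using test_function_bounded continuous_bounded_L2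
  by (metis continuous_on_subset subset_UNIV test_function_continuous)

lemma integration_by_parts:
  assumes "u \<in> test_functions \<Omega>" "\<phi> \<in> test_functions \<Omega>"
  shows "L2_inner \<Omega> u (partial_deriv i \<phi>) = - L2_inner \<Omega> (partial_deriv i u) \<phi>"
proof -
  have "(\<integral>x. partial_deriv i (\<lambda>x. u x * \<phi> x) x \<partial>lborel) = 0"
    using assms by (intro integral_partial_deriv_eq_0[of _ \<Omega>] test_function_mult test_function_smooth)
  moreover have "(\<integral>x. partial_deriv i (\<lambda>x. u x * \<phi> x) x \<partial>lebesgue_on \<Omega>)
      = (\<integral>x. partial_deriv i (\<lambda>x. u x * \<phi> x) x \<partial>lborel)"
    using assms by (intro integral_\<Omega> test_function_measurable test_function_outside
        test_function_partial test_function_mult test_function_smooth)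
  ultimately have "(\<integral>x. u x * partial_deriv i \<phi> x + partial_deriv i u x * \<phi> x \<partial>lebesgue_on \<Omega>) = 0"
    using assms by (simp add: partial_deriv_mult test_function_differentiable)
  thus ?thesis
    using assms by (simp add: L2_inner_def L2_mult_integrable test_function_L2 test_function_partial)
qed

lemma radius_bound:
  obtains R where "0 < R" "\<And>x. x \<in> \<Omega> \<Longrightarrow> norm x \<le> R"
  using bounded_\<Omega> by (auto simp: bounded_pos)

text \<open>The Poincare inequality, from \<open>\<phi>\<^sup>2 = \<partial>\<^sub>i (x\<^sub>i \<phi>\<^sup>2) - 2 x\<^sub>i \<phi> \<partial>\<^sub>i\<phi>\<close>.\<close>

lemma poincare_test_function:
  assumes "\<phi> \<in> test_functions \<Omega>" and R: "\<And>x. x \<in> \<Omega> \<Longrightarrow> norm x \<le> R"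
  shows "L2_norm \<Omega> \<phi> \<le> 2 * R * L2_norm \<Omega> (partial_deriv i \<phi>)"
proof -
  let ?d = "partial_deriv i \<phi>"
  let ?x = "\<lambda>x. x $ i * \<phi> x"
  have x: "?x \<in> test_functions \<Omega>" by (intro test_function_mult smooth_on_coord assms)
  have d: "?d \<in> test_functions \<Omega>" by (intro test_function_partial assms)
  have coord: "(\<lambda>x. x $ i) differentiable (at x)" for x :: "real^'n"
    by (rule smooth_on_differentiable[OF smooth_on_coord[of UNIV]]) simp
  have dx: "partial_deriv i ?x x = \<phi> x + x $ i * ?d x" for x
    by (simp add: partial_deriv_mult[OF coord test_function_differentiable[OF assms(1)]] partial_deriv_coord)
  have x': "(\<lambda>x. x $ i * ?d x) \<in> test_functions \<Omega>" by (intro test_function_mult smooth_on_coord d)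
  have "L2_inner \<Omega> ?x ?d = - L2_inner \<Omega> (\<lambda>x. \<phi> x + x $ i * ?d x) \<phi>"
    using integration_by_parts[OF x assms(1), of i] unfolding fun_eq_iff[of "partial_deriv i ?x", THEN iffD2, OF allI, OF dx] .
  also have "L2_inner \<Omega> (\<lambda>x. \<phi> x + x $ i * ?d x) \<phi>
      = L2_inner \<Omega> \<phi> \<phi> + L2_inner \<Omega> (\<lambda>x. x $ i * ?d x) \<phi>"
    by (intro L2.B_add test_function_L2 assms x')
  also have "L2_inner \<Omega> (\<lambda>x. x $ i * ?d x) \<phi> = L2_inner \<Omega> ?x ?d"
    by (simp add: L2_inner_def mult_ac)
  finally have "L2_inner \<Omega> \<phi> \<phi> = - 2 * L2_inner \<Omega> ?x ?d" by simp
  also have "\<dots> \<le> 2 * (L2_norm \<Omega> ?x * L2_norm \<Omega> ?d)"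
    using L2_cauchy_schwarz[OF test_function_L2[OF x] test_function_L2[OF d]] by linarith
  also have "L2_norm \<Omega> ?x \<le> R * L2_norm \<Omega> \<phi>"
  proof (rule L2_bounded_mult(2)[OF test_function_L2[OF assms(1)]])
    show "(\<lambda>x :: real^'n. x $ i) \<in> borel_measurable (lebesgue_on \<Omega>)"
      by (intro continuous_imp_measurable_on_sets_lebesgue \<Omega>_sets continuous_intros)
    show "\<bar>x $ i\<bar> \<le> R" if "x \<in> \<Omega>" for x
      using component_le_norm_cart[of x i] R[OF that] by linarith
  qed
  finally have "(L2_norm \<Omega> \<phi>)\<^sup>2 \<le> 2 * (R * L2_norm \<Omega> \<phi> * L2_norm \<Omega> ?d)"
    unfolding L2_norm_power2 by (simp add: mult_right_mono L2_norm_nonneg)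
  hence *: "L2_norm \<Omega> \<phi> * L2_norm \<Omega> \<phi> \<le> L2_norm \<Omega> \<phi> * (2 * R * L2_norm \<Omega> ?d)"
    by (simp add: power2_eq_square mult_ac)
  show ?thesis
  \<comment> \<open>One factor is cancelled. If it vanishes, the right-hand side must still be
    nonnegative, and the sign of \<open>R\<close> comes from a point of \<Omega>.\<close>
  proof (cases "L2_norm \<Omega> \<phi> = 0")
    case True
    show ?thesis
    proof (cases "\<Omega> = {}")
      case True
      hence "space (lebesgue_on \<Omega>) = {}" by (simp add: space_restrict_space)
      thus ?thesis by (simp add: L2_norm_def L2_inner_def integral_empty)
    next
      case False
      then obtain x where "x \<in> \<Omega>" by auto
      hence "0 \<le> R" using R[of x] norm_ge_zero[of x] by linarith
      thus ?thesis using True by (simp add: L2_norm_nonneg)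
    qed
  next
    case False
    thus ?thesis using * L2_norm_nonneg[of \<Omega> \<phi>] by (auto simp: mult_le_cancel_left)
  qed
qed

end

subsection \<open>The Dirichlet problem\<close>

lemma L2_norm_zero [simp]: "L2_norm \<Omega> (\<lambda>x. 0) = 0"
  by (simp add: L2_norm_def L2_inner_def)

lemma L2_norm_scale: "L2_norm \<Omega> (\<lambda>x. c * f x) = \<bar>c\<bar> * L2_norm \<Omega> f"
proof -
  have "L2_inner \<Omega> (\<lambda>x. c * f x) (\<lambda>x. c * f x) = (\<integral>x. (c * c) * (f x * f x) \<partial>lebesgue_on \<Omega>)"
    by (simp add: L2_inner_def mult_ac)
  thus ?thesis by (simp add: L2_norm_def L2_inner_def real_sqrt_mult)
qed

lemma H10_L2: "u \<in> H10 \<Omega> \<Longrightarrow> u \<in> L2 \<Omega>"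
  by (simp add: H10_def)

lemma H10I:
  fixes \<phi> :: "nat \<Rightarrow> real^'n::finite \<Rightarrow> real"
  assumes "u \<in> L2 \<Omega>" "\<And>i. v i \<in> L2 \<Omega>" "\<And>i. weak_partial \<Omega> i u (v i)"
    and "\<And>k. \<phi> k \<in> test_functions \<Omega>" "(\<lambda>k. L2_norm \<Omega> (\<lambda>x. \<phi> k x - u x)) \<longlonglongrightarrow> 0"
    and "\<And>i. (\<lambda>k. L2_norm \<Omega> (\<lambda>x. partial_deriv i (\<phi> k) x - v i x)) \<longlonglongrightarrow> 0"
  shows "u \<in> H10 \<Omega>"
  unfolding H10_def by (intro CollectI conjI exI[of _ v] exI[of _ \<phi>] allI assms)

text \<open>The relation from which \<open>green\<close> chooses. It is linear in the pair
  \<open>(f, u)\<close>, whereas the chosen solutions depend linearly on \<open>f\<close> only up to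
  null sets.\<close>

definition solves ::
    "(real^'n::finite) set \<Rightarrow> (real^'n \<Rightarrow> real) \<Rightarrow> (real^'n \<Rightarrow> real) \<Rightarrow> (real^'n \<Rightarrow> real) \<Rightarrow> bool" where
  "solves \<Omega> q f u \<longleftrightarrow>
     (\<exists>h. dirichlet_laplacian \<Omega> u h \<and> (AE x in lebesgue_on \<Omega>. - h x + q x * u x = f x))"

lemma green_eq_solves: "green \<Omega> q f = (SOME u. solves \<Omega> q f u)"
  by (simp add: green_def solves_def)

lemma solves_L2: "solves \<Omega> q f u \<Longrightarrow> u \<in> L2 \<Omega>"
  by (auto simp: solves_def dirichlet_laplacian_def H10_L2)

definition nonneg_potential :: "(real^'n::finite) set \<Rightarrow> (real^'n \<Rightarrow> real) \<Rightarrow> bool" where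
  "nonneg_potential \<Omega> q \<longleftrightarrow> q \<in> borel_measurable (lebesgue_on \<Omega>) \<and>
     (\<exists>B. \<forall>x\<in>\<Omega>. \<bar>q x\<bar> \<le> B) \<and> (\<forall>x\<in>\<Omega>. 0 \<le> q x)"

lemma nonneg_potential_mult_L2: "nonneg_potential \<Omega> q \<Longrightarrow> f \<in> L2 \<Omega> \<Longrightarrow> (\<lambda>x. q x * f x) \<in> L2 \<Omega>"
  by (auto simp: nonneg_potential_def intro: L2_bounded_mult)

lemma nonneg_potential_inner_nonneg:
  assumes "nonneg_potential \<Omega> q"
  shows "0 \<le> L2_inner \<Omega> (\<lambda>x. q x * f x) f"
proof -
  have "0 \<le> q x * f x * f x" if "x \<in> \<Omega>" for x
    using that assms by (simp add: nonneg_potential_def mult.assoc)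
  thus ?thesis
    unfolding L2_inner_def by (intro integral_nonneg_AE AE_I2) (auto simp: space_restrict_space)
qed

lemma L2_inner_commute: "L2_inner \<Omega> f g = L2_inner \<Omega> g f"
  by (simp add: L2_inner_def mult.commute)

lemma L2_inner_mult_left: "L2_inner \<Omega> (\<lambda>x. q x * f x) g = L2_inner \<Omega> f (\<lambda>x. q x * g x)"
  by (simp add: L2_inner_def mult_ac)

context bounded_open
begin

lemma laplacian_inner:
  assumes "w \<in> L2 \<Omega>" "\<phi> \<in> test_functions \<Omega>"
  shows "L2_inner \<Omega> w (laplacian \<phi>) = (\<Sum>i\<in>UNIV. L2_inner \<Omega> w (partial_deriv i (partial_deriv i \<phi>)))"
  unfolding laplacian_def[abs_def] L2_inner_commute[of \<Omega> w]
  by (intro L2_inner_sum test_function_L2 test_function_partial assms)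

lemma test_function_H10:
  assumes "\<phi> \<in> test_functions \<Omega>"
  shows "\<phi> \<in> H10 \<Omega>"
proof (rule H10I[of _ _ "\<lambda>i. partial_deriv i \<phi>" "\<lambda>k. \<phi>"])
  show "weak_partial \<Omega> i \<phi> (partial_deriv i \<phi>)" for i
    by (simp add: weak_partial_def assms integration_by_parts)
qed (simp_all add: assms test_function_L2 test_function_partial)

text \<open>The source of the resolvent equation: a test function solves the Dirichlet problem with
  its own image under \<open>-\<Delta> + q\<close> as right-hand side. Integrating by parts twice
  identifies the distributional Laplacian with the classical one.\<close>

lemma solves_test_function:
  assumes "\<phi> \<in> test_functions \<Omega>"
  shows "solves \<Omega> q (\<lambda>x. - laplacian \<phi> x + q x * \<phi> x) \<phi>"
  unfolding solves_def dirichlet_laplacian_def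
proof (intro exI conjI ballI)
  show "\<phi> \<in> H10 \<Omega>" by (rule test_function_H10[OF assms])
  show "laplacian \<phi> \<in> L2 \<Omega>" by (intro test_function_L2 test_function_laplacian assms)
  fix \<psi> assume \<psi>: "\<psi> \<in> test_functions \<Omega>"
  have "L2_inner \<Omega> \<phi> (laplacian \<psi>) = (\<Sum>i\<in>UNIV. L2_inner \<Omega> \<phi> (partial_deriv i (partial_deriv i \<psi>)))"
    by (intro laplacian_inner test_function_L2 assms \<psi>)
  also have "\<dots> = (\<Sum>i\<in>UNIV. L2_inner \<Omega> \<psi> (partial_deriv i (partial_deriv i \<phi>)))"
    using assms \<psi> test_function_partial[OF assms] test_function_partial[OF \<psi>]
    by (simp add: integration_by_parts L2_inner_commute[of _ "partial_deriv _ \<phi>"])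
  also have "\<dots> = L2_inner \<Omega> \<psi> (laplacian \<phi>)"
    by (intro laplacian_inner[symmetric] test_function_L2 assms \<psi>)
  finally show "L2_inner \<Omega> \<phi> (laplacian \<psi>) = L2_inner \<Omega> (laplacian \<phi>) \<psi>"
    by (simp add: L2_inner_def mult.commute)
qed auto

lemma H10_add:
  assumes "u \<in> H10 \<Omega>" "w \<in> H10 \<Omega>"
  shows "(\<lambda>x. u x + w x) \<in> H10 \<Omega>"
proof -
  obtain v \<phi> where u: "u \<in> L2 \<Omega>" and v: "\<And>i. v i \<in> L2 \<Omega>" "\<And>i. weak_partial \<Omega> i u (v i)"
    and \<phi>: "\<And>k :: nat. \<phi> k \<in> test_functions \<Omega>" "(\<lambda>k. L2_norm \<Omega> (\<lambda>x. \<phi> k x - u x)) \<longlonglongrightarrow> 0"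
      "\<And>i. (\<lambda>k. L2_norm \<Omega> (\<lambda>x. partial_deriv i (\<phi> k) x - v i x)) \<longlonglongrightarrow> 0"
    using assms(1) unfolding H10_def by blast
  obtain v' \<phi>' where w: "w \<in> L2 \<Omega>" and v': "\<And>i. v' i \<in> L2 \<Omega>" "\<And>i. weak_partial \<Omega> i w (v' i)"
    and \<phi>': "\<And>k :: nat. \<phi>' k \<in> test_functions \<Omega>" "(\<lambda>k. L2_norm \<Omega> (\<lambda>x. \<phi>' k x - w x)) \<longlonglongrightarrow> 0"
      "\<And>i. (\<lambda>k. L2_norm \<Omega> (\<lambda>x. partial_deriv i (\<phi>' k) x - v' i x)) \<longlonglongrightarrow> 0"
    using assms(2) unfolding H10_def by blast
  have lim: "(\<lambda>k. L2_norm \<Omega> (\<lambda>x. (f k x + f' k x) - (a x + a' x))) \<longlonglongrightarrow> 0"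
    if "\<And>k. f k \<in> L2 \<Omega>" "\<And>k. f' k \<in> L2 \<Omega>" "a \<in> L2 \<Omega>" "a' \<in> L2 \<Omega>"
      "(\<lambda>k. L2_norm \<Omega> (\<lambda>x. f k x - a x)) \<longlonglongrightarrow> 0" "(\<lambda>k. L2_norm \<Omega> (\<lambda>x. f' k x - a' x)) \<longlonglongrightarrow> 0"
    for f f' :: "nat \<Rightarrow> real^'n \<Rightarrow> real" and a a'
  proof (rule Lim_null_comparison)
    show "(\<lambda>k. L2_norm \<Omega> (\<lambda>x. f k x - a x) + L2_norm \<Omega> (\<lambda>x. f' k x - a' x)) \<longlonglongrightarrow> 0"
      using tendsto_add[OF that(5,6)] by simp
    have "L2_norm \<Omega> (\<lambda>x. (f k x + f' k x) - (a x + a' x))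
        \<le> L2_norm \<Omega> (\<lambda>x. f k x - a x) + L2_norm \<Omega> (\<lambda>x. f' k x - a' x)" for k
      using L2_triangle[OF L2.diff[OF that(1,3)] L2.diff[OF that(2,4)], of k k]
      by (simp add: algebra_simps)
    thus "\<forall>\<^sub>F k in sequentially. norm (L2_norm \<Omega> (\<lambda>x. (f k x + f' k x) - (a x + a' x)))
        \<le> L2_norm \<Omega> (\<lambda>x. f k x - a x) + L2_norm \<Omega> (\<lambda>x. f' k x - a' x)"
      by (simp add: L2_norm_nonneg)
  qed
  have "partial_deriv i (\<lambda>x. \<phi> k x + \<phi>' k x) x = partial_deriv i (\<phi> k) x + partial_deriv i (\<phi>' k) x" for i k x
    using \<phi>(1) \<phi>'(1) by (intro partial_deriv_add test_function_differentiable)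
  moreover have "weak_partial \<Omega> i (\<lambda>x. u x + w x) (\<lambda>x. v i x + v' i x)" for i
    using v(2)[of i] v'(2)[of i] unfolding weak_partial_def
    by (auto simp: L2.B_add u v(1) w v'(1) test_function_L2 test_function_partial)
  ultimately show ?thesis
    by (intro H10I[of _ _ "\<lambda>i x. v i x + v' i x" "\<lambda>k x. \<phi> k x + \<phi>' k x"])
      (simp_all add: L2_add u w v v' \<phi> \<phi>' test_function_add lim test_function_L2 test_function_partial)
qed

lemma H10_scale:
  assumes "u \<in> H10 \<Omega>"
  shows "(\<lambda>x. c * u x) \<in> H10 \<Omega>"
proof -
  obtain v \<phi> where u: "u \<in> L2 \<Omega>" and v: "\<And>i. v i \<in> L2 \<Omega>" "\<And>i. weak_partial \<Omega> i u (v i)"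
    and \<phi>: "\<And>k :: nat. \<phi> k \<in> test_functions \<Omega>" "(\<lambda>k. L2_norm \<Omega> (\<lambda>x. \<phi> k x - u x)) \<longlonglongrightarrow> 0"
      "\<And>i. (\<lambda>k. L2_norm \<Omega> (\<lambda>x. partial_deriv i (\<phi> k) x - v i x)) \<longlonglongrightarrow> 0"
    using assms(1) unfolding H10_def by blast
  have lim: "(\<lambda>k. L2_norm \<Omega> (\<lambda>x. c * f k x - c * a x)) \<longlonglongrightarrow> 0"
    if "(\<lambda>k. L2_norm \<Omega> (\<lambda>x. f k x - a x)) \<longlonglongrightarrow> 0" for f :: "nat \<Rightarrow> real^'n \<Rightarrow> real" and a
    using tendsto_mult_right_zero[OF that, of "\<bar>c\<bar>"]
    by (simp add: right_diff_distrib[symmetric] L2_norm_scale)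
  have "partial_deriv i (\<lambda>x. c * \<phi> k x) x = c * partial_deriv i (\<phi> k) x" for i k x
    using \<phi>(1) by (intro partial_deriv_cmult test_function_differentiable)
  moreover have "weak_partial \<Omega> i (\<lambda>x. c * u x) (\<lambda>x. c * v i x)" for i
    using v(2)[of i] unfolding weak_partial_def
    by (auto simp: L2.B_scale u v(1) test_function_L2 test_function_partial)
  ultimately show ?thesis
    by (intro H10I[of _ _ "\<lambda>i x. c * v i x" "\<lambda>k x. c * \<phi> k x"])
      (simp_all add: L2_scale u v \<phi> test_function_cmult lim)
qed

lemma solves_add:
  assumes "solves \<Omega> q f u" "solves \<Omega> q g w"
  shows "solves \<Omega> q (\<lambda>x. f x + g x) (\<lambda>x. u x + w x)"
proof -
  obtain h where h: "dirichlet_laplacian \<Omega> u h" "AE x in lebesgue_on \<Omega>. - h x + q x * u x = f x"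
    using assms(1) by (auto simp: solves_def)
  obtain h' where h': "dirichlet_laplacian \<Omega> w h'" "AE x in lebesgue_on \<Omega>. - h' x + q x * w x = g x"
    using assms(2) by (auto simp: solves_def)
  have "dirichlet_laplacian \<Omega> (\<lambda>x. u x + w x) (\<lambda>x. h x + h' x)"
    using h(1) h'(1) unfolding dirichlet_laplacian_def
    by (auto simp: L2.B_add H10_L2 test_function_L2 test_function_laplacian intro!: H10_add L2_add)
  moreover have "AE x in lebesgue_on \<Omega>. - (h x + h' x) + q x * (u x + w x) = f x + g x"
    using h(2) h'(2) by eventually_elim (simp add: algebra_simps)
  ultimately show ?thesis by (auto simp: solves_def)
qed

lemma solves_scale:
  assumes "solves \<Omega> q f u"
  shows "solves \<Omega> q (\<lambda>x. c * f x) (\<lambda>x. c * u x)"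
proof -
  obtain h where h: "dirichlet_laplacian \<Omega> u h" "AE x in lebesgue_on \<Omega>. - h x + q x * u x = f x"
    using assms(1) by (auto simp: solves_def)
  have "dirichlet_laplacian \<Omega> (\<lambda>x. c * u x) (\<lambda>x. c * h x)"
    using h(1) unfolding dirichlet_laplacian_def
    by (auto simp: L2.B_scale H10_L2 test_function_L2 test_function_laplacian intro!: H10_scale L2_scale)
  moreover have "AE x in lebesgue_on \<Omega>. - (c * h x) + q x * (c * u x) = c * f x"
    using h(2) by eventually_elim (simp add: algebra_simps)
  ultimately show ?thesis by (auto simp: solves_def)
qed

lemma solves_diff:
  "solves \<Omega> q f u \<Longrightarrow> solves \<Omega> q g w \<Longrightarrow> solves \<Omega> q (\<lambda>x. f x - g x) (\<lambda>x. u x - w x)"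
  using solves_add[of q f u "\<lambda>x. -1 * g x" "\<lambda>x. -1 * w x"] solves_scale[of q g w "-1"] by simp

text \<open>Moving the difference of the potentials to the right-hand side makes solutions for
  different potentials comparable.\<close>

lemma solves_change_potential:
  assumes "solves \<Omega> q f u"
  shows "solves \<Omega> q' (\<lambda>x. f x + (q' x - q x) * u x) u"
proof -
  obtain h where h: "dirichlet_laplacian \<Omega> u h" "AE x in lebesgue_on \<Omega>. - h x + q x * u x = f x"
    using assms(1) by (auto simp: solves_def)
  have "AE x in lebesgue_on \<Omega>. - h x + q' x * u x = f x + (q' x - q x) * u x"
    using h(2) by eventually_elim (simp add: algebra_simps)
  thus ?thesis using h(1) by (auto simp: solves_def)
qed

section \<open>Energy estimate and solvability\<close>

lemma poincare:
  obtains P where "0 < P"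
    "\<And>\<phi>. \<phi> \<in> test_functions \<Omega> \<Longrightarrow>
      (L2_norm \<Omega> \<phi>)\<^sup>2 \<le> P * (\<Sum>i\<in>UNIV. (L2_norm \<Omega> (partial_deriv i \<phi>))\<^sup>2)"
proof -
  obtain R where R: "0 < R" "\<And>x. x \<in> \<Omega> \<Longrightarrow> norm x \<le> R" using radius_bound by metis
  have "(L2_norm \<Omega> \<phi>)\<^sup>2 \<le> (2 * R)\<^sup>2 * (\<Sum>i\<in>UNIV. (L2_norm \<Omega> (partial_deriv i \<phi>))\<^sup>2)"
    if "\<phi> \<in> test_functions \<Omega>" for \<phi>
  proof -
    fix i0 :: 'n
    have "(L2_norm \<Omega> \<phi>)\<^sup>2 \<le> (2 * R * L2_norm \<Omega> (partial_deriv i0 \<phi>))\<^sup>2"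
      using that R by (intro power_mono poincare_test_function L2_norm_nonneg)
    also have "\<dots> = (2 * R)\<^sup>2 * (L2_norm \<Omega> (partial_deriv i0 \<phi>))\<^sup>2" by (simp add: power_mult_distrib)
    also have "\<dots> \<le> (2 * R)\<^sup>2 * (\<Sum>i\<in>UNIV. (L2_norm \<Omega> (partial_deriv i \<phi>))\<^sup>2)"
      by (intro mult_left_mono member_le_sum) auto
    finally show ?thesis .
  qed
  thus thesis using R that[of "(2 * R)\<^sup>2"] by simp
qed

text \<open>One derivative is moved from the test function to \<open>u\<close>, so that only first
  derivatives remain. The approximating sequence \<phi> is kept in the conclusion because it allows
  testing the equation with \<open>u\<close> itself in the limit.\<close>

lemma solves_weak_form:
  assumes q: "nonneg_potential \<Omega> q" and f: "f \<in> L2 \<Omega>" and sol: "solves \<Omega> q f u"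
  obtains v \<phi> where "\<And>i. v i \<in> L2 \<Omega>" "\<And>k :: nat. \<phi> k \<in> test_functions \<Omega>"
    "(\<lambda>k. L2_norm \<Omega> (\<lambda>x. \<phi> k x - u x)) \<longlonglongrightarrow> 0"
    "\<And>i. (\<lambda>k. L2_norm \<Omega> (\<lambda>x. partial_deriv i (\<phi> k) x - v i x)) \<longlonglongrightarrow> 0"
    "\<And>\<psi>. \<psi> \<in> test_functions \<Omega> \<Longrightarrow>
      (\<Sum>i\<in>UNIV. L2_inner \<Omega> (v i) (partial_deriv i \<psi>)) + L2_inner \<Omega> (\<lambda>x. q x * u x) \<psi> = L2_inner \<Omega> f \<psi>"
proof -
  obtain h where h: "u \<in> H10 \<Omega>" "h \<in> L2 \<Omega>"
    and lap: "\<And>\<phi>. \<phi> \<in> test_functions \<Omega> \<Longrightarrow> L2_inner \<Omega> u (laplacian \<phi>) = L2_inner \<Omega> h \<phi>"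
    and eq: "AE x in lebesgue_on \<Omega>. - h x + q x * u x = f x"
    using sol by (auto simp: solves_def dirichlet_laplacian_def)
  obtain v \<phi> where u: "u \<in> L2 \<Omega>" and v: "\<And>i. v i \<in> L2 \<Omega>" "\<And>i. weak_partial \<Omega> i u (v i)"
    and \<phi>: "\<And>k :: nat. \<phi> k \<in> test_functions \<Omega>" "(\<lambda>k. L2_norm \<Omega> (\<lambda>x. \<phi> k x - u x)) \<longlonglongrightarrow> 0"
      "\<And>i. (\<lambda>k. L2_norm \<Omega> (\<lambda>x. partial_deriv i (\<phi> k) x - v i x)) \<longlonglongrightarrow> 0"
    using h(1) unfolding H10_def by blast
  show thesis
  proof (rule that[OF v(1) \<phi>])
    fix \<psi> assume \<psi>: "\<psi> \<in> test_functions \<Omega>"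
    have qu: "(\<lambda>x. q x * u x) \<in> L2 \<Omega>" by (rule nonneg_potential_mult_L2[OF q u])
    have "L2_inner \<Omega> (v i) (partial_deriv i \<psi>) = - L2_inner \<Omega> u (partial_deriv i (partial_deriv i \<psi>))" for i
      using v(2)[of i] test_function_partial[OF \<psi>, of i] by (simp add: weak_partial_def)
    hence "(\<Sum>i\<in>UNIV. L2_inner \<Omega> (v i) (partial_deriv i \<psi>)) = - L2_inner \<Omega> h \<psi>"
      by (simp add: sum_negf laplacian_inner[OF u \<psi>, symmetric] lap[OF \<psi>])
    moreover have "L2_inner \<Omega> f \<psi> = L2_inner \<Omega> (\<lambda>x. q x * u x - h x) \<psi>"
      unfolding L2_inner_def
    proof (rule integral_cong_AE)
      show "AE x in lebesgue_on \<Omega>. f x * \<psi> x = (q x * u x - h x) * \<psi> x"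
        using eq by eventually_elim auto
    qed (use L2_measurable[OF f] L2_measurable[OF qu] L2_measurable[OF h(2)]
          L2_measurable[OF test_function_L2[OF \<psi>]] in auto)
    moreover have "L2_inner \<Omega> (\<lambda>x. q x * u x - h x) \<psi> = L2_inner \<Omega> (\<lambda>x. q x * u x) \<psi> - L2_inner \<Omega> h \<psi>"
      by (intro L2_inner_diff qu h test_function_L2 \<psi>)
    ultimately show "(\<Sum>i\<in>UNIV. L2_inner \<Omega> (v i) (partial_deriv i \<psi>)) + L2_inner \<Omega> (\<lambda>x. q x * u x) \<psi>
        = L2_inner \<Omega> f \<psi>" by simp
  qed
qed

text \<open>Testing with the approximations of \<open>u\<close> yields the energy identity: the
  squared norms of the \<open>v i\<close> and \<open>\<langle>q u, u\<rangle>\<close> add up to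
  \<open>\<langle>f, u\<rangle>\<close>. The potential term is nonnegative and may be dropped, and
  the Poincare inequality passes to the limit. Hence \<open>P\<close> is the Poincare constant, the
  same for all potentials.\<close>

lemma solves_norm_le_ex:
  "\<exists>P>0. \<forall>q f u. nonneg_potential \<Omega> q \<longrightarrow> f \<in> L2 \<Omega> \<longrightarrow> solves \<Omega> q f u \<longrightarrow>
     L2_norm \<Omega> u \<le> P * L2_norm \<Omega> f"
proof -
  obtain P where P: "0 < P" "\<And>\<phi>. \<phi> \<in> test_functions \<Omega> \<Longrightarrow>
      (L2_norm \<Omega> \<phi>)\<^sup>2 \<le> P * (\<Sum>i\<in>UNIV. (L2_norm \<Omega> (partial_deriv i \<phi>))\<^sup>2)"
    using poincare by metis
  have "L2_norm \<Omega> u \<le> P * L2_norm \<Omega> f"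
    if q: "nonneg_potential \<Omega> q" and f: "f \<in> L2 \<Omega>" and sol: "solves \<Omega> q f u" for q f u
  proof -
    obtain v \<phi> where v: "\<And>i. v i \<in> L2 \<Omega>" and \<phi>: "\<And>k :: nat. \<phi> k \<in> test_functions \<Omega>"
      "(\<lambda>k. L2_norm \<Omega> (\<lambda>x. \<phi> k x - u x)) \<longlonglongrightarrow> 0"
      "\<And>i. (\<lambda>k. L2_norm \<Omega> (\<lambda>x. partial_deriv i (\<phi> k) x - v i x)) \<longlonglongrightarrow> 0"
      and weak: "\<And>\<psi>. \<psi> \<in> test_functions \<Omega> \<Longrightarrow>
      (\<Sum>i\<in>UNIV. L2_inner \<Omega> (v i) (partial_deriv i \<psi>)) + L2_inner \<Omega> (\<lambda>x. q x * u x) \<psi> = L2_inner \<Omega> f \<psi>"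
      using solves_weak_form[OF q f sol] by blast
    have u: "u \<in> L2 \<Omega>" by (rule solves_L2[OF sol])
    have qu: "(\<lambda>x. q x * u x) \<in> L2 \<Omega>" by (rule nonneg_potential_mult_L2[OF q u])
    have lim: "(\<lambda>k. L2_inner \<Omega> w (\<phi> k)) \<longlonglongrightarrow> L2_inner \<Omega> w u" if "w \<in> L2 \<Omega>" for w
      using L2_inner_tendsto[OF test_function_L2[OF \<phi>(1)] u \<phi>(2) that]
      by (simp add: L2_inner_def mult.commute)
    have lim': "(\<lambda>k. L2_inner \<Omega> w (partial_deriv i (\<phi> k))) \<longlonglongrightarrow> L2_inner \<Omega> w (v i)" if "w \<in> L2 \<Omega>" for w i
      using L2_inner_tendsto[OF test_function_L2[OF test_function_partial[OF \<phi>(1)]] v \<phi>(3) that]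
      by (simp add: L2_inner_def mult.commute)
    have "(\<lambda>k. (\<Sum>i\<in>UNIV. L2_inner \<Omega> (v i) (partial_deriv i (\<phi> k))) + L2_inner \<Omega> (\<lambda>x. q x * u x) (\<phi> k))
        \<longlonglongrightarrow> (\<Sum>i\<in>UNIV. L2_inner \<Omega> (v i) (v i)) + L2_inner \<Omega> (\<lambda>x. q x * u x) u"
      by (intro tendsto_add tendsto_sum lim lim' v qu)
    hence "(\<lambda>k. L2_inner \<Omega> f (\<phi> k)) \<longlonglongrightarrow> (\<Sum>i\<in>UNIV. L2_inner \<Omega> (v i) (v i)) + L2_inner \<Omega> (\<lambda>x. q x * u x) u"
      by (simp add: weak \<phi>(1))
    hence energy: "(\<Sum>i\<in>UNIV. L2_inner \<Omega> (v i) (v i)) + L2_inner \<Omega> (\<lambda>x. q x * u x) u = L2_inner \<Omega> f u"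
      using lim[OF f] LIMSEQ_unique by blast
    have "(L2_norm \<Omega> u)\<^sup>2 \<le> P * (\<Sum>i\<in>UNIV. (L2_norm \<Omega> (v i))\<^sup>2)"
    proof (rule LIMSEQ_le)
      show "(\<lambda>k. (L2_norm \<Omega> (\<phi> k))\<^sup>2) \<longlonglongrightarrow> (L2_norm \<Omega> u)\<^sup>2"
        by (intro tendsto_power L2_norm_tendsto test_function_L2 \<phi> u)
      show "(\<lambda>k. P * (\<Sum>i\<in>UNIV. (L2_norm \<Omega> (partial_deriv i (\<phi> k)))\<^sup>2))
          \<longlonglongrightarrow> P * (\<Sum>i\<in>UNIV. (L2_norm \<Omega> (v i))\<^sup>2)"
        by (intro tendsto_mult tendsto_const tendsto_sum tendsto_power L2_norm_tendsto
            test_function_L2 test_function_partial \<phi> v)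
    qed (use P \<phi> in auto)
    also have "(\<Sum>i\<in>UNIV. (L2_norm \<Omega> (v i))\<^sup>2) \<le> L2_inner \<Omega> f u"
      using energy nonneg_potential_inner_nonneg[OF q, of u] by (simp add: L2_norm_power2)
    also have "\<dots> \<le> L2_norm \<Omega> f * L2_norm \<Omega> u"
      using L2_cauchy_schwarz[OF f u] by linarith
    finally have "L2_norm \<Omega> u * L2_norm \<Omega> u \<le> (P * L2_norm \<Omega> f) * L2_norm \<Omega> u"
      using P(1) by (simp add: power2_eq_square mult.assoc)
    thus ?thesis
      using L2_norm_nonneg[of \<Omega> u] L2_norm_nonneg[of \<Omega> f] P(1)
      by (cases "L2_norm \<Omega> u = 0") (auto simp: mult_le_cancel_right)
  qed
  thus ?thesis using P(1) by blast
qed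

text \<open>The bound is uniform in the potential; it gives uniqueness, and it dominates the averages.\<close>

definition green_bound :: real where
  "green_bound = (SOME P. 0 < P \<and> (\<forall>q f u. nonneg_potential \<Omega> q \<longrightarrow> f \<in> L2 \<Omega> \<longrightarrow>
     solves \<Omega> q f u \<longrightarrow> L2_norm \<Omega> u \<le> P * L2_norm \<Omega> f))"

lemma green_bound:
  "0 < green_bound"
  "nonneg_potential \<Omega> q \<Longrightarrow> f \<in> L2 \<Omega> \<Longrightarrow> solves \<Omega> q f u \<Longrightarrow> L2_norm \<Omega> u \<le> green_bound * L2_norm \<Omega> f"
  using someI_ex[OF solves_norm_le_ex[unfolded Bex_def]] unfolding green_bound_def by blast+

text \<open>The energy form is considered on test functions, where \<open>riesz_sequence\<close>
  asks for no completeness. By the Poincare inequality its minimising sequence is Cauchy in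
  \<open>L^2\<close> together with all first derivatives, and the limits \<open>u'\<close> and
  \<open>v\<close> form exactly the data that place \<open>u'\<close> in
  \<open>H10 \<Omega>\<close>.\<close>

lemma solves_exists:
  assumes q: "nonneg_potential \<Omega> q" and f: "f \<in> L2 \<Omega>"
  shows "\<exists>u. solves \<Omega> q f u"
proof -
  define E where "E u v = (\<Sum>i\<in>UNIV. L2_inner \<Omega> (partial_deriv i u) (partial_deriv i v))
      + L2_inner \<Omega> (\<lambda>x. q x * u x) v" for u v
  note L2I = test_function_L2 test_function_partial nonneg_potential_mult_L2[OF q]
  interpret E: semi_inner "test_functions \<Omega>" E
  proof
    fix u v w :: "real^'n \<Rightarrow> real" and c
    assume u: "u \<in> test_functions \<Omega>"
    note Du = test_function_differentiable[OF u]
    show "0 \<le> E u u"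
      unfolding E_def by (intro add_nonneg_nonneg sum_nonneg nonneg_potential_inner_nonneg q L2.B_nonneg L2I u)
    show "E u v = E v u"
      by (simp add: E_def L2_inner_def mult_ac)
    assume w: "w \<in> test_functions \<Omega>"
    have "(\<lambda>x. q x * (c * u x)) = (\<lambda>x. c * (q x * u x))" by (auto simp: mult_ac)
    thus "E (\<lambda>x. c * u x) w = c * E u w"
      using u w by (simp add: E_def partial_deriv_cmult[OF Du, abs_def] L2.B_scale L2I sum_distrib_left distrib_left)
    assume v: "v \<in> test_functions \<Omega>"
    note Dv = test_function_differentiable[OF v]
    show "E (\<lambda>x. u x + v x) w = E u w + E v w"
      using u v w by (simp add: E_def partial_deriv_add[OF Du Dv, abs_def] L2.B_add L2I sum.distrib distrib_left)
  qed (auto intro: test_function_zero test_function_add test_function_cmult)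
  obtain P where P: "0 < P" "\<And>\<phi>. \<phi> \<in> test_functions \<Omega> \<Longrightarrow>
      (L2_norm \<Omega> \<phi>)\<^sup>2 \<le> P * (\<Sum>i\<in>UNIV. (L2_norm \<Omega> (partial_deriv i \<phi>))\<^sup>2)"
    using poincare by metis
  have E_partial: "(\<Sum>i\<in>UNIV. (L2_norm \<Omega> (partial_deriv i \<phi>))\<^sup>2) \<le> E \<phi> \<phi>" if "\<phi> \<in> test_functions \<Omega>" for \<phi>
    using nonneg_potential_inner_nonneg[OF q, of \<phi>] by (simp add: E_def L2_norm_power2)
  have E_norm: "(L2_norm \<Omega> \<phi>)\<^sup>2 \<le> P * E \<phi> \<phi>" if "\<phi> \<in> test_functions \<Omega>" for \<phi>
    using P(2)[OF that] mult_left_mono[OF E_partial[OF that], of P] P(1) by linarith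
  have "\<exists>u :: nat \<Rightarrow> real^'n \<Rightarrow> real. (\<forall>k. u k \<in> test_functions \<Omega>) \<and>
    (\<forall>m n. E (\<lambda>x. u m x - u n x) (\<lambda>x. u m x - u n x) \<le> 2 * (1 / Suc m + 1 / Suc n)) \<and>
    (\<forall>v\<in>test_functions \<Omega>. (\<lambda>k. E (u k) v) \<longlonglongrightarrow> L2_inner \<Omega> f v)"
  proof (rule E.riesz_sequence)
    fix u assume u: "u \<in> test_functions \<Omega>"
    show "L2_inner \<Omega> f (\<lambda>x. c * u x) = c * L2_inner \<Omega> f u" for c
      by (intro L2.B_scale_right L2I u f)
    have "L2_norm \<Omega> u \<le> sqrt (P * E u u)"
      using real_sqrt_le_mono[OF E_norm[OF u]] by (simp add: L2_norm_nonneg)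
    hence "L2_norm \<Omega> f * L2_norm \<Omega> u \<le> L2_norm \<Omega> f * (sqrt P * sqrt (E u u))"
      by (intro mult_left_mono L2_norm_nonneg) (simp add: real_sqrt_mult)
    thus "\<bar>L2_inner \<Omega> f u\<bar> \<le> (L2_norm \<Omega> f * sqrt P) * sqrt (E u u)"
      using L2_cauchy_schwarz[OF f test_function_L2[OF u]] by (simp add: mult.assoc)
    show "L2_inner \<Omega> f (\<lambda>x. u x + v x) = L2_inner \<Omega> f u + L2_inner \<Omega> f v"
      if "v \<in> test_functions \<Omega>" for v
      by (intro L2.B_add_right L2I u f that)
  qed
  then obtain u :: "nat \<Rightarrow> real^'n \<Rightarrow> real" where u: "\<And>k. u k \<in> test_functions \<Omega>"
    and cauchy: "\<And>m n. E (\<lambda>x. u m x - u n x) (\<lambda>x. u m x - u n x) \<le> 2 * (1 / Suc m + 1 / Suc n)"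
    and lim: "\<And>v. v \<in> test_functions \<Omega> \<Longrightarrow> (\<lambda>k. E (u k) v) \<longlonglongrightarrow> L2_inner \<Omega> f v"
    by blast
  have ud: "(\<lambda>x. u m x - u n x) \<in> test_functions \<Omega>" for m n by (intro test_function_diff u)
  have cu: "(L2_norm \<Omega> (\<lambda>x. u m x - u n x))\<^sup>2 \<le> (P * 2) * (1 / Suc m + 1 / Suc n)" for m n
    using order_trans[OF E_norm[OF ud, of m n] mult_left_mono[OF cauchy[of m n] less_imp_le[OF P(1)]]]
    by (simp only: mult.assoc)
  obtain u' where u': "u' \<in> L2 \<Omega>" "(\<lambda>k. L2_norm \<Omega> (\<lambda>x. u k x - u' x)) \<longlonglongrightarrow> 0"
    by (rule L2_complete[OF finite_measure_\<Omega> test_function_L2[OF u] cauchy_seqI_inverse_Suc[OF cu]])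
  have ex_v: "\<exists>v. v \<in> L2 \<Omega> \<and> (\<lambda>k. L2_norm \<Omega> (\<lambda>x. partial_deriv i (u k) x - v x)) \<longlonglongrightarrow> 0" for i
  proof -
    have "partial_deriv i (\<lambda>x. u m x - u n x) x = partial_deriv i (u m) x - partial_deriv i (u n) x" for m n x
      using partial_deriv_add[OF test_function_differentiable[OF u[of m]]
          test_function_differentiable[OF test_function_cmult[OF u[of n], of "-1"]], of i x]
        partial_deriv_cmult[OF test_function_differentiable[OF u[of n]], of i "-1" x] by simp
    hence eq: "partial_deriv i (\<lambda>x. u m x - u n x) = (\<lambda>x. partial_deriv i (u m) x - partial_deriv i (u n) x)" for m n
      by auto
    have cv: "(L2_norm \<Omega> (\<lambda>x. partial_deriv i (u m) x - partial_deriv i (u n) x))\<^sup>2 \<le> 2 * (1 / Suc m + 1 / Suc n)" for m n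
    proof -
      have "(L2_norm \<Omega> (partial_deriv i (\<lambda>x. u m x - u n x)))\<^sup>2
          \<le> (\<Sum>i\<in>UNIV. (L2_norm \<Omega> (partial_deriv i (\<lambda>x. u m x - u n x)))\<^sup>2)"
        by (rule member_le_sum) auto
      also have "\<dots> \<le> 2 * (1 / Suc m + 1 / Suc n)" using E_partial[OF ud] cauchy order_trans by blast
      finally show ?thesis unfolding eq .
    qed
    obtain f' where "f' \<in> L2 \<Omega>" "(\<lambda>k. L2_norm \<Omega> (\<lambda>x. partial_deriv i (u k) x - f' x)) \<longlonglongrightarrow> 0"
      by (rule L2_complete[OF finite_measure_\<Omega> test_function_L2[OF test_function_partial[OF u]]
          cauchy_seqI_inverse_Suc[OF cv]])
    thus ?thesis by (intro exI[of _ f'] conjI)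
  qed
  have "\<exists>v. \<forall>i. v i \<in> L2 \<Omega> \<and> (\<lambda>k. L2_norm \<Omega> (\<lambda>x. partial_deriv i (u k) x - v i x)) \<longlonglongrightarrow> 0"
    by (rule choice) (rule allI, rule ex_v)
  then obtain v where v: "\<And>i. v i \<in> L2 \<Omega>"
    "\<And>i. (\<lambda>k. L2_norm \<Omega> (\<lambda>x. partial_deriv i (u k) x - v i x)) \<longlonglongrightarrow> 0"
    by blast
  have limu: "(\<lambda>k. L2_inner \<Omega> (u k) w) \<longlonglongrightarrow> L2_inner \<Omega> u' w" if "w \<in> L2 \<Omega>" for w
    by (intro L2_inner_tendsto test_function_L2 u u' that)
  have limv: "(\<lambda>k. L2_inner \<Omega> (partial_deriv i (u k)) w) \<longlonglongrightarrow> L2_inner \<Omega> (v i) w" if "w \<in> L2 \<Omega>" for w i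
    by (intro L2_inner_tendsto test_function_L2 test_function_partial u v that)
  have wp: "weak_partial \<Omega> i u' (v i)" for i
    unfolding weak_partial_def
  proof
    fix \<phi> assume \<phi>: "\<phi> \<in> test_functions \<Omega>"
    have "(\<lambda>k. - L2_inner \<Omega> (u k) (partial_deriv i \<phi>)) \<longlonglongrightarrow> - L2_inner \<Omega> u' (partial_deriv i \<phi>)"
      by (intro tendsto_minus limu L2I \<phi>)
    hence "(\<lambda>k. L2_inner \<Omega> (partial_deriv i (u k)) \<phi>) \<longlonglongrightarrow> - L2_inner \<Omega> u' (partial_deriv i \<phi>)"
      by (simp add: integration_by_parts u \<phi>)
    thus "L2_inner \<Omega> u' (partial_deriv i \<phi>) = - L2_inner \<Omega> (v i) \<phi>"
      using LIMSEQ_unique[OF limv[OF test_function_L2[OF \<phi>], of i]] by fastforce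
  qed
  have qu: "(\<lambda>x. q x * u' x) \<in> L2 \<Omega>" by (rule nonneg_potential_mult_L2[OF q u'(1)])
  have weak: "(\<Sum>i\<in>UNIV. L2_inner \<Omega> (v i) (partial_deriv i \<psi>)) + L2_inner \<Omega> (\<lambda>x. q x * u' x) \<psi> = L2_inner \<Omega> f \<psi>"
    if \<psi>: "\<psi> \<in> test_functions \<Omega>" for \<psi>
  proof (rule LIMSEQ_unique[OF _ lim[OF \<psi>]])
    have "(\<lambda>k. (\<Sum>i\<in>UNIV. L2_inner \<Omega> (partial_deriv i (u k)) (partial_deriv i \<psi>)) + L2_inner \<Omega> (u k) (\<lambda>x. q x * \<psi> x))
      \<longlonglongrightarrow> (\<Sum>i\<in>UNIV. L2_inner \<Omega> (v i) (partial_deriv i \<psi>)) + L2_inner \<Omega> u' (\<lambda>x. q x * \<psi> x)"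
      by (intro tendsto_add tendsto_sum limu limv L2I \<psi>)
    thus "(\<lambda>k. E (u k) \<psi>) \<longlonglongrightarrow>
        (\<Sum>i\<in>UNIV. L2_inner \<Omega> (v i) (partial_deriv i \<psi>)) + L2_inner \<Omega> (\<lambda>x. q x * u' x) \<psi>"
      by (simp add: E_def L2_inner_mult_left)
  qed
  have "dirichlet_laplacian \<Omega> u' (\<lambda>x. q x * u' x - f x)"
    unfolding dirichlet_laplacian_def
  proof (intro conjI ballI)
    show "u' \<in> H10 \<Omega>" by (intro H10I[of _ _ v u] u u' v wp)
    show "(\<lambda>x. q x * u' x - f x) \<in> L2 \<Omega>" by (intro L2.diff qu f)
    fix \<psi> assume \<psi>: "\<psi> \<in> test_functions \<Omega>"
    have "L2_inner \<Omega> u' (laplacian \<psi>) = (\<Sum>i\<in>UNIV. L2_inner \<Omega> u' (partial_deriv i (partial_deriv i \<psi>)))"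
      by (intro laplacian_inner u' \<psi>)
    also have "\<dots> = - (\<Sum>i\<in>UNIV. L2_inner \<Omega> (v i) (partial_deriv i \<psi>))"
      using wp \<psi> by (simp add: weak_partial_def test_function_partial sum_negf)
    also have "\<dots> = L2_inner \<Omega> (\<lambda>x. q x * u' x - f x) \<psi>"
      using weak[OF \<psi>] by (simp add: L2_inner_diff qu f test_function_L2 \<psi>)
    finally show "L2_inner \<Omega> u' (laplacian \<psi>) = L2_inner \<Omega> (\<lambda>x. q x * u' x - f x) \<psi>" .
  qed
  thus ?thesis unfolding solves_def by (intro exI[of _ u'] exI[of _ "\<lambda>x. q x * u' x - f x"]) auto
qed

section \<open>Green's operators through their inner products\<close>

lemma green_solves:
  "nonneg_potential \<Omega> q \<Longrightarrow> f \<in> L2 \<Omega> \<Longrightarrow> solves \<Omega> q f (green \<Omega> q f)"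
  unfolding green_eq_solves by (rule someI_ex[OF solves_exists])

lemma green_L2: "nonneg_potential \<Omega> q \<Longrightarrow> f \<in> L2 \<Omega> \<Longrightarrow> green \<Omega> q f \<in> L2 \<Omega>"
  by (rule solves_L2[OF green_solves])

text \<open>Uniqueness up to null sets: the difference of two solutions solves the problem with
  right-hand side 0, and the uniform bound forces its norm to vanish. Linearity in \<open>f\<close>
  and the resolvent equation follow by exhibiting a solution.\<close>

lemma green_inner_eq:
  assumes q: "nonneg_potential \<Omega> q" and f: "f \<in> L2 \<Omega>" and sol: "solves \<Omega> q f u" and g: "g \<in> L2 \<Omega>"
  shows "L2_inner \<Omega> (green \<Omega> q f) g = L2_inner \<Omega> u g"
proof -
  have L2: "green \<Omega> q f \<in> L2 \<Omega>" "u \<in> L2 \<Omega>"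
    by (rule green_L2[OF q f], rule solves_L2[OF sol])
  have "solves \<Omega> q (\<lambda>x. 0) (\<lambda>x. green \<Omega> q f x - u x)"
    using solves_diff[OF green_solves[OF q f] sol] by simp
  hence "L2_norm \<Omega> (\<lambda>x. green \<Omega> q f x - u x) \<le> 0"
    using green_bound(2)[OF q L2_zero] by fastforce
  hence "L2_norm \<Omega> (\<lambda>x. green \<Omega> q f x - u x) = 0"
    using L2_norm_nonneg order_antisym by blast
  hence "L2_inner \<Omega> (\<lambda>x. green \<Omega> q f x - u x) g = 0"
    using L2_cauchy_schwarz[OF L2.diff[OF L2] g] by simp
  thus ?thesis by (simp add: L2_inner_diff L2 g)
qed

lemma green_inner_add:
  assumes q: "nonneg_potential \<Omega> q" and "f \<in> L2 \<Omega>" "f' \<in> L2 \<Omega>" "g \<in> L2 \<Omega>"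
  shows "L2_inner \<Omega> (green \<Omega> q (\<lambda>x. f x + f' x)) g = L2_inner \<Omega> (green \<Omega> q f) g + L2_inner \<Omega> (green \<Omega> q f') g"
  using green_inner_eq[OF q L2_add solves_add[OF green_solves green_solves]]
  by (simp add: assms green_L2 L2.B_add)

lemma green_inner_scale:
  assumes q: "nonneg_potential \<Omega> q" and "f \<in> L2 \<Omega>" "g \<in> L2 \<Omega>"
  shows "L2_inner \<Omega> (green \<Omega> q (\<lambda>x. c * f x)) g = c * L2_inner \<Omega> (green \<Omega> q f) g"
  using green_inner_eq[OF q L2_scale solves_scale[OF green_solves]]
  by (simp add: assms green_L2 L2.B_scale)

lemma green_inner_sum:
  assumes q: "nonneg_potential \<Omega> q" and g: "g \<in> L2 \<Omega>" and "finite I"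
  shows "(\<And>i. i \<in> I \<Longrightarrow> f i \<in> L2 \<Omega>) \<Longrightarrow>
    L2_inner \<Omega> (green \<Omega> q (\<lambda>x. \<Sum>i\<in>I. f i x)) g = (\<Sum>i\<in>I. L2_inner \<Omega> (green \<Omega> q (f i)) g)"
  using assms(3)
proof (induction I)
  case empty
  show ?case using green_inner_scale[OF q L2_zero g, of 0] by simp
next
  case (insert i I)
  thus ?case by (simp add: green_inner_add[OF q _ L2_sum g])
qed

lemma green_inner_test_function:
  assumes q: "nonneg_potential \<Omega> q" and \<phi>: "\<phi> \<in> test_functions \<Omega>" and g: "g \<in> L2 \<Omega>"
  shows "L2_inner \<Omega> (green \<Omega> q (\<lambda>x. - laplacian \<phi> x + q x * \<phi> x)) g = L2_inner \<Omega> \<phi> g"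
proof (rule green_inner_eq[OF q _ solves_test_function[OF \<phi>] g])
  have "(\<lambda>x. (-1) * laplacian \<phi> x + q x * \<phi> x) \<in> L2 \<Omega>"
    by (intro L2_add L2_scale nonneg_potential_mult_L2 q test_function_L2 test_function_laplacian \<phi>)
  thus "(\<lambda>x. - laplacian \<phi> x + q x * \<phi> x) \<in> L2 \<Omega>" by simp
qed

lemma green_norm_le:
  "nonneg_potential \<Omega> q \<Longrightarrow> f \<in> L2 \<Omega> \<Longrightarrow> L2_norm \<Omega> (green \<Omega> q f) \<le> green_bound * L2_norm \<Omega> f"
  by (rule green_bound(2)[OF _ _ green_solves])

lemma green_inner_le:
  assumes "nonneg_potential \<Omega> q" "f \<in> L2 \<Omega>" "g \<in> L2 \<Omega>"
  shows "\<bar>L2_inner \<Omega> (green \<Omega> q f) g\<bar> \<le> green_bound * L2_norm \<Omega> f * L2_norm \<Omega> g"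
proof -
  have "\<bar>L2_inner \<Omega> (green \<Omega> q f) g\<bar> \<le> L2_norm \<Omega> (green \<Omega> q f) * L2_norm \<Omega> g"
    by (intro L2_cauchy_schwarz green_L2 assms)
  also have "\<dots> \<le> green_bound * L2_norm \<Omega> f * L2_norm \<Omega> g"
    by (intro mult_right_mono green_norm_le assms L2_norm_nonneg)
  finally show ?thesis .
qed

text \<open>The difference of the solutions \<open>u\<close> and \<open>u'\<close> solves the
  problem for \<open>q\<close> with right-hand side \<open>-(q - q') u'\<close>; one factor
  \<open>green_bound\<close> comes from this problem, the other from \<open>u'\<close>. The estimate
  is what makes the Green's operators measurable in the random parameters.\<close>

lemma green_inner_potential_lipschitz:
  assumes q: "nonneg_potential \<Omega> q" and q': "nonneg_potential \<Omega> q'" and f: "f \<in> L2 \<Omega>" and g: "g \<in> L2 \<Omega>"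
    and e: "0 \<le> e" "\<And>x. x \<in> \<Omega> \<Longrightarrow> \<bar>q x - q' x\<bar> \<le> e"
  shows "\<bar>L2_inner \<Omega> (green \<Omega> q f) g - L2_inner \<Omega> (green \<Omega> q' f) g\<bar>
    \<le> green_bound * green_bound * L2_norm \<Omega> f * L2_norm \<Omega> g * e"
proof -
  let ?u = "green \<Omega> q f" and ?u' = "green \<Omega> q' f"
  have u: "?u \<in> L2 \<Omega>" "?u' \<in> L2 \<Omega>" by (intro green_L2 q q' f)+
  have "(\<lambda>x. q x - q' x) \<in> borel_measurable (lebesgue_on \<Omega>)"
    using q q' by (auto simp: nonneg_potential_def)
  note w = L2_bounded_mult[OF u(2) this e(2)]
  have "solves \<Omega> q (\<lambda>x. f x - (f x + (q x - q' x) * ?u' x)) (\<lambda>x. ?u x - ?u' x)"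
    by (intro solves_diff solves_change_potential green_solves q q' f)
  hence "solves \<Omega> q (\<lambda>x. (-1) * ((q x - q' x) * ?u' x)) (\<lambda>x. ?u x - ?u' x)" by simp
  hence "L2_norm \<Omega> (\<lambda>x. ?u x - ?u' x) \<le> green_bound * L2_norm \<Omega> (\<lambda>x. (-1) * ((q x - q' x) * ?u' x))"
    by (intro green_bound(2)[OF q] L2_scale w)
  also have "\<dots> = green_bound * L2_norm \<Omega> (\<lambda>x. (q x - q' x) * ?u' x)" by (subst L2_norm_scale) simp
  also have "\<dots> \<le> green_bound * (e * (green_bound * L2_norm \<Omega> f))"
    by (intro mult_left_mono order_trans[OF w(2)] green_norm_le q' f e) (use green_bound(1) in auto)
  finally have "L2_norm \<Omega> (\<lambda>x. ?u x - ?u' x) * L2_norm \<Omega> g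
      \<le> green_bound * (e * (green_bound * L2_norm \<Omega> f)) * L2_norm \<Omega> g"
    by (intro mult_right_mono L2_norm_nonneg)
  moreover have "\<bar>L2_inner \<Omega> (\<lambda>x. ?u x - ?u' x) g\<bar> \<le> L2_norm \<Omega> (\<lambda>x. ?u x - ?u' x) * L2_norm \<Omega> g"
    by (intro L2_cauchy_schwarz L2.diff u g)
  ultimately show ?thesis by (simp add: L2_inner_diff u g mult_ac)
qed

end

subsection \<open>High-frequency asymptotics\<close>

text \<open>\<open>F = O(\<kappa>^-s)\<close>, required on the whole half-line
  \<open>\<kappa> \<ge> 1\<close> and not just eventually. There a higher order implies every lower
  one with the same constant.\<close>

definition decays :: "nat \<Rightarrow> (real \<Rightarrow> real) \<Rightarrow> bool" where
  "decays s F \<longleftrightarrow> (\<exists>C. \<forall>\<kappa>\<ge>1. \<bar>F \<kappa>\<bar> \<le> C / \<kappa> ^ s)"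

lemma decaysI: "(\<And>\<kappa>. 1 \<le> \<kappa> \<Longrightarrow> \<bar>F \<kappa>\<bar> \<le> C / \<kappa> ^ s) \<Longrightarrow> decays s F"
  by (auto simp: decays_def)

lemma decays_add:
  assumes "decays s F" "decays s G"
  shows "decays s (\<lambda>\<kappa>. F \<kappa> + G \<kappa>)"
proof -
  obtain C C' where "\<And>\<kappa>. 1 \<le> \<kappa> \<Longrightarrow> \<bar>F \<kappa>\<bar> \<le> C / \<kappa> ^ s" "\<And>\<kappa>. 1 \<le> \<kappa> \<Longrightarrow> \<bar>G \<kappa>\<bar> \<le> C' / \<kappa> ^ s"
    using assms unfolding decays_def by blast
  hence "\<bar>F \<kappa> + G \<kappa>\<bar> \<le> (C + C') / \<kappa> ^ s" if "1 \<le> \<kappa>" for \<kappa>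
    using that abs_triangle_ineq[of "F \<kappa>" "G \<kappa>"] by (fastforce simp: add_divide_distrib)
  thus ?thesis by (rule decaysI)
qed

lemma decays_cmult:
  assumes "decays s F"
  shows "decays s (\<lambda>\<kappa>. c * F \<kappa>)"
proof -
  obtain C where C: "\<And>\<kappa>. 1 \<le> \<kappa> \<Longrightarrow> \<bar>F \<kappa>\<bar> \<le> C / \<kappa> ^ s"
    using assms unfolding decays_def by blast
  have "\<bar>c * F \<kappa>\<bar> \<le> (\<bar>c\<bar> * C) / \<kappa> ^ s" if "1 \<le> \<kappa>" for \<kappa>
    using mult_left_mono[OF C[OF that], of "\<bar>c\<bar>"] by (simp add: abs_mult)
  thus ?thesis by (rule decaysI)
qed

lemma decays_zero: "decays s (\<lambda>\<kappa>. 0)"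
  by (rule decaysI[of _ 0]) simp

lemma decays_minus: "decays s F \<Longrightarrow> decays s (\<lambda>\<kappa>. - F \<kappa>)"
  using decays_cmult[of s F "-1"] by simp

lemma decays_diff: "decays s F \<Longrightarrow> decays s G \<Longrightarrow> decays s (\<lambda>\<kappa>. F \<kappa> - G \<kappa>)"
  using decays_add[OF _ decays_minus] by simp

lemma decays_sum: "(\<And>i. i \<in> I \<Longrightarrow> decays s (F i)) \<Longrightarrow> decays s (\<lambda>\<kappa>. \<Sum>i\<in>I. F i \<kappa>)"
  by (induction I rule: infinite_finite_induct) (auto intro: decays_zero decays_add)

lemma decays_mono:
  assumes "decays s F" "t \<le> s"
  shows "decays t F"
proof -
  obtain C where C: "\<And>\<kappa>. 1 \<le> \<kappa> \<Longrightarrow> \<bar>F \<kappa>\<bar> \<le> C / \<kappa> ^ s"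
    using assms unfolding decays_def by blast
  have "0 \<le> C" using C[of 1] abs_ge_zero[of "F 1"] by simp
  hence "C / \<kappa> ^ s \<le> C / \<kappa> ^ t" if "1 \<le> \<kappa>" for \<kappa>
    using that assms(2) by (intro divide_left_mono power_increasing) auto
  thus ?thesis using C by (intro decaysI[of _ C]) (meson order_trans)
qed

lemma decays_divide:
  assumes "decays s F"
  shows "decays (s + t) (\<lambda>\<kappa>. F \<kappa> / \<kappa> ^ t)"
proof -
  obtain C where C: "\<And>\<kappa>. 1 \<le> \<kappa> \<Longrightarrow> \<bar>F \<kappa>\<bar> \<le> C / \<kappa> ^ s"
    using assms unfolding decays_def by blast
  have "\<bar>F \<kappa> / \<kappa> ^ t\<bar> \<le> C / \<kappa> ^ (s + t)" if "1 \<le> \<kappa>" for \<kappa>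
    using divide_right_mono[OF C[OF that], of "\<kappa> ^ t"] that by (simp add: abs_divide power_add)
  thus ?thesis by (rule decaysI)
qed

lemma decays_cong: "decays s F \<Longrightarrow> (\<And>\<kappa>. 1 \<le> \<kappa> \<Longrightarrow> F \<kappa> = G \<kappa>) \<Longrightarrow> decays s G"
  by (auto simp: decays_def)

lemma decays_const_eq_0:
  assumes "decays 1 (\<lambda>\<kappa>. c)"
  shows "c = 0"
proof (rule ccontr)
  assume "c \<noteq> 0"
  obtain C where C: "\<And>\<kappa>. 1 \<le> \<kappa> \<Longrightarrow> \<bar>c\<bar> \<le> C / \<kappa>"
    using assms unfolding decays_def by auto
  define \<kappa> where "\<kappa> = max 1 ((C + 1) / \<bar>c\<bar>)"
  have "1 \<le> \<kappa>" "(C + 1) / \<bar>c\<bar> \<le> \<kappa>" by (auto simp: \<kappa>_def)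
  hence "\<bar>c\<bar> * \<kappa> \<le> C" "C + 1 \<le> \<kappa> * \<bar>c\<bar>"
    using C[of \<kappa>] \<open>c \<noteq> 0\<close> by (simp_all add: field_simps)
  thus False by (simp add: mult.commute)
qed

section \<open>Oscillating test functions\<close>

definition wave :: "'n \<Rightarrow> real \<Rightarrow> real \<Rightarrow> (real^'n::finite \<Rightarrow> real) \<Rightarrow> real^'n \<Rightarrow> real" where
  "wave i0 \<kappa> \<theta> a x = cos (\<kappa> * x $ i0 + \<theta>) * a x"

lemma smooth_on_phase: "smooth_on UNIV (\<lambda>x. cos (\<kappa> * x $ i0 + \<theta>))"
  by (intro smooth_on_cos smooth_on_mult smooth_on_const smooth_on_coord open_UNIV)

lemma partial_deriv_phase:
  "partial_deriv i (\<lambda>x. cos (\<kappa> * x $ i0 + \<theta>)) x = (if i = i0 then \<kappa> * cos (\<kappa> * x $ i0 + (\<theta> + pi / 2)) else 0)"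
proof -
  have lin: "(\<lambda>x :: real^'a. \<kappa> * x $ i0) differentiable (at x)"
    by (rule smooth_on_differentiable[of UNIV]) (auto intro!: smooth_on_mult smooth_on_const smooth_on_coord)
  have coord: "(\<lambda>x :: real^'a. x $ i0) differentiable (at x)"
    by (rule smooth_on_differentiable[of UNIV]) (auto intro!: smooth_on_coord)
  have "((\<lambda>t. cos (t + \<theta>)) has_real_derivative cos (\<kappa> * x $ i0 + (\<theta> + pi / 2))) (at (\<kappa> * x $ i0))"
    by (auto intro!: derivative_eq_intros simp: cos_add sin_add)
  from partial_deriv_comp[OF this lin] show ?thesis
    by (simp add: partial_deriv_cmult[OF coord] partial_deriv_coord mult.commute)
qed

lemma wave_test_function:
  "a \<in> test_functions \<Omega> \<Longrightarrow> wave i0 \<kappa> \<theta> a \<in> test_functions \<Omega>"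
  unfolding wave_def[abs_def] by (intro test_function_mult smooth_on_phase)

text \<open>Differentiating a cosine shifts its phase by a quarter period. Keeping the phase as a
  parameter therefore makes the waves closed under differentiation, within real-valued
  functions.\<close>

lemma partial_deriv_wave:
  assumes "\<And>x. a differentiable (at x)"
  shows "partial_deriv i (wave i0 \<kappa> \<theta> a) =
    (\<lambda>x. wave i0 \<kappa> \<theta> (partial_deriv i a) x + (if i = i0 then \<kappa> else 0) * wave i0 \<kappa> (\<theta> + pi / 2) a x)"
proof
  fix x
  have "(\<lambda>x. cos (\<kappa> * x $ i0 + \<theta>)) differentiable (at x)"
    by (rule smooth_on_differentiable[OF smooth_on_phase UNIV_I])
  from partial_deriv_mult[OF this assms]
  show "partial_deriv i (wave i0 \<kappa> \<theta> a) x =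
      wave i0 \<kappa> \<theta> (partial_deriv i a) x + (if i = i0 then \<kappa> else 0) * wave i0 \<kappa> (\<theta> + pi / 2) a x"
    by (simp add: wave_def[abs_def] partial_deriv_phase)
qed

lemma laplacian_wave:
  assumes a: "a \<in> test_functions \<Omega>"
  shows "laplacian (wave i0 \<kappa> \<theta> a) x = wave i0 \<kappa> \<theta> (laplacian a) x
    + 2 * \<kappa> * wave i0 \<kappa> (\<theta> + pi / 2) (partial_deriv i0 a) x - \<kappa>\<^sup>2 * wave i0 \<kappa> \<theta> a x"
proof -
  note tf = test_function_partial wave_test_function test_function_cmult
  note d = test_function_differentiable
  have "partial_deriv i (partial_deriv i (wave i0 \<kappa> \<theta> a)) x
      = wave i0 \<kappa> \<theta> (partial_deriv i (partial_deriv i a)) x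
        + (if i = i0 then 2 * \<kappa> * wave i0 \<kappa> (\<theta> + pi / 2) (partial_deriv i0 a) x - \<kappa>\<^sup>2 * wave i0 \<kappa> \<theta> a x else 0)"
    for i
  proof -
    let ?c = "if i = i0 then \<kappa> else 0"
    have "partial_deriv i (partial_deriv i (wave i0 \<kappa> \<theta> a)) x
        = partial_deriv i (\<lambda>x. wave i0 \<kappa> \<theta> (partial_deriv i a) x + ?c * wave i0 \<kappa> (\<theta> + pi / 2) a x) x"
      by (subst partial_deriv_wave[of a]) (auto intro: d a)
    also have "\<dots> = partial_deriv i (wave i0 \<kappa> \<theta> (partial_deriv i a)) x
        + ?c * partial_deriv i (wave i0 \<kappa> (\<theta> + pi / 2) a) x"
      using a by (simp add: partial_deriv_add[of "wave i0 \<kappa> \<theta> (partial_deriv i a)"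
            x "\<lambda>x. ?c * wave i0 \<kappa> (\<theta> + pi / 2) a x"] partial_deriv_cmult d[of _ \<Omega>] tf)
    also have "\<dots> = (wave i0 \<kappa> \<theta> (partial_deriv i (partial_deriv i a)) x
        + ?c * wave i0 \<kappa> (\<theta> + pi / 2) (partial_deriv i a) x)
        + ?c * (wave i0 \<kappa> (\<theta> + pi / 2) (partial_deriv i a) x
        + ?c * wave i0 \<kappa> (\<theta> + pi / 2 + pi / 2) a x)"
      using a by (simp add: partial_deriv_wave d[of _ \<Omega>] tf)
    \<comment> \<open>Two quarter-period shifts reverse the sign, which produces the dominant term
      with coefficient \<open>-\<kappa>^2\<close>.\<close>
    also have "wave i0 \<kappa> (\<theta> + pi / 2 + pi / 2) a x = - wave i0 \<kappa> \<theta> a x"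
      using cos_periodic_pi[of "\<kappa> * x $ i0 + \<theta>"] by (simp add: wave_def add.assoc)
    finally show ?thesis by (auto simp: power2_eq_square algebra_simps)
  qed
  hence "laplacian (wave i0 \<kappa> \<theta> a) x = (\<Sum>i\<in>UNIV. wave i0 \<kappa> \<theta> (partial_deriv i (partial_deriv i a)) x
        + (if i = i0 then 2 * \<kappa> * wave i0 \<kappa> (\<theta> + pi / 2) (partial_deriv i0 a) x - \<kappa>\<^sup>2 * wave i0 \<kappa> \<theta> a x else 0))"
    by (simp add: laplacian_def)
  also have "\<dots> = (\<Sum>i\<in>UNIV. wave i0 \<kappa> \<theta> (partial_deriv i (partial_deriv i a)) x)
      + (2 * \<kappa> * wave i0 \<kappa> (\<theta> + pi / 2) (partial_deriv i0 a) x - \<kappa>\<^sup>2 * wave i0 \<kappa> \<theta> a x)"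
    by (simp add: sum.distrib)
  also have "(\<Sum>i\<in>UNIV. wave i0 \<kappa> \<theta> (partial_deriv i (partial_deriv i a)) x) = wave i0 \<kappa> \<theta> (laplacian a) x"
    by (simp add: wave_def laplacian_def sum_distrib_left)
  finally show ?thesis by simp
qed

text \<open>In the application \<open>D js f g\<close> and \<open>m js\<close> are the differences, between the two random vectors,
  of \<open>E X\<^sub>j\<^sub>s \<langle>G f, g\<rangle>\<close> and of \<open>E X\<^sub>j\<^sub>s\<close>, where \<open>X\<^sub>j\<^sub>s\<close> is the product of the \<open>X\<^sub>j\<close>, \<open>j\<close> in the
  list \<open>js\<close>. Assumption \<open>D_resolvent\<close> is the resolvent equation.\<close>

locale moment_forms = bounded_open \<Omega> for \<Omega> :: "(real^'n::finite) set" +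
  fixes q0 :: "real^'n \<Rightarrow> real" and V :: "'d::finite \<Rightarrow> real^'n \<Rightarrow> real"
    and D :: "'d list \<Rightarrow> (real^'n \<Rightarrow> real) \<Rightarrow> (real^'n \<Rightarrow> real) \<Rightarrow> real" and m :: "'d list \<Rightarrow> real"
    and i0 :: 'n
  assumes smooth_q0: "smooth_on \<Omega> q0" and smooth_V: "\<And>j. smooth_on \<Omega> (V j)"
    and D_add: "\<And>js f f' g. f \<in> L2 \<Omega> \<Longrightarrow> f' \<in> L2 \<Omega> \<Longrightarrow> g \<in> L2 \<Omega> \<Longrightarrow>
      D js (\<lambda>x. f x + f' x) g = D js f g + D js f' g"
    and D_scale: "\<And>js c f g. f \<in> L2 \<Omega> \<Longrightarrow> g \<in> L2 \<Omega> \<Longrightarrow> D js (\<lambda>x. c * f x) g = c * D js f g"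
    and D_bound: "\<And>js. \<exists>C. \<forall>f\<in>L2 \<Omega>. \<forall>g\<in>L2 \<Omega>. \<bar>D js f g\<bar> \<le> C * L2_norm \<Omega> f * L2_norm \<Omega> g"
    and D_resolvent: "\<And>js \<phi> g. \<phi> \<in> test_functions \<Omega> \<Longrightarrow> g \<in> L2 \<Omega> \<Longrightarrow>
      D js (\<lambda>x. - laplacian \<phi> x + q0 x * \<phi> x) g + (\<Sum>j\<in>UNIV. D (j # js) (\<lambda>x. V j x * \<phi> x) g)
        = m js * L2_inner \<Omega> \<phi> g"
begin

text \<open>The amplitude at order \<open>\<kappa>^-(2r+2)\<close> of the form for a list
  \<open>js\<close> of length \<open>k - r\<close>, when all moments of order less than
  \<open>k\<close> agree. Each of the \<open>r\<close> remaining steps appends a factor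
  \<open>V j\<close>, with a sign because that term changes sides in the resolvent equation; at
  length \<open>k\<close> the moment difference is left.\<close>

fun leading :: "nat \<Rightarrow> 'd list \<Rightarrow> real^'n \<Rightarrow> real" where
  "leading 0 js x = m js"
| "leading (Suc r) js x = - (\<Sum>j\<in>UNIV. V j x * leading r (j # js) x)"

lemma smooth_leading: "smooth_on \<Omega> (leading r js)"
proof (induction r arbitrary: js)
  case (Suc r)
  have "smooth_on \<Omega> (\<lambda>x. (-1) * (\<Sum>j\<in>UNIV. V j x * leading r (j # js) x))"
    by (intro smooth_on_mult smooth_on_sum smooth_on_const smooth_V Suc open_\<Omega>)
  moreover have "leading (Suc r) js = (\<lambda>x. (-1) * (\<Sum>j\<in>UNIV. V j x * leading r (j # js) x))"
    by (simp add: fun_eq_iff)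
  ultimately show ?case by simp
qed (simp add: fun_eq_iff smooth_on_const leading.simps(1)[abs_def])

lemma wave_norm_le:
  assumes "a \<in> test_functions \<Omega>"
  shows "L2_norm \<Omega> (wave i0 \<kappa> \<theta> a) \<le> L2_norm \<Omega> a"
proof -
  have "L2_norm \<Omega> (\<lambda>x. cos (\<kappa> * x $ i0 + \<theta>) * a x) \<le> 1 * L2_norm \<Omega> a"
    by (rule L2_bounded_mult(2)[OF test_function_L2[OF assms]])
      (auto intro!: continuous_imp_measurable_on_sets_lebesgue \<Omega>_sets continuous_intros)
  thus ?thesis by (simp add: wave_def[abs_def])
qed

lemma wave_mult: "(\<lambda>x. q x * wave i0 \<kappa> \<theta> a x) = wave i0 \<kappa> \<theta> (\<lambda>x. q x * a x)"
  by (simp add: wave_def fun_eq_iff)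

text \<open>The resolvent equation for a wave, solved for its dominant term. All terms on the right
  are again waves whose amplitudes are test functions, so that the identity can be iterated.\<close>

lemma D_wave:
  assumes a: "a \<in> test_functions \<Omega>" and g: "g \<in> L2 \<Omega>"
  shows "\<kappa>\<^sup>2 * D js (wave i0 \<kappa> \<theta> a) g
    = (m js * L2_inner \<Omega> (wave i0 \<kappa> \<theta> a) g - (\<Sum>j\<in>UNIV. D (j # js) (wave i0 \<kappa> \<theta> (\<lambda>x. V j x * a x)) g))
      + 2 * \<kappa> * D js (wave i0 \<kappa> (\<theta> + pi / 2) (partial_deriv i0 a)) g
      + D js (wave i0 \<kappa> \<theta> (\<lambda>x. laplacian a x - q0 x * a x)) g"
proof -
  let ?w = "wave i0 \<kappa> \<theta> a" and ?w1 = "wave i0 \<kappa> (\<theta> + pi / 2) (partial_deriv i0 a)"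
    and ?w2 = "wave i0 \<kappa> \<theta> (\<lambda>x. laplacian a x - q0 x * a x)"
  have w: "?w \<in> test_functions \<Omega>" by (intro wave_test_function a)
  have w1: "?w1 \<in> test_functions \<Omega>" by (intro wave_test_function test_function_partial a)
  have w2: "?w2 \<in> test_functions \<Omega>"
    by (intro wave_test_function test_function_diff test_function_laplacian test_function_mult_smooth
        a open_\<Omega> smooth_q0)
  have "- laplacian ?w x + q0 x * ?w x = \<kappa>\<^sup>2 * ?w x + ((- 2 * \<kappa>) * ?w1 x + (-1) * ?w2 x)" for x
    by (subst laplacian_wave[OF a]) (simp add: wave_def algebra_simps)
  hence "D js (\<lambda>x. - laplacian ?w x + q0 x * ?w x) g = D js (\<lambda>x. \<kappa>\<^sup>2 * ?w x + ((- 2 * \<kappa>) * ?w1 x + (-1) * ?w2 x)) g"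
    by simp
  also have "\<dots> = D js (\<lambda>x. \<kappa>\<^sup>2 * ?w x) g + (D js (\<lambda>x. (- 2 * \<kappa>) * ?w1 x) g + D js (\<lambda>x. (-1) * ?w2 x) g)"
    by (subst D_add, (intro L2_add L2_scale test_function_L2 w w1 w2 g)+,
        subst D_add, (intro L2_add L2_scale test_function_L2 w w1 w2 g)+) (rule refl)
  also have "\<dots> = \<kappa>\<^sup>2 * D js ?w g + ((- 2 * \<kappa>) * D js ?w1 g + (-1) * D js ?w2 g)"
    by (simp only: D_scale test_function_L2 w w1 w2 g)
  finally show ?thesis
    using D_resolvent[OF w g, of js] by (simp add: wave_mult)
qed

section \<open>Expansion of the forms in powers of \<open>1 / \<kappa>\<close>\<close>

context
  fixes g :: "real \<Rightarrow> real^'n \<Rightarrow> real" and B :: real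
  assumes g: "\<And>\<kappa>. g \<kappa> \<in> L2 \<Omega>" "\<And>\<kappa>. L2_norm \<Omega> (g \<kappa>) \<le> B"
begin

text \<open>The second argument is allowed to vary with \<kappa> under a norm bound, because in the
  end it is a wave of the same frequency.\<close>

definition T where "T js a \<theta> \<kappa> = D js (wave i0 \<kappa> \<theta> a) (g \<kappa>)"

text \<open>The source terms of \<open>D_wave\<close>: the moment of \<open>js\<close> and the forms
  of lists longer by one. The other terms there concern the same list \<open>js\<close>, with a
  changed amplitude and one power of \<kappa> or more less than the dominant term.\<close>

definition R where "R js a \<theta> \<kappa> = m js * L2_inner \<Omega> (wave i0 \<kappa> \<theta> a) (g \<kappa>) - (\<Sum>j\<in>UNIV. T (j # js) (\<lambda>x. V j x * a x) \<theta> \<kappa>)"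

lemma test_function_V: "a \<in> test_functions \<Omega> \<Longrightarrow> (\<lambda>x. V j x * a x) \<in> test_functions \<Omega>"
  by (intro test_function_mult_smooth open_\<Omega> smooth_V)

lemma decays_inner_0:
  assumes "a \<in> test_functions \<Omega>"
  shows "decays 0 (\<lambda>\<kappa>. L2_inner \<Omega> (wave i0 \<kappa> \<theta> a) (g \<kappa>))"
proof (rule decaysI)
  fix \<kappa> :: real
  have "\<bar>L2_inner \<Omega> (wave i0 \<kappa> \<theta> a) (g \<kappa>)\<bar> \<le> L2_norm \<Omega> (wave i0 \<kappa> \<theta> a) * L2_norm \<Omega> (g \<kappa>)"
    by (intro L2_cauchy_schwarz test_function_L2 wave_test_function assms g)
  also have "\<dots> \<le> L2_norm \<Omega> a * B"
    by (intro mult_mono wave_norm_le assms g L2_norm_nonneg)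
  finally show "\<bar>L2_inner \<Omega> (wave i0 \<kappa> \<theta> a) (g \<kappa>)\<bar> \<le> L2_norm \<Omega> a * B / \<kappa> ^ 0" by simp
qed

lemma decays_T_0:
  assumes "a \<in> test_functions \<Omega>"
  shows "decays 0 (T js a \<theta>)"
proof -
  obtain C where C: "\<forall>f\<in>L2 \<Omega>. \<forall>g\<in>L2 \<Omega>. \<bar>D js f g\<bar> \<le> C * L2_norm \<Omega> f * L2_norm \<Omega> g"
    using D_bound by blast
  show ?thesis
  proof (rule decaysI)
    fix \<kappa> :: real
    have "\<bar>T js a \<theta> \<kappa>\<bar> \<le> C * L2_norm \<Omega> (wave i0 \<kappa> \<theta> a) * L2_norm \<Omega> (g \<kappa>)"
      unfolding T_def by (rule C[rule_format, OF test_function_L2[OF wave_test_function[OF assms]] g(1)])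
    also have "\<dots> \<le> \<bar>C\<bar> * L2_norm \<Omega> (wave i0 \<kappa> \<theta> a) * L2_norm \<Omega> (g \<kappa>)"
      by (intro mult_right_mono L2_norm_nonneg abs_ge_self)
    also have "\<dots> \<le> \<bar>C\<bar> * L2_norm \<Omega> a * B"
      by (intro mult_mono mult_left_mono wave_norm_le assms g L2_norm_nonneg abs_ge_zero mult_nonneg_nonneg)
    finally show "\<bar>T js a \<theta> \<kappa>\<bar> \<le> \<bar>C\<bar> * L2_norm \<Omega> a * B / \<kappa> ^ 0" by simp
  qed
qed

lemma decays_R_0: "a \<in> test_functions \<Omega> \<Longrightarrow> decays 0 (R js a \<theta>)"
  unfolding R_def by (intro decays_diff decays_cmult decays_sum decays_inner_0 decays_T_0 test_function_V)

lemma T_expansion: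
  assumes "a \<in> test_functions \<Omega>" "1 \<le> \<kappa>"
  shows "T js a \<theta> \<kappa> = R js a \<theta> \<kappa> / \<kappa> ^ 2 + (2 * (T js (partial_deriv i0 a) (\<theta> + pi / 2) \<kappa> / \<kappa> ^ 1)
    + T js (\<lambda>x. laplacian a x - q0 x * a x) \<theta> \<kappa> / \<kappa> ^ 2)"
proof -
  have "t = r / \<kappa> ^ 2 + (2 * (t1 / \<kappa> ^ 1) + t2 / \<kappa> ^ 2)" if "\<kappa>\<^sup>2 * t = r + 2 * \<kappa> * t1 + t2" for t r t1 t2
  proof -
    have "t = (\<kappa>\<^sup>2 * t) / \<kappa>\<^sup>2" using assms(2) by simp
    also have "\<dots> = r / \<kappa> ^ 2 + (2 * (t1 / \<kappa> ^ 1) + t2 / \<kappa> ^ 2)"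
      unfolding that using assms(2) by (simp add: add_divide_distrib power2_eq_square)
    finally show ?thesis .
  qed
  thus ?thesis using D_wave[OF assms(1) g(1), of \<kappa> js \<theta> \<kappa>] by (simp only: T_def R_def)
qed

text \<open>A bootstrap starting from mere boundedness. In \<open>T_expansion\<close> the terms with
  changed amplitudes are divided by at least one power of \<kappa>, so every application raises the
  known order of \<open>T\<close> by one, until \<open>R / \<kappa>^2\<close> sets the limit
  \<open>p + 2\<close>. The hypothesis covers all amplitudes and phases because the expansion
  changes both. With the full order known, the same terms are one order smaller than
  \<open>R / \<kappa>^2\<close>.\<close>

lemma
  assumes R: "\<And>a \<theta>. a \<in> test_functions \<Omega> \<Longrightarrow> decays p (R js a \<theta>)" and a: "a \<in> test_functions \<Omega>"
  shows decays_T_step: "decays (p + 2) (T js a \<theta>)"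
    and decays_T_remainder: "decays (p + 3) (\<lambda>\<kappa>. T js a \<theta> \<kappa> - R js a \<theta> \<kappa> / \<kappa> ^ 2)"
proof -
  have tf: "partial_deriv i0 a \<in> test_functions \<Omega>" "(\<lambda>x. laplacian a x - q0 x * a x) \<in> test_functions \<Omega>"
    if "a \<in> test_functions \<Omega>" for a
    by (intro test_function_partial test_function_diff test_function_laplacian
        test_function_mult_smooth open_\<Omega> smooth_q0 that)+
  have "s \<le> p + 2 \<Longrightarrow> a \<in> test_functions \<Omega> \<Longrightarrow> decays s (T js a \<theta>)" for s a \<theta>
  proof (induction s arbitrary: a \<theta>)
    case 0
    thus ?case by (intro decays_T_0)
  next
    case (Suc s)
    have "decays (Suc s) (\<lambda>\<kappa>. R js a \<theta> \<kappa> / \<kappa> ^ 2)"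
      by (rule decays_mono[OF decays_divide[OF R[OF Suc.prems(2)]] Suc.prems(1)])
    moreover have "decays (Suc s) (\<lambda>\<kappa>. T js (partial_deriv i0 a) (\<theta> + pi / 2) \<kappa> / \<kappa> ^ 1)"
      using decays_divide[OF Suc.IH[OF _ tf(1)[OF Suc.prems(2)]], of 1] Suc.prems by simp
    moreover have "decays (Suc s) (\<lambda>\<kappa>. T js (\<lambda>x. laplacian a x - q0 x * a x) \<theta> \<kappa> / \<kappa> ^ 2)"
      by (rule decays_mono[OF decays_divide[OF Suc.IH[OF _ tf(2)[OF Suc.prems(2)]]]]) (use Suc.prems in auto)
    ultimately have "decays (Suc s) (\<lambda>\<kappa>. R js a \<theta> \<kappa> / \<kappa> ^ 2 + (2 * (T js (partial_deriv i0 a) (\<theta> + pi / 2) \<kappa> / \<kappa> ^ 1)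
        + T js (\<lambda>x. laplacian a x - q0 x * a x) \<theta> \<kappa> / \<kappa> ^ 2))"
      by (intro decays_add decays_cmult)
    thus ?case by (rule decays_cong) (use T_expansion[OF Suc.prems(2)] in auto)
  qed
  note T = this[OF order_refl]
  show "decays (p + 2) (T js a \<theta>)" by (rule T[OF a])
  have "decays (p + 2 + 1) (\<lambda>\<kappa>. T js (partial_deriv i0 a) (\<theta> + pi / 2) \<kappa> / \<kappa> ^ 1)"
    by (intro decays_divide T tf a)
  hence "decays (p + 3) (\<lambda>\<kappa>. T js (partial_deriv i0 a) (\<theta> + pi / 2) \<kappa> / \<kappa> ^ 1)"
    by (simp add: numeral_3_eq_3)
  moreover have "decays (p + 3) (\<lambda>\<kappa>. T js (\<lambda>x. laplacian a x - q0 x * a x) \<theta> \<kappa> / \<kappa> ^ 2)"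
    by (rule decays_mono[OF decays_divide[OF T[OF tf(2)[OF a]]]]) simp
  ultimately have "decays (p + 3) (\<lambda>\<kappa>. 2 * (T js (partial_deriv i0 a) (\<theta> + pi / 2) \<kappa> / \<kappa> ^ 1)
        + T js (\<lambda>x. laplacian a x - q0 x * a x) \<theta> \<kappa> / \<kappa> ^ 2)"
    by (intro decays_add decays_cmult)
  thus "decays (p + 3) (\<lambda>\<kappa>. T js a \<theta> \<kappa> - R js a \<theta> \<kappa> / \<kappa> ^ 2)"
    by (rule decays_cong) (use T_expansion[OF a] in auto)
qed

lemma decays_T_2: "a \<in> test_functions \<Omega> \<Longrightarrow> decays 2 (T js a \<theta>)"
  using decays_T_step[where p = 0, OF decays_R_0] by (simp add: numeral_2_eq_2)

context
  fixes k :: nat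
  assumes m0: "\<And>js. length js < k \<Longrightarrow> m js = 0"
begin

text \<open>Here \<open>r\<close> counts how far the list is below length \<open>k\<close>. At
  length \<open>k\<close> the order 2 holds in any case; for shorter lists the moment vanishes, so
  \<open>R\<close> consists only of forms of longer lists and inherits their order, to which the
  bootstrap adds two.\<close>

lemma decays_T:
  assumes "r \<le> k" "length js = k - r" "a \<in> test_functions \<Omega>"
  shows "decays (2 * r + 2) (T js a \<theta>)"
  using assms
proof (induction r arbitrary: js a \<theta>)
  case 0
  show ?case using decays_T_2[OF 0(3)] by (simp add: numeral_2_eq_2)
next
  case (Suc r)
  have "decays (2 * r + 2) (R js a \<theta>)" if "a \<in> test_functions \<Omega>" for a \<theta>
  proof -
    have "m js = 0" using Suc.prems by (intro m0) auto
    hence "R js a \<theta> = (\<lambda>\<kappa>. - (\<Sum>j\<in>UNIV. T (j # js) (\<lambda>x. V j x * a x) \<theta> \<kappa>))"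
      by (simp add: R_def[abs_def])
    moreover have "decays (2 * r + 2) (T (j # js) (\<lambda>x. V j x * a x) \<theta>)" for j
      using Suc.prems by (intro Suc.IH test_function_V that) auto
    ultimately show ?thesis by (auto intro!: decays_minus decays_sum)
  qed
  from decays_T_step[OF this Suc.prems(3)] show ?case by simp
qed

text \<open>The induction of \<open>decays_T\<close> with the main term retained. Up to one order
  more, \<open>T\<close> may be replaced by \<open>R / \<kappa>^2\<close>. For \<open>r = 0\<close>
  the main part of \<open>R\<close> is the moment term; for larger \<open>r\<close> it is minus the
  sum of the forms of longer lists, whose leading terms are known.\<close>

lemma T_leading:
  assumes "r \<le> k" "length js = k - r" "a \<in> test_functions \<Omega>"
  shows "decays (2 * r + 3) (\<lambda>\<kappa>. T js a \<theta> \<kappa>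
    - L2_inner \<Omega> (wave i0 \<kappa> \<theta> (\<lambda>x. leading r js x * a x)) (g \<kappa>) / \<kappa> ^ (2 * r + 2))"
  using assms
proof (induction r arbitrary: js a)
  case 0
  have w: "wave i0 \<kappa> \<theta> a \<in> L2 \<Omega>" for \<kappa> by (intro test_function_L2 wave_test_function 0)
  \<comment> \<open>The forms of length \<open>k + 1\<close> are \<open>O(\<kappa>^-2)\<close> and
    carry another \<open>\<kappa>^-2\<close>, so they do not reach the leading order.\<close>
  have "decays 3 (\<lambda>\<kappa>. \<Sum>j\<in>UNIV. T (j # js) (\<lambda>x. V j x * a x) \<theta> \<kappa> / \<kappa> ^ 2)"
    by (intro decays_sum decays_mono[OF decays_divide[OF decays_T_2]] test_function_V 0) simp
  moreover have "decays 3 (\<lambda>\<kappa>. T js a \<theta> \<kappa> - R js a \<theta> \<kappa> / \<kappa> ^ 2)"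
    using decays_T_remainder[where p = 0, OF decays_R_0 0(3)] by simp
  ultimately have "decays (2 * 0 + 3) (\<lambda>\<kappa>. (T js a \<theta> \<kappa> - R js a \<theta> \<kappa> / \<kappa> ^ 2)
      - (\<Sum>j\<in>UNIV. T (j # js) (\<lambda>x. V j x * a x) \<theta> \<kappa> / \<kappa> ^ 2))"
    using decays_diff by simp
  thus ?case
    by (rule decays_cong)
      (simp add: R_def wave_mult[symmetric] L2.B_scale w g(1) power2_eq_square diff_divide_distrib sum_divide_distrib)
next
  case (Suc r)
  have m: "m js = 0" using Suc.prems by (intro m0) auto
  have len: "length (j # js) = k - r" "r \<le> k" for j using Suc.prems by auto
  have R: "decays (2 * r + 2) (R js a \<theta>)" if "a \<in> test_functions \<Omega>" for a \<theta>
  proof -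
    have "R js a \<theta> = (\<lambda>\<kappa>. - (\<Sum>j\<in>UNIV. T (j # js) (\<lambda>x. V j x * a x) \<theta> \<kappa>))"
      using m by (simp add: R_def[abs_def])
    moreover have "decays (2 * r + 2) (T (j # js) (\<lambda>x. V j x * a x) \<theta>)" for j
      by (intro decays_T len test_function_V that)
    ultimately show ?thesis by (auto intro!: decays_minus decays_sum)
  qed
  let ?L = "\<lambda>j \<kappa>. L2_inner \<Omega> (wave i0 \<kappa> \<theta> (\<lambda>x. leading r (j # js) x * (V j x * a x))) (g \<kappa>)"
  have tf: "(\<lambda>x. leading r (j # js) x * (V j x * a x)) \<in> test_functions \<Omega>" for j
    by (intro test_function_mult_smooth open_\<Omega> smooth_leading smooth_V Suc.prems)
  have sum: "decays (2 * r + 3 + 2) (\<lambda>\<kappa>. \<Sum>j\<in>UNIV. (T (j # js) (\<lambda>x. V j x * a x) \<theta> \<kappa> - ?L j \<kappa> / \<kappa> ^ (2 * r + 2)) / \<kappa> ^ 2)"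
    by (intro decays_sum decays_divide Suc.IH len test_function_V Suc.prems)
  have "decays (2 * r + 3 + 2) (\<lambda>\<kappa>. T js a \<theta> \<kappa> - R js a \<theta> \<kappa> / \<kappa> ^ 2)"
    using decays_T_remainder[OF R Suc.prems(3)] by (simp add: add.commute)
  from decays_diff[OF this sum] have "decays (2 * r + 3 + 2) (\<lambda>\<kappa>. (T js a \<theta> \<kappa> - R js a \<theta> \<kappa> / \<kappa> ^ 2)
      - (\<Sum>j\<in>UNIV. (T (j # js) (\<lambda>x. V j x * a x) \<theta> \<kappa> - ?L j \<kappa> / \<kappa> ^ (2 * r + 2)) / \<kappa> ^ 2))"
    .
  hence "decays (2 * Suc r + 3) (\<lambda>\<kappa>. (T js a \<theta> \<kappa> - R js a \<theta> \<kappa> / \<kappa> ^ 2)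
      - (\<Sum>j\<in>UNIV. (T (j # js) (\<lambda>x. V j x * a x) \<theta> \<kappa> - ?L j \<kappa> / \<kappa> ^ (2 * r + 2)) / \<kappa> ^ 2))"
    by (simp add: numeral_eq_Suc)
  thus ?case
  proof (rule decays_cong)
    fix \<kappa> :: real assume "1 \<le> \<kappa>"
    have "wave i0 \<kappa> \<theta> (\<lambda>x. leading (Suc r) js x * a x)
        = (\<lambda>x. (-1) * (\<Sum>j\<in>UNIV. wave i0 \<kappa> \<theta> (\<lambda>x. leading r (j # js) x * (V j x * a x)) x))"
      by (auto simp: wave_def fun_eq_iff sum_distrib_left sum_distrib_right sum_negf mult_ac)
    hence "L2_inner \<Omega> (wave i0 \<kappa> \<theta> (\<lambda>x. leading (Suc r) js x * a x)) (g \<kappa>)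
        = (-1) * L2_inner \<Omega> (\<lambda>x. (\<Sum>j\<in>UNIV. wave i0 \<kappa> \<theta> (\<lambda>x. leading r (j # js) x * (V j x * a x)) x)) (g \<kappa>)"
      by (simp only: L2.B_scale L2_sum test_function_L2 wave_test_function tf g(1))
    also have "\<dots> = - (\<Sum>j\<in>UNIV. ?L j \<kappa>)"
      by (subst L2_inner_sum) (simp_all add: test_function_L2 wave_test_function tf g(1))
    finally show "T js a \<theta> \<kappa> - R js a \<theta> \<kappa> / \<kappa> ^ 2
        - (\<Sum>j\<in>UNIV. (T (j # js) (\<lambda>x. V j x * a x) \<theta> \<kappa> - ?L j \<kappa> / \<kappa> ^ (2 * r + 2)) / \<kappa> ^ 2)
      = T js a \<theta> \<kappa> - L2_inner \<Omega> (wave i0 \<kappa> \<theta> (\<lambda>x. leading (Suc r) js x * a x)) (g \<kappa>) / \<kappa> ^ (2 * Suc r + 2)"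
      by (simp add: R_def m diff_divide_distrib sum_divide_distrib sum_subtractf power_add[of _ "2 * r + 2" 2, simplified] sum_negf)
  qed
qed

lemmas D_leading = T_leading[unfolded T_def]

end

end

text \<open>For the empty list and \<open>r = k\<close> the form vanishes, so the expansion says
  that the inner product of its leading wave with the second argument is
  \<open>O(1 / \<kappa>)\<close>. Here \<open>a\<close> is a bump around \<open>x\<close>, and the
  second argument is that leading wave itself, with amplitude \<open>b\<close>; thus a squared norm
  is forced to vanish.\<close>

lemma leading_eq_0:
  assumes D0: "\<And>f g. f \<in> L2 \<Omega> \<Longrightarrow> g \<in> L2 \<Omega> \<Longrightarrow> D [] f g = 0"
    and m0: "\<And>js. length js < k \<Longrightarrow> m js = 0" and x: "x \<in> \<Omega>"
  shows "leading k [] x = 0"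
proof -
  obtain r where r: "0 < r" "cball x r \<subseteq> \<Omega>" using open_\<Omega> x open_contains_cball by blast
  obtain a where a: "smooth_on UNIV a" "\<And>y. 0 \<le> a y" "\<And>y. a y \<noteq> 0 \<longleftrightarrow> y \<in> ball x r"
    using bump_exists[OF r(1), of x] by blast
  have "{y. a y \<noteq> 0} = ball x r" by (simp only: a(3) Collect_mem_eq)
  hence "closure {y. a y \<noteq> 0} = cball x r" using r by simp
  hence a_test: "a \<in> test_functions \<Omega>"
    using a(1) r by (simp only: test_functions_def mem_Collect_eq compact_cball simp_thms)
  define b where "b y = leading k [] y * a y" for y
  have b: "b \<in> test_functions \<Omega>"
    unfolding b_def by (intro test_function_mult_smooth open_\<Omega> smooth_leading a_test)
  have dec: "decays 1 (\<lambda>\<kappa>. L2_inner \<Omega> (wave i0 \<kappa> \<theta> b) (wave i0 \<kappa> \<theta> b))" for \<theta>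
  proof -
    have "decays (2 * k + 3) (\<lambda>\<kappa>. D [] (wave i0 \<kappa> \<theta> a) (wave i0 \<kappa> \<theta> b)
      - L2_inner \<Omega> (wave i0 \<kappa> \<theta> (\<lambda>x. leading k [] x * a x)) (wave i0 \<kappa> \<theta> b) / \<kappa> ^ (2 * k + 2))"
      using D_leading[of "\<lambda>\<kappa>. wave i0 \<kappa> \<theta> b" "L2_norm \<Omega> b" k k "[]" a \<theta>] m0 a_test
      by (simp add: wave_norm_le b test_function_L2 wave_test_function)
    hence "decays (2 * k + 3) (\<lambda>\<kappa>. - (L2_inner \<Omega> (wave i0 \<kappa> \<theta> b) (wave i0 \<kappa> \<theta> b) / \<kappa> ^ (2 * k + 2)))"
      by (simp add: D0 test_function_L2 wave_test_function a_test b b_def[symmetric])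
    hence "decays (2 * k + 3) (\<lambda>\<kappa>. L2_inner \<Omega> (wave i0 \<kappa> \<theta> b) (wave i0 \<kappa> \<theta> b) / \<kappa> ^ (2 * k + 2))"
      using decays_minus by fastforce
    then obtain C where C: "\<And>\<kappa>. 1 \<le> \<kappa> \<Longrightarrow>
        \<bar>L2_inner \<Omega> (wave i0 \<kappa> \<theta> b) (wave i0 \<kappa> \<theta> b) / \<kappa> ^ (2 * k + 2)\<bar> \<le> C / \<kappa> ^ (2 * k + 3)"
      unfolding decays_def by blast
    show ?thesis
    proof (rule decaysI)
      fix \<kappa> :: real assume "1 \<le> \<kappa>"
      have "\<kappa> ^ (2 * k + 3) = \<kappa> ^ (2 * k + 2) * \<kappa>" by (simp add: numeral_eq_Suc)
      with C[OF \<open>1 \<le> \<kappa>\<close>] \<open>1 \<le> \<kappa>\<close>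
      show "\<bar>L2_inner \<Omega> (wave i0 \<kappa> \<theta> b) (wave i0 \<kappa> \<theta> b)\<bar> \<le> C / \<kappa> ^ 1"
        by (simp add: abs_divide divide_le_eq field_simps)
    qed
  qed
  \<comment> \<open>Adding the two phases makes the leading term independent of \<open>\<kappa>\<close>, which avoids the
    Riemann-Lebesgue lemma.\<close>
  have "L2_inner \<Omega> (wave i0 \<kappa> 0 b) (wave i0 \<kappa> 0 b) + L2_inner \<Omega> (wave i0 \<kappa> (pi / 2) b) (wave i0 \<kappa> (pi / 2) b)
      = L2_inner \<Omega> b b" for \<kappa>
  proof -
    have "wave i0 \<kappa> 0 b y * wave i0 \<kappa> 0 b y + wave i0 \<kappa> (pi / 2) b y * wave i0 \<kappa> (pi / 2) b y = b y * b y" for y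
    proof -
      have "(c * z) * (c * z) + (- s * z) * (- s * z) = (c\<^sup>2 + s\<^sup>2) * (z * z)" for c s z :: real
        by (simp add: power2_eq_square algebra_simps)
      moreover have "wave i0 \<kappa> 0 b y = cos (\<kappa> * y $ i0) * b y"
        "wave i0 \<kappa> (pi / 2) b y = - sin (\<kappa> * y $ i0) * b y"
        by (simp_all add: wave_def cos_add)
      ultimately show ?thesis by (simp only: sin_cos_squared_add2 mult_1_left)
    qed
    thus ?thesis
      by (simp add: L2_inner_def L2_mult_integrable test_function_L2 wave_test_function b
          flip: Bochner_Integration.integral_add)
  qed
  hence "decays 1 (\<lambda>\<kappa>. L2_inner \<Omega> b b)" using decays_add[OF dec[of 0] dec[of "pi / 2"]] by simp
  hence "L2_inner \<Omega> b b = 0" by (rule decays_const_eq_0)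
  hence int: "(\<integral>y. (b y)\<^sup>2 \<partial>lborel) = 0"
    using integral_\<Omega>[of "\<lambda>y. (b y)\<^sup>2"] test_function_measurable[OF b] test_function_outside[OF b]
    by (simp add: L2_inner_def power2_eq_square)
  have "integrable lborel (\<lambda>y. (b y)\<^sup>2)"
  proof -
    have "integrable (lebesgue_on \<Omega>) (\<lambda>y. (b y)\<^sup>2)" using test_function_L2[OF b] by (simp add: L2_def)
    hence "integrable lebesgue (\<lambda>y. indicator \<Omega> y *\<^sub>R (b y)\<^sup>2)"
      using \<Omega>_sets by (simp add: integrable_restrict_space)
    moreover have "(\<lambda>y. indicator \<Omega> y *\<^sub>R (b y)\<^sup>2) = (\<lambda>y. (b y)\<^sup>2)"
      by (rule ext) (use test_function_outside[OF b] in \<open>auto simp: indicator_def\<close>)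
    ultimately show ?thesis
      using test_function_measurable[OF b] by (simp add: integrable_completion)
  qed
  hence ae: "AE y in lborel. b y = 0"
    using int integral_nonneg_eq_0_iff_AE[of lborel "\<lambda>y. (b y)\<^sup>2"] by simp
  \<comment> \<open>So far \<open>b\<close> vanishes almost everywhere; being continuous, it is
    nonzero on an open set, and an open null set is empty.\<close>
  have "open {y. b y \<noteq> 0}"
    using test_function_continuous[OF b] by (intro open_Collect_neq continuous_on_const)
  moreover have "{y. b y \<noteq> 0} \<in> null_sets lborel"
    using ae AE_iff_null_sets[of "{y. b y \<noteq> 0}" lborel] calculation by simp
  ultimately have "{y. b y \<noteq> 0} = {}"
    using open_not_negligible negligible_iff_null_sets null_sets_completionI by metis
  hence "b x = 0" by auto
  moreover have "a x \<noteq> 0" using a(3) r by simp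
  ultimately show ?thesis by (simp add: b_def)
qed

end

subsection \<open>Moments and compactly supported laws\<close>

text \<open>Monomials indexed by lists fit the resolvent equation, which brings in one coordinate at
  a time as a new head. The passage to multi-indices takes place only when linear independence is
  applied.\<close>

definition list_monomial :: "('d \<Rightarrow> real) \<Rightarrow> 'd list \<Rightarrow> real" where
  "list_monomial a js = prod_list (map a js)"

lemma list_monomial_simps [simp]:
  "list_monomial a [] = 1" "list_monomial a (j # js) = a j * list_monomial a js"
  by (simp_all add: list_monomial_def)

lemma continuous_on_list_monomial [continuous_intros]:
  "continuous_on S (\<lambda>c :: real^'d. list_monomial (\<lambda>j. c $ j) js)"
  by (induction js) (auto intro!: continuous_intros)

lemma list_monomial_eq_monomial:
  fixes a :: "'d::finite \<Rightarrow> real"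
  shows "list_monomial a js = monomial a (count_list js)"
proof (induction js)
  case Nil
  show ?case by (simp add: monomial_def)
next
  case (Cons j js)
  have "monomial a (count_list (j # js)) = (\<Prod>i\<in>UNIV. (if i = j then a i else 1) * a i ^ count_list js i)"
    unfolding monomial_def by (intro prod.cong) auto
  also have "\<dots> = a j * monomial a (count_list js)"
    by (simp add: prod.distrib monomial_def)
  finally show ?case using Cons by (simp only: list_monomial_simps)
qed

lemma sum_count_list: "(\<Sum>i\<in>UNIV. count_list js (i :: 'd::finite)) = length js"
proof (induction js)
  case (Cons j js)
  have "(\<Sum>i\<in>UNIV. count_list (j # js) i) = (\<Sum>i\<in>UNIV. (if i = j then 1 else 0) + count_list js i)"
    by (intro sum.cong) auto
  thus ?case using Cons by (simp add: sum.distrib)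
qed simp

lemma ex_list_with_counts: "\<exists>js. count_list js = (\<alpha> :: 'd::finite \<Rightarrow> nat)"
proof -
  obtain js where js: "mset js = Abs_multiset \<alpha>" using ex_mset by blast
  have "count (Abs_multiset \<alpha>) = \<alpha>" by (simp add: count_Abs_multiset)
  hence "count_list js = \<alpha>" using js by (simp add: fun_eq_iff count_mset[symmetric])
  thus ?thesis ..
qed

lemma finite_lists_length: "finite {js :: 'd::finite list. length js = k}"
  using finite_lists_length_eq[of "UNIV :: 'd set" k] by simp

text \<open>The number of lists with given multiplicities is a multinomial coefficient; only its
  positivity matters.\<close>

lemma sum_lists_eq_sum_multi_indices:
  fixes F :: "('d::finite \<Rightarrow> nat) \<Rightarrow> real"
  shows "(\<Sum>js | length js = k. F (count_list js)) =
    (\<Sum>\<alpha>\<in>multi_indices k. real (card {js. length js = k \<and> count_list js = \<alpha>}) * F \<alpha>)"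
proof -
  have "(\<Sum>js | length js = k. F (count_list js)) =
      (\<Sum>\<alpha>\<in>multi_indices k. \<Sum>js\<in>{js \<in> {js. length js = k}. count_list js = \<alpha>}. F (count_list js))"
    by (rule sum.group[OF finite_lists_length finite_multi_indices, symmetric])
      (auto simp: multi_indices_def sum_count_list)
  also have "\<dots> = (\<Sum>\<alpha>\<in>multi_indices k. real (card {js. length js = k \<and> count_list js = \<alpha>}) * F \<alpha>)"
    by (intro sum.cong) auto
  finally show ?thesis .
qed

lemma card_lists_with_counts_pos:
  fixes \<alpha> :: "'d::finite \<Rightarrow> nat"
  assumes "\<alpha> \<in> multi_indices k"
  shows "0 < card {js. length js = k \<and> count_list js = \<alpha>}"
proof -
  obtain js where js: "count_list js = \<alpha>" using ex_list_with_counts by blast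
  hence "length js = k" using assms sum_count_list[of js] by (simp add: multi_indices_def)
  hence "js \<in> {js. length js = k \<and> count_list js = \<alpha>}" using js by simp
  moreover have "finite {js. length js = k \<and> count_list js = \<alpha>}"
    by (rule finite_subset[OF _ finite_lists_length[of k]]) auto
  ultimately show ?thesis by (auto simp: card_gt_0_iff)
qed

section \<open>Laws with compact support\<close>

lemma integrable_continuous_compact_support:
  fixes \<mu> :: "'b::topological_space measure" and f :: "'b \<Rightarrow> real"
  assumes "finite_measure \<mu>" "sets \<mu> = sets borel" "compact K" "AE c in \<mu>. c \<in> K" "continuous_on UNIV f"
  shows "integrable \<mu> f"
proof -
  have "bounded (f ` K)"
    using assms by (intro compact_imp_bounded compact_continuous_image) (auto intro: continuous_on_subset)
  then obtain B where B: "\<forall>c\<in>K. \<bar>f c\<bar> \<le> B" by (auto simp: bounded_iff)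
  show ?thesis
  proof (rule finite_measure.integrable_const_bound[OF assms(1)])
    show "AE c in \<mu>. norm (f c) \<le> B" using assms(4) by eventually_elim (use B in auto)
    show "f \<in> borel_measurable \<mu>"
      using borel_measurable_continuous_onI[OF assms(5)] measurable_cong_sets[OF assms(2) refl] by blast
  qed
qed

lemma compact_support_moments_imp_polynomials:
  fixes \<mu> \<nu> :: "(real^'d::finite) measure"
  assumes \<mu>: "finite_measure \<mu>" "sets \<mu> = sets borel" "AE c in \<mu>. c \<in> K"
    and \<nu>: "finite_measure \<nu>" "sets \<nu> = sets borel" "AE c in \<nu>. c \<in> K" and K: "compact K"
    and moments: "\<And>js. (\<integral>c. list_monomial (\<lambda>j. c $ j) js \<partial>\<mu>) = (\<integral>c. list_monomial (\<lambda>j. c $ j) js \<partial>\<nu>)"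
    and p: "real_polynomial_function p"
  shows "(\<integral>c. p c \<partial>\<mu>) = (\<integral>c. p c \<partial>\<nu>)"
proof -
  \<comment> \<open>Equality of integrals alone is not preserved under products. Demanding it
    against every monomial gives a set that is stable under multiplication by coordinates, and the
    induction over polynomial functions shows that multiplication by \<open>p\<close> maps
    \<open>W\<close> into itself.\<close>
  define W where "W = {f :: real^'d \<Rightarrow> real. continuous_on UNIV f \<and>
    (\<forall>js. (\<integral>c. f c * list_monomial (\<lambda>j. c $ j) js \<partial>\<mu>) = (\<integral>c. f c * list_monomial (\<lambda>j. c $ j) js \<partial>\<nu>))}"
  have int: "integrable \<mu> (\<lambda>c. f c * list_monomial (\<lambda>j. c $ j) js)"
    "integrable \<nu> (\<lambda>c. f c * list_monomial (\<lambda>j. c $ j) js)" if "continuous_on UNIV f" for f js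
    by (rule integrable_continuous_compact_support[OF \<mu>(1,2) K \<mu>(3)],
        intro continuous_intros that,
        rule integrable_continuous_compact_support[OF \<nu>(1,2) K \<nu>(3)],
        intro continuous_intros that)
  have W_add: "(\<lambda>c. f c + g c) \<in> W" if "f \<in> W" "g \<in> W" for f g
    using that by (auto simp: W_def distrib_right int intro!: continuous_intros)
  have W_scale: "(\<lambda>c. x * f c) \<in> W" if "f \<in> W" for f x
    using that by (auto simp: W_def mult.assoc intro!: continuous_intros)
  have W_coord: "(\<lambda>c. c $ j * f c) \<in> W" if "f \<in> W" for f j
  proof -
    have "(\<integral>c. c $ j * f c * list_monomial (\<lambda>j. c $ j) js \<partial>\<mu>)
        = (\<integral>c. c $ j * f c * list_monomial (\<lambda>j. c $ j) js \<partial>\<nu>)" for js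
      using that[unfolded W_def, simplified, THEN conjunct2, rule_format, of "j # js"]
      by (simp add: mult_ac)
    thus ?thesis using that by (auto simp: W_def intro!: continuous_intros)
  qed
  have W_sum: "finite I \<Longrightarrow> (\<And>i. i \<in> I \<Longrightarrow> f i \<in> W) \<Longrightarrow> (\<lambda>c. \<Sum>i\<in>I. f i c) \<in> W"
    for I :: "'d set" and f
  proof (induction I rule: finite_induct)
    case empty
    show ?case by (simp add: W_def)
  next
    case (insert i I)
    thus ?case using W_add[of "f i" "\<lambda>c. \<Sum>i\<in>I. f i c"] by simp
  qed
  have "\<forall>f\<in>W. (\<lambda>c. p c * f c) \<in> W"
    using p
  proof (induction p rule: real_polynomial_function.induct)
    case (linear l)
    \<comment> \<open>A generator of the polynomial functions is an arbitrary bounded linear map; it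
      is reduced to coordinates.\<close>
    have lin: "l c = (\<Sum>j\<in>UNIV. l (axis j 1) * c $ j)" for c
    proof -
      have "l c = l (\<Sum>j\<in>UNIV. c $ j *\<^sub>R axis j 1)"
        using basis_expansion[of c] by (simp add: scalar_mult_eq_scaleR)
      also have "\<dots> = (\<Sum>j\<in>UNIV. l (axis j 1) * c $ j)"
        using bounded_linear.linear[OF linear] by (simp add: linear_sum linear_scale mult.commute)
      finally show ?thesis .
    qed
    have eq: "(\<lambda>c. l c * f c) = (\<lambda>c. \<Sum>j\<in>UNIV. l (axis j 1) * (c $ j * f c))" for f
      by (rule ext, subst lin) (simp only: sum_distrib_right mult.assoc)
    show ?case unfolding eq by (intro ballI W_sum W_scale W_coord) auto
  next
    case (mult f g)
    thus ?case by (auto simp: mult.assoc)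
  qed (auto simp: distrib_right intro: W_scale W_add)
  moreover have "(\<lambda>c. 1) \<in> W" by (simp add: W_def moments)
  ultimately have "(\<lambda>c. p c * 1) \<in> W" by (rule bspec)
  hence "(\<integral>c. p c * 1 * list_monomial (\<lambda>j. c $ j) [] \<partial>\<mu>) = (\<integral>c. p c * 1 * list_monomial (\<lambda>j. c $ j) [] \<partial>\<nu>)"
    unfolding W_def by blast
  thus ?thesis by simp
qed

text \<open>The indicator of a closed set is the limit of continuous functions that decrease
  linearly in the distance to the set, with slope \<open>n\<close>. Closed sets are stable under
  intersection and generate the Borel sets.\<close>

lemma measure_eqI_continuous_integrals:
  fixes \<mu> \<nu> :: "'b::metric_space measure"
  assumes \<mu>: "finite_measure \<mu>" "sets \<mu> = sets borel" and \<nu>: "finite_measure \<nu>" "sets \<nu> = sets borel"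
    and eq: "\<And>f :: 'b \<Rightarrow> real. continuous_on UNIV f \<Longrightarrow> (\<And>c. \<bar>f c\<bar> \<le> 1) \<Longrightarrow> (\<integral>c. f c \<partial>\<mu>) = (\<integral>c. f c \<partial>\<nu>)"
  shows "\<mu> = \<nu>"
proof -
  have closed_eq: "emeasure \<mu> A = emeasure \<nu> A" if A: "closed A" for A
  \<comment> \<open>By convention \<open>infdist c {} = 0\<close>, so for the empty set the
    approximating functions would be constantly 1.\<close>
  proof (cases "A = {}")
    case False
    define f where "f n c = max 0 (1 - real n * infdist c A)" for n and c :: 'b
    have cont: "continuous_on UNIV (f n)" for n
      unfolding f_def by (intro continuous_intros)
    have bnd: "\<bar>f n c\<bar> \<le> 1" for n c
      by (simp add: f_def infdist_nonneg)
    have conv: "(\<lambda>n. f n c) \<longlonglongrightarrow> indicator A c" for c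
    proof (cases "c \<in> A")
      case True
      thus ?thesis by (simp add: f_def)
    next
      case c: False
      hence pos: "0 < infdist c A" using A False infdist_pos_not_in_closed by blast
      obtain N :: nat where N: "1 / infdist c A < N" using reals_Archimedean2 by blast
      have "f n c = 0" if "N \<le> n" for n
      proof -
        have "1 / infdist c A < real n" using N that by linarith
        hence "1 < real n * infdist c A" using pos by (simp add: field_simps)
        thus ?thesis by (simp add: f_def)
      qed
      hence "eventually (\<lambda>n. f n c = indicator A c) sequentially"
        using c by (auto simp: eventually_sequentially intro!: exI[of _ N])
      thus ?thesis by (rule tendsto_eventually)
    qed
    have lim: "(\<lambda>n. \<integral>c. f n c \<partial>M) \<longlonglongrightarrow> measure M A" if M: "finite_measure M" "sets M = sets borel" for M
    proof -
      have meas: "g \<in> borel_measurable M" if "g \<in> borel_measurable borel" for g :: "'b \<Rightarrow> real"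
        using that measurable_cong_sets[OF M(2) refl] by blast
      have "(\<lambda>n. \<integral>c. f n c \<partial>M) \<longlonglongrightarrow> (\<integral>c. indicator A c \<partial>M)"
      proof (rule integral_dominated_convergence)
        show "integrable M (\<lambda>c. 1 :: real)" using M by (simp add: finite_measure.integrable_const)
        show "f n \<in> borel_measurable M" for n
          by (intro meas borel_measurable_continuous_onI cont)
        show "(indicator A :: 'b \<Rightarrow> real) \<in> borel_measurable M"
          using A by (intro meas) (simp add: borel_closed)
      qed (use conv bnd in auto)
      moreover have "A \<in> sets M" using A M by (simp add: borel_closed)
      ultimately show ?thesis by simp
    qed
    have "(\<integral>c. f n c \<partial>\<mu>) = (\<integral>c. f n c \<partial>\<nu>)" for n by (intro eq cont bnd)
    hence "measure \<mu> A = measure \<nu> A" using lim[OF \<mu>] lim[OF \<nu>] by (simp add: LIMSEQ_unique)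
    thus ?thesis using \<mu>(1) \<nu>(1) by (simp add: finite_measure.emeasure_eq_measure)
  qed simp
  show ?thesis
  proof (rule measure_eqI_generator_eq)
    show "Int_stable (Collect closed :: 'b set set)" by (auto simp: Int_stable_def)
    show "sets \<mu> = sigma_sets UNIV (Collect closed)" "sets \<nu> = sigma_sets UNIV (Collect closed)"
      using \<mu> \<nu> by (simp_all add: borel_eq_closed)
    show "range (\<lambda>_ :: nat. UNIV :: 'b set) \<subseteq> Collect closed" by auto
    show "emeasure \<mu> UNIV \<noteq> \<infinity>"
      using finite_measure.emeasure_finite[OF \<mu>(1)] by auto
  qed (auto intro: closed_eq)
qed

lemma compact_support_moments_determine:
  fixes \<mu> \<nu> :: "(real^'d::finite) measure"
  assumes \<mu>: "prob_space \<mu>" "sets \<mu> = sets borel" "AE c in \<mu>. c \<in> K"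
    and \<nu>: "prob_space \<nu>" "sets \<nu> = sets borel" "AE c in \<nu>. c \<in> K" and K: "compact K"
    and moments: "\<And>js. (\<integral>c. list_monomial (\<lambda>j. c $ j) js \<partial>\<mu>) = (\<integral>c. list_monomial (\<lambda>j. c $ j) js \<partial>\<nu>)"
  shows "\<mu> = \<nu>"
proof (rule measure_eqI_continuous_integrals)
  show fin: "finite_measure \<mu>" "finite_measure \<nu>"
    using \<mu> \<nu> by (simp_all add: prob_space.finite_measure)
  show "sets \<mu> = sets borel" "sets \<nu> = sets borel" by fact+
  fix f :: "real^'d \<Rightarrow> real" assume f: "continuous_on UNIV f"
  have close: "\<bar>(\<integral>c. f c \<partial>M) - (\<integral>c. p c \<partial>M)\<bar> \<le> e"
    if M: "prob_space M" "sets M = sets borel" "AE c in M. c \<in> K"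
      and p: "real_polynomial_function p" "\<And>c. c \<in> K \<Longrightarrow> \<bar>f c - p c\<bar> < e" for M p e
  proof -
    interpret prob_space M by (rule M(1))
    have p': "continuous_on UNIV p"
      using p(1) continuous_real_polymonial_function by (auto intro: continuous_at_imp_continuous_on)
    note int = integrable_continuous_compact_support[OF finite_measure_axioms M(2) K M(3)]
    have "(\<integral>c. f c \<partial>M) - (\<integral>c. p c \<partial>M) = (\<integral>c. f c - p c \<partial>M)" using int f p' by simp
    moreover have "\<bar>\<integral>c. f c - p c \<partial>M\<bar> \<le> (\<integral>c. \<bar>f c - p c\<bar> \<partial>M)" by (rule integral_abs_bound)
    moreover have "(\<integral>c. \<bar>f c - p c\<bar> \<partial>M) \<le> (\<integral>c. e \<partial>M)"
      by (rule integral_mono_AE)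
        (use int f p' M(3) p(2) in \<open>auto intro!: continuous_intros intro: less_imp_le elim!: AE_mp\<close>)
    moreover have "(\<integral>c. e \<partial>M) = e" by (simp add: prob_space)
    ultimately show ?thesis by linarith
  qed
  have "\<bar>(\<integral>c. f c \<partial>\<mu>) - (\<integral>c. f c \<partial>\<nu>)\<bar> \<le> 2 * e" if e: "0 < e" for e
  proof -
    obtain p where p: "real_polynomial_function p" "\<And>c. c \<in> K \<Longrightarrow> \<bar>f c - p c\<bar> < e"
      using Stone_Weierstrass_real_polynomial_function[OF K continuous_on_subset[OF f subset_UNIV] e] by blast
    have "(\<integral>c. p c \<partial>\<mu>) = (\<integral>c. p c \<partial>\<nu>)"
      by (rule compact_support_moments_imp_polynomials[OF fin(1) \<mu>(2,3) fin(2) \<nu>(2,3) K moments p(1)])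
    thus ?thesis using close[OF \<mu> p] close[OF \<nu> p] by linarith
  qed
  hence "\<bar>(\<integral>c. f c \<partial>\<mu>) - (\<integral>c. f c \<partial>\<nu>)\<bar> \<le> 0"
    using field_le_epsilon[of "\<bar>(\<integral>c. f c \<partial>\<mu>) - (\<integral>c. f c \<partial>\<nu>)\<bar>" 0] by (metis add_0 half_gt_zero mult_2 field_sum_of_halves mult.commute)
  thus "(\<integral>c. f c \<partial>\<mu>) = (\<integral>c. f c \<partial>\<nu>)" by simp
qed

section \<open>From the leading term to the moments\<close>

context moment_forms
begin

text \<open>The recursion puts each new index in front of \<open>js\<close>, hence the reversed list
  inside \<open>m\<close>. The order becomes irrelevant as soon as \<open>m\<close> depends only on
  the multiplicities.\<close>

lemma leading_eq_sum:
  "leading r js x = (-1) ^ r * (\<Sum>is | length is = r. list_monomial (\<lambda>j. V j x) is * m (rev is @ js))"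
proof (induction r arbitrary: js)
  case 0
  show ?case by simp
next
  case (Suc r)
  have set: "{is :: 'd list. length is = Suc r} = (\<lambda>(j, is). j # is) ` (UNIV \<times> {is. length is = r})"
    by (auto simp: length_Suc_conv image_iff)
  have inj: "inj_on (\<lambda>(j, is). j # is) (UNIV \<times> {is :: 'd list. length is = r})"
    by (auto simp: inj_on_def)
  have "(\<Sum>is | length is = Suc r. list_monomial (\<lambda>j. V j x) is * m (rev is @ js))
      = (\<Sum>(j, is)\<in>UNIV \<times> {is. length is = r}. V j x * (list_monomial (\<lambda>j. V j x) is * m (rev is @ j # js)))"
    unfolding set sum.reindex[OF inj] by (intro sum.cong) (auto simp: mult.assoc)
  also have "\<dots> = (\<Sum>j\<in>UNIV. V j x * (\<Sum>is | length is = r. list_monomial (\<lambda>j. V j x) is * m (rev is @ j # js)))"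
    by (subst sum.cartesian_product[symmetric]) (simp add: sum_distrib_left)
  finally show ?case by (simp add: Suc sum_distrib_left sum_negf mult_ac)
qed

text \<open>By induction on the degree: once all moments of lower order agree, the leading term of the
  expansion is a linear relation between the \<open>V\<^sup>\<alpha>\<close> whose coefficients are positive multiples of
  the moment differences.\<close>

lemma moments_eq_0:
  assumes D0: "\<And>f g. f \<in> L2 \<Omega> \<Longrightarrow> g \<in> L2 \<Omega> \<Longrightarrow> D [] f g = 0"
    and m: "\<And>js. m js = mm (count_list js)" and m_Nil: "m [] = 0"
    and U: "U \<subseteq> \<Omega>"
    and indep: "\<And>k. 1 \<le> k \<Longrightarrow> lin_indep_on U (multi_indices k) (\<lambda>\<alpha> x. monomial (\<lambda>j. V j x) \<alpha>)"
  shows "m js = 0"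
proof (induction "length js" arbitrary: js rule: less_induct)
  case less
  let ?k = "length js"
  show ?case
  proof (cases "?k = 0")
    case True
    thus ?thesis using m_Nil by simp
  next
    case False
    let ?N = "\<lambda>\<alpha>. real (card {is :: 'd list. length is = ?k \<and> count_list is = \<alpha>})"
    have rel: "(\<Sum>\<alpha>\<in>multi_indices ?k. (?N \<alpha> * mm \<alpha>) * monomial (\<lambda>j. V j x) \<alpha>) = 0" if "x \<in> U" for x
    proof -
      have "leading ?k [] x = 0" using that U by (intro leading_eq_0 D0 less) auto
      hence "(\<Sum>is | length is = ?k. list_monomial (\<lambda>j. V j x) is * m (rev is @ [])) = 0"
        by (simp add: leading_eq_sum)
      moreover have "count_list (rev is) = count_list is" for "is" :: "'d list"
        by (simp add: fun_eq_iff)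
      ultimately have "(\<Sum>is | length is = ?k. monomial (\<lambda>j. V j x) (count_list is) * mm (count_list is)) = 0"
        by (simp add: m list_monomial_eq_monomial)
      thus ?thesis
        unfolding sum_lists_eq_sum_multi_indices[of "\<lambda>\<alpha>. monomial (\<lambda>j. V j x) \<alpha> * mm \<alpha>"]
        by (simp add: mult_ac)
    qed
    have "1 \<le> ?k" using False by (cases js) auto
    hence "?N \<alpha> * mm \<alpha> = 0" if "\<alpha> \<in> multi_indices ?k" for \<alpha>
      using indep[of ?k, unfolded lin_indep_on_def, THEN spec, of "\<lambda>\<alpha>. ?N \<alpha> * mm \<alpha>"] rel that by blast
    moreover have "count_list js \<in> multi_indices ?k" by (simp add: multi_indices_def sum_count_list)
    ultimately have "?N (count_list js) * mm (count_list js) = 0" "0 < ?N (count_list js)"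
      using card_lists_with_counts_pos[of "count_list js" ?k] by (blast, simp only: of_nat_0_less_iff)
    thus ?thesis unfolding m[of js] by (simp only: mult_eq_0_iff) simp
  qed
qed

end

subsection \<open>Random potentials\<close>

text \<open>Where the potential takes negative values the choice in \<open>green\<close> is
  arbitrary and need not be measurable. That event is null, and on the completion such values cannot
  spoil measurability.\<close>

lemma borel_measurable_completion_cong_AE:
  fixes f g :: "'a \<Rightarrow> real"
  assumes f: "f \<in> borel_measurable (completion M)" and ae: "AE x in M. f x = g x"
  shows "g \<in> borel_measurable (completion M)"
proof (rule measurableI)
  fix S :: "real set" assume S: "S \<in> sets borel"
  show "g -` S \<inter> space (completion M) \<in> sets (completion M)"
  proof (rule completion.in_sets_AE)
    show "f -` S \<inter> space (completion M) \<in> sets (completion M)" using f S by (rule measurable_sets)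
    show "AE x in completion M. x \<in> f -` S \<inter> space (completion M) \<longleftrightarrow> x \<in> g -` S \<inter> space (completion M)"
      using AE_completion[OF ae] by eventually_elim auto
  qed auto
qed auto

locale affine_potentials = bounded_open \<Omega> for \<Omega> :: "(real^'n::finite) set" +
  fixes q0 :: "real^'n \<Rightarrow> real" and V :: "'d::finite \<Rightarrow> real^'n \<Rightarrow> real"
  assumes continuous_q0: "continuous_on (closure \<Omega>) q0"
    and continuous_V: "\<And>j. continuous_on (closure \<Omega>) (V j)"
begin

lemma compact_closure_\<Omega>: "compact (closure \<Omega>)"
  using bounded_\<Omega> by (simp add: compact_closure)

lemma continuous_closure_bounded:
  fixes f :: "real^'n \<Rightarrow> real"
  assumes "continuous_on (closure \<Omega>) f"
  shows "\<exists>B. \<forall>x\<in>closure \<Omega>. \<bar>f x\<bar> \<le> B"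
  using compact_imp_bounded[OF compact_continuous_image[OF assms compact_closure_\<Omega>]]
  by (auto simp: bounded_iff)

lemma continuous_closure_measurable:
  "continuous_on (closure \<Omega>) f \<Longrightarrow> f \<in> borel_measurable (lebesgue_on \<Omega>)"
  by (rule continuous_imp_measurable_on_sets_lebesgue[OF continuous_on_subset[OF _ closure_subset] \<Omega>_sets])

lemma continuous_closure_mult_L2:
  assumes "continuous_on (closure \<Omega>) q" "f \<in> L2 \<Omega>"
  shows "(\<lambda>x. q x * f x) \<in> L2 \<Omega>"
proof -
  obtain B where B: "\<forall>x\<in>closure \<Omega>. \<bar>q x\<bar> \<le> B" using continuous_closure_bounded[OF assms(1)] by blast
  show ?thesis
    by (rule L2_bounded_mult(1)[OF assms(2) continuous_closure_measurable[OF assms(1)], of B])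
      (use B closure_subset[of \<Omega>] in auto)
qed

lemma continuous_potential: "continuous_on (closure \<Omega>) (potential q0 V c)"
  unfolding potential_def[abs_def] by (intro continuous_intros continuous_q0 continuous_V)

definition nonneg_params :: "(real^'d) set" where
  "nonneg_params = {c. \<forall>x\<in>closure \<Omega>. 0 \<le> potential q0 V c x}"

lemma closed_nonneg_params: "closed nonneg_params"
  unfolding nonneg_params_def Collect_ball_eq
  by (intro closed_INT ballI closed_Collect_le) (auto simp: potential_def intro!: continuous_intros)

lemma nonneg_potential:
  assumes "c \<in> nonneg_params"
  shows "nonneg_potential \<Omega> (potential q0 V c)"
proof -
  obtain B where B: "\<forall>x\<in>closure \<Omega>. \<bar>potential q0 V c x\<bar> \<le> B"
    using continuous_closure_bounded[OF continuous_potential] by blast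
  show ?thesis
    unfolding nonneg_potential_def
    using assms B closure_subset[of \<Omega>] continuous_closure_measurable[OF continuous_potential]
    unfolding nonneg_params_def by blast
qed

lemma potential_lipschitz:
  obtains C where "0 \<le> C" "\<And>c c' x. x \<in> \<Omega> \<Longrightarrow> \<bar>potential q0 V c x - potential q0 V c' x\<bar> \<le> C * dist c c'"
proof -
  have "\<forall>j. \<exists>B. \<forall>x\<in>closure \<Omega>. \<bar>V j x\<bar> \<le> B" using continuous_closure_bounded continuous_V by blast
  then obtain B where B: "\<And>j x. x \<in> closure \<Omega> \<Longrightarrow> \<bar>V j x\<bar> \<le> B j" by metis
  show thesis
  proof
    show "0 \<le> (\<Sum>j\<in>UNIV. \<bar>B j\<bar>)" by (intro sum_nonneg) auto
    fix c c' :: "real^'d" and x assume x: "x \<in> \<Omega>"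
    have "\<bar>potential q0 V c x - potential q0 V c' x\<bar> = \<bar>\<Sum>j\<in>UNIV. (c $ j - c' $ j) * V j x\<bar>"
      by (simp add: potential_def left_diff_distrib sum_subtractf)
    also have "\<dots> \<le> (\<Sum>j\<in>UNIV. \<bar>(c $ j - c' $ j) * V j x\<bar>)" by (rule sum_abs)
    also have "\<dots> \<le> (\<Sum>j\<in>UNIV. \<bar>B j\<bar> * dist c c')"
    proof (rule sum_mono)
      fix j
      have "\<bar>c $ j - c' $ j\<bar> \<le> dist c c'"
        using component_le_norm_cart[of "c - c'" j] by (simp add: dist_norm)
      moreover have "\<bar>V j x\<bar> \<le> \<bar>B j\<bar>" using B[of x j] x closure_subset[of \<Omega>] by fastforce
      ultimately have "\<bar>c $ j - c' $ j\<bar> * \<bar>V j x\<bar> \<le> dist c c' * \<bar>B j\<bar>" by (intro mult_mono) auto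
      thus "\<bar>(c $ j - c' $ j) * V j x\<bar> \<le> \<bar>B j\<bar> * dist c c'" by (simp add: abs_mult mult.commute)
    qed
    also have "\<dots> = (\<Sum>j\<in>UNIV. \<bar>B j\<bar>) * dist c c'" by (simp add: sum_distrib_right)
    finally show "\<bar>potential q0 V c x - potential q0 V c' x\<bar> \<le> (\<Sum>j\<in>UNIV. \<bar>B j\<bar>) * dist c c'" .
  qed
qed

text \<open>The inner product as a function of the parameters, set to zero where
  \<open>green\<close> is not controlled. This makes it a Borel function that can be integrated
  against the law of the random vector.\<close>

definition green_form :: "(real^'n \<Rightarrow> real) \<Rightarrow> (real^'n \<Rightarrow> real) \<Rightarrow> real^'d \<Rightarrow> real" where
  "green_form f g c = indicator nonneg_params c *\<^sub>R L2_inner \<Omega> (green \<Omega> (potential q0 V c) f) g"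

lemma green_form_eq:
  "c \<in> nonneg_params \<Longrightarrow> green_form f g c = L2_inner \<Omega> (green \<Omega> (potential q0 V c) f) g"
  by (simp add: green_form_def)

text \<open>On the closed set of admissible parameters the function is Lipschitz continuous, and it
  is zero outside.\<close>

lemma green_form_measurable:
  assumes f: "f \<in> L2 \<Omega>" and g: "g \<in> L2 \<Omega>"
  shows "green_form f g \<in> borel_measurable borel"
proof -
  obtain C where C: "0 \<le> C" "\<And>c c' x. x \<in> \<Omega> \<Longrightarrow> \<bar>potential q0 V c x - potential q0 V c' x\<bar> \<le> C * dist c c'"
    using potential_lipschitz by blast
  let ?P = "green_bound * green_bound * L2_norm \<Omega> f * L2_norm \<Omega> g"
  have "continuous_on nonneg_params (\<lambda>c. L2_inner \<Omega> (green \<Omega> (potential q0 V c) f) g)"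
  proof (rule lipschitz_on_continuous_on[OF lipschitz_onI])
    show "0 \<le> ?P * C"
      using green_bound(1) C by (intro mult_nonneg_nonneg L2_norm_nonneg) auto
    fix c c' assume "c \<in> nonneg_params" "c' \<in> nonneg_params"
    hence "\<bar>L2_inner \<Omega> (green \<Omega> (potential q0 V c) f) g - L2_inner \<Omega> (green \<Omega> (potential q0 V c') f) g\<bar>
        \<le> ?P * (C * dist c c')"
      using C by (intro green_inner_potential_lipschitz nonneg_potential f g) auto
    thus "dist (L2_inner \<Omega> (green \<Omega> (potential q0 V c) f) g) (L2_inner \<Omega> (green \<Omega> (potential q0 V c') f) g)
        \<le> ?P * C * dist c c'"
      by (simp add: dist_real_def mult.assoc)
  qed
  thus ?thesis
    unfolding green_form_def[abs_def]
    by (intro borel_measurable_continuous_on_indicator borel_closed closed_nonneg_params)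
qed

lemma green_form_le:
  assumes "f \<in> L2 \<Omega>" "g \<in> L2 \<Omega>"
  shows "\<bar>green_form f g c\<bar> \<le> green_bound * L2_norm \<Omega> f * L2_norm \<Omega> g"
proof (cases "c \<in> nonneg_params")
  case True
  thus ?thesis using assms by (simp add: green_form_eq green_inner_le nonneg_potential)
next
  case False
  thus ?thesis using green_bound(1) by (simp add: green_form_def L2_norm_nonneg)
qed

lemma green_form_add:
  "f \<in> L2 \<Omega> \<Longrightarrow> f' \<in> L2 \<Omega> \<Longrightarrow> g \<in> L2 \<Omega> \<Longrightarrow>
    green_form (\<lambda>x. f x + f' x) g c = green_form f g c + green_form f' g c"
  by (cases "c \<in> nonneg_params") (simp_all add: green_form_def green_inner_add nonneg_potential)

lemma green_form_scale:
  "f \<in> L2 \<Omega> \<Longrightarrow> g \<in> L2 \<Omega> \<Longrightarrow> green_form (\<lambda>x. a * f x) g c = a * green_form f g c"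
  by (cases "c \<in> nonneg_params") (simp_all add: green_form_def green_inner_scale nonneg_potential)

text \<open>Since the potential is affine in \<open>c\<close>, every coordinate \<open>c $ j\<close>
  comes out of the Green's operator as a scalar factor. In the averages it lengthens the monomial by
  one index.\<close>

lemma green_form_resolvent:
  assumes \<phi>: "\<phi> \<in> test_functions \<Omega>" and g: "g \<in> L2 \<Omega>" and c: "c \<in> nonneg_params"
  shows "green_form (\<lambda>x. - laplacian \<phi> x + q0 x * \<phi> x) g c
    + (\<Sum>j\<in>UNIV. c $ j * green_form (\<lambda>x. V j x * \<phi> x) g c) = L2_inner \<Omega> \<phi> g"
proof -
  note q = nonneg_potential[OF c]
  have L: "(\<lambda>x. - laplacian \<phi> x + q0 x * \<phi> x) \<in> L2 \<Omega>"
    using L2_add[OF L2_scale[OF test_function_L2[OF test_function_laplacian[OF \<phi>]], of "-1"]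
        continuous_closure_mult_L2[OF continuous_q0 test_function_L2[OF \<phi>]]] by simp
  have V: "(\<lambda>x. V j x * \<phi> x) \<in> L2 \<Omega>" for j
    by (intro continuous_closure_mult_L2 continuous_V test_function_L2 \<phi>)
  have "(\<lambda>x. - laplacian \<phi> x + potential q0 V c x * \<phi> x)
      = (\<lambda>x. (- laplacian \<phi> x + q0 x * \<phi> x) + (\<Sum>j\<in>UNIV. c $ j * (V j x * \<phi> x)))"
    by (simp add: potential_def fun_eq_iff distrib_right sum_distrib_right mult.assoc)
  hence "L2_inner \<Omega> \<phi> g = L2_inner \<Omega> (green \<Omega> (potential q0 V c)
      (\<lambda>x. (- laplacian \<phi> x + q0 x * \<phi> x) + (\<Sum>j\<in>UNIV. c $ j * (V j x * \<phi> x)))) g"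
    using green_inner_test_function[OF q \<phi> g] by simp
  also have "\<dots> = green_form (\<lambda>x. - laplacian \<phi> x + q0 x * \<phi> x) g c
      + L2_inner \<Omega> (green \<Omega> (potential q0 V c) (\<lambda>x. \<Sum>j\<in>UNIV. c $ j * (V j x * \<phi> x))) g"
    by (simp only: green_inner_add[OF q L L2_sum[OF L2_scale[OF V]] g] green_form_eq[OF c])
  also have "L2_inner \<Omega> (green \<Omega> (potential q0 V c) (\<lambda>x. \<Sum>j\<in>UNIV. c $ j * (V j x * \<phi> x))) g
      = (\<Sum>j\<in>UNIV. c $ j * green_form (\<lambda>x. V j x * \<phi> x) g c)"
    by (subst green_inner_sum) (simp_all add: q V g L2_scale green_inner_scale green_form_eq c)
  finally show ?thesis by simp
qed

section \<open>Averages over the law of the parameters\<close>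

definition averaged_form :: "(real^'d) measure \<Rightarrow> 'd list \<Rightarrow> (real^'n \<Rightarrow> real) \<Rightarrow> (real^'n \<Rightarrow> real) \<Rightarrow> real" where
  "averaged_form \<mu> js f g = (\<integral>c. list_monomial (\<lambda>j. c $ j) js * green_form f g c \<partial>\<mu>)"

text \<open>The hypotheses on a random vector transferred to its law. Both laws live on the same
  parameter space, although the underlying probability spaces differ.\<close>

definition admissible_law :: "(real^'d) measure \<Rightarrow> (real^'d) set \<Rightarrow> bool" where
  "admissible_law \<mu> K \<longleftrightarrow> prob_space \<mu> \<and> sets \<mu> = sets borel \<and> compact K \<and>
     (AE c in \<mu>. c \<in> K) \<and> (AE c in \<mu>. c \<in> nonneg_params)"

context
  fixes \<mu> :: "(real^'d) measure" and K :: "(real^'d) set"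
  assumes law: "admissible_law \<mu> K"
begin

lemma law_facts: "prob_space \<mu>" "sets \<mu> = sets borel" "compact K" "AE c in \<mu>. c \<in> K"
    "AE c in \<mu>. c \<in> nonneg_params"
  using law by (auto simp: admissible_law_def)

lemma integrable_moment: "integrable \<mu> (\<lambda>c. list_monomial (\<lambda>j. c $ j) js)"
  by (intro integrable_continuous_compact_support[OF prob_space.finite_measure[OF law_facts(1)] law_facts(2-4)]
      continuous_intros)

lemma integrable_averaged_form:
  assumes "f \<in> L2 \<Omega>" "g \<in> L2 \<Omega>"
  shows "integrable \<mu> (\<lambda>c. list_monomial (\<lambda>j. c $ j) js * green_form f g c)"
proof (rule Bochner_Integration.integrable_bound)
  define B where "B = green_bound * L2_norm \<Omega> f * L2_norm \<Omega> g"
  show "integrable \<mu> (\<lambda>c. B * list_monomial (\<lambda>j. c $ j) js)"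
    by (intro integrable_mult_right integrable_moment)
  have "(\<lambda>c. list_monomial (\<lambda>j. c $ j) js * green_form f g c) \<in> borel_measurable borel"
    by (intro borel_measurable_times green_form_measurable assms borel_measurable_continuous_onI
        continuous_on_list_monomial)
  thus "(\<lambda>c. list_monomial (\<lambda>j. c $ j) js * green_form f g c) \<in> borel_measurable \<mu>"
    using measurable_cong_sets[OF law_facts(2) refl] by blast
  have "\<bar>list_monomial (\<lambda>j. c $ j) js\<bar> * \<bar>green_form f g c\<bar> \<le> \<bar>list_monomial (\<lambda>j. c $ j) js\<bar> * B" for c
    unfolding B_def by (intro mult_left_mono green_form_le assms) auto
  moreover have "0 \<le> B" unfolding B_def using green_bound(1) by (intro mult_nonneg_nonneg L2_norm_nonneg) auto
  ultimately show "AE c in \<mu>. norm (list_monomial (\<lambda>j. c $ j) js * green_form f g c)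
      \<le> norm (B * list_monomial (\<lambda>j. c $ j) js)"
    by (intro AE_I2) (simp add: abs_mult mult.commute)
qed

lemma averaged_form_add:
  "f \<in> L2 \<Omega> \<Longrightarrow> f' \<in> L2 \<Omega> \<Longrightarrow> g \<in> L2 \<Omega> \<Longrightarrow>
    averaged_form \<mu> js (\<lambda>x. f x + f' x) g = averaged_form \<mu> js f g + averaged_form \<mu> js f' g"
  by (simp add: averaged_form_def green_form_add distrib_left integrable_averaged_form)

lemma averaged_form_scale:
  "f \<in> L2 \<Omega> \<Longrightarrow> g \<in> L2 \<Omega> \<Longrightarrow> averaged_form \<mu> js (\<lambda>x. a * f x) g = a * averaged_form \<mu> js f g"
  by (simp add: averaged_form_def green_form_scale mult.left_commute[of _ a])

lemma averaged_form_bound: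
  "\<exists>C. \<forall>f\<in>L2 \<Omega>. \<forall>g\<in>L2 \<Omega>. \<bar>averaged_form \<mu> js f g\<bar> \<le> C * L2_norm \<Omega> f * L2_norm \<Omega> g"
proof (intro exI ballI)
  fix f g assume fg: "f \<in> L2 \<Omega>" "g \<in> L2 \<Omega>"
  let ?B = "green_bound * L2_norm \<Omega> f * L2_norm \<Omega> g"
  have "\<bar>averaged_form \<mu> js f g\<bar> \<le> (\<integral>c. \<bar>list_monomial (\<lambda>j. c $ j) js * green_form f g c\<bar> \<partial>\<mu>)"
    unfolding averaged_form_def by (rule integral_abs_bound)
  also have "\<dots> \<le> (\<integral>c. ?B * \<bar>list_monomial (\<lambda>j. c $ j) js\<bar> \<partial>\<mu>)"
  proof (rule integral_mono)
    show "integrable \<mu> (\<lambda>c. \<bar>list_monomial (\<lambda>j. c $ j) js * green_form f g c\<bar>)"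
      using integrable_averaged_form[OF fg] by (rule integrable_abs)
    show "integrable \<mu> (\<lambda>c. ?B * \<bar>list_monomial (\<lambda>j. c $ j) js\<bar>)"
      by (intro integrable_mult_right integrable_abs integrable_moment)
    show "\<bar>list_monomial (\<lambda>j. c $ j) js * green_form f g c\<bar> \<le> ?B * \<bar>list_monomial (\<lambda>j. c $ j) js\<bar>" for c
      using mult_left_mono[OF green_form_le[OF fg, of c], of "\<bar>list_monomial (\<lambda>j. c $ j) js\<bar>"]
      by (simp add: abs_mult mult.commute)
  qed
  finally show "\<bar>averaged_form \<mu> js f g\<bar>
      \<le> (green_bound * (\<integral>c. \<bar>list_monomial (\<lambda>j. c $ j) js\<bar> \<partial>\<mu>)) * L2_norm \<Omega> f * L2_norm \<Omega> g"
    by (simp add: mult_ac)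
qed

lemma averaged_form_resolvent:
  assumes \<phi>: "\<phi> \<in> test_functions \<Omega>" and g: "g \<in> L2 \<Omega>"
  shows "averaged_form \<mu> js (\<lambda>x. - laplacian \<phi> x + q0 x * \<phi> x) g
    + (\<Sum>j\<in>UNIV. averaged_form \<mu> (j # js) (\<lambda>x. V j x * \<phi> x) g)
    = (\<integral>c. list_monomial (\<lambda>j. c $ j) js \<partial>\<mu>) * L2_inner \<Omega> \<phi> g"
proof -
  let ?m = "\<lambda>c :: real^'d. list_monomial (\<lambda>j. c $ j) js"
  let ?f = "\<lambda>x. - laplacian \<phi> x + q0 x * \<phi> x"
  have L: "?f \<in> L2 \<Omega>"
    using L2_add[OF L2_scale[OF test_function_L2[OF test_function_laplacian[OF \<phi>]], of "-1"]
        continuous_closure_mult_L2[OF continuous_q0 test_function_L2[OF \<phi>]]] by simp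
  have V: "(\<lambda>x. V j x * \<phi> x) \<in> L2 \<Omega>" for j
    by (intro continuous_closure_mult_L2 continuous_V test_function_L2 \<phi>)
  note int = integrable_averaged_form[OF L g, of js] integrable_averaged_form[OF V g, of "_ # js"]
  have "averaged_form \<mu> js ?f g + (\<Sum>j\<in>UNIV. averaged_form \<mu> (j # js) (\<lambda>x. V j x * \<phi> x) g)
      = (\<integral>c. ?m c * green_form ?f g c
        + (\<Sum>j\<in>UNIV. list_monomial (\<lambda>j. c $ j) (j # js) * green_form (\<lambda>x. V j x * \<phi> x) g c) \<partial>\<mu>)"
    unfolding averaged_form_def
    by (subst Bochner_Integration.integral_add[OF int(1) Bochner_Integration.integrable_sum[OF int(2)]],
        subst Bochner_Integration.integral_sum[OF int(2)]) (rule refl)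
  also have "\<dots> = (\<integral>c. ?m c * L2_inner \<Omega> \<phi> g \<partial>\<mu>)"
  proof (rule integral_cong_AE)
    show "AE c in \<mu>. ?m c * green_form ?f g c
        + (\<Sum>j\<in>UNIV. list_monomial (\<lambda>j. c $ j) (j # js) * green_form (\<lambda>x. V j x * \<phi> x) g c)
        = ?m c * L2_inner \<Omega> \<phi> g"
      using law_facts(5)
    proof eventually_elim
      case (elim c)
      show ?case
        unfolding green_form_resolvent[OF \<phi> g elim, symmetric]
        by (simp add: distrib_left sum_distrib_left mult_ac)
    qed
    show "(\<lambda>c. ?m c * green_form ?f g c
        + (\<Sum>j\<in>UNIV. list_monomial (\<lambda>j. c $ j) (j # js) * green_form (\<lambda>x. V j x * \<phi> x) g c))
        \<in> borel_measurable \<mu>"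
      by (intro borel_measurable_add borel_measurable_sum borel_measurable_integrable int)
    show "(\<lambda>c. ?m c * L2_inner \<Omega> \<phi> g) \<in> borel_measurable \<mu>"
      by (intro borel_measurable_times borel_measurable_const borel_measurable_integrable integrable_moment)
  qed
  finally show ?thesis by simp
qed

end

lemma admissible_imp_law:
  assumes "admissible \<Omega> q0 V M X"
  obtains K where "admissible_law (distr M borel X) K"
proof -
  obtain K where K: "prob_space M" "X \<in> borel_measurable M" "compact K" "AE c in distr M borel X. c \<in> K"
    and nn: "AE \<omega> in M. X \<omega> \<in> nonneg_params"
    using assms by (auto simp: admissible_def nonneg_params_def)
  have "AE c in distr M borel X. c \<in> nonneg_params"
    using AE_distr_iff[OF K(2), of "\<lambda>c. c \<in> nonneg_params"] closed_nonneg_params nn by (simp add: borel_closed)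
  hence "admissible_law (distr M borel X) K"
    using K by (simp add: admissible_law_def prob_space.prob_space_distr)
  thus thesis by (rule that)
qed

text \<open>\<open>L2_riesz\<close>, applied to the averaged form as a functional of
  \<open>g\<close>, shows that the choice in \<open>weak_expectation\<close> has a witness. Passing
  to the law of \<open>X\<close> goes through the completion of \<open>M\<close>, where the
  uncontrolled null event is harmless.\<close>

lemma averaged_green_inner:
  assumes adm: "admissible \<Omega> q0 V M X" and f: "f \<in> L2 \<Omega>"
  shows "averaged_green M X \<Omega> q0 V f \<in> L2 \<Omega>"
    and "g \<in> L2 \<Omega> \<Longrightarrow>
      L2_inner \<Omega> (averaged_green M X \<Omega> q0 V f) g = averaged_form (distr M borel X) [] f g"
proof -
  let ?\<mu> = "distr M borel X"
  let ?G = "\<lambda>\<omega>. green \<Omega> (potential q0 V (X \<omega>)) f"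
  have X: "X \<in> borel_measurable M" and nn: "AE \<omega> in M. X \<omega> \<in> nonneg_params"
    using adm by (auto simp: admissible_def nonneg_params_def)
  obtain K where law: "admissible_law ?\<mu> K" using admissible_imp_law[OF adm] by blast
  have eq: "(\<integral>\<omega>. L2_inner \<Omega> (?G \<omega>) g \<partial>completion M) = averaged_form ?\<mu> [] f g" if g: "g \<in> L2 \<Omega>" for g
  proof -
    have meas: "(\<lambda>\<omega>. green_form f g (X \<omega>)) \<in> borel_measurable M"
      by (rule measurable_compose[OF X green_form_measurable[OF f g]])
    have ae: "AE \<omega> in M. green_form f g (X \<omega>) = L2_inner \<Omega> (?G \<omega>) g"
      using nn by eventually_elim (simp add: green_form_eq)
    have "(\<integral>\<omega>. L2_inner \<Omega> (?G \<omega>) g \<partial>completion M) = (\<integral>\<omega>. green_form f g (X \<omega>) \<partial>completion M)"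
    proof (rule integral_cong_AE)
      show "(\<lambda>\<omega>. green_form f g (X \<omega>)) \<in> borel_measurable (completion M)"
        by (rule measurable_completion[OF meas])
      thus "(\<lambda>\<omega>. L2_inner \<Omega> (?G \<omega>) g) \<in> borel_measurable (completion M)"
        using ae by (rule borel_measurable_completion_cong_AE)
      show "AE \<omega> in completion M. L2_inner \<Omega> (?G \<omega>) g = green_form f g (X \<omega>)"
        using AE_completion[OF ae] by eventually_elim simp
    qed
    also have "\<dots> = (\<integral>\<omega>. green_form f g (X \<omega>) \<partial>M)" by (rule integral_completion[OF meas])
    also have "\<dots> = averaged_form ?\<mu> [] f g"
      unfolding averaged_form_def using integral_distr[OF X green_form_measurable[OF f g]] by simp
    finally show ?thesis .
  qed
  have "\<exists>h. h \<in> L2 \<Omega> \<and> (\<forall>g\<in>L2 \<Omega>. L2_inner \<Omega> h g = (\<integral>\<omega>. L2_inner \<Omega> (?G \<omega>) g \<partial>completion M))"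
  proof -
    have sets: "sets ?\<mu> = sets borel" by simp
    have green_right: "green_form f (\<lambda>x. u x + v x) c = green_form f u c + green_form f v c"
      "green_form f (\<lambda>x. a * u x) c = a * green_form f u c"
      if "u \<in> L2 \<Omega>" "v \<in> L2 \<Omega>" for u v a c
      using that f by (cases "c \<in> nonneg_params";
          simp add: green_form_def L2.B_add_right L2.B_scale_right green_L2 nonneg_potential)+
    obtain C where C: "\<forall>f\<in>L2 \<Omega>. \<forall>g\<in>L2 \<Omega>. \<bar>averaged_form ?\<mu> [] f g\<bar> \<le> C * L2_norm \<Omega> f * L2_norm \<Omega> g"
      using averaged_form_bound[OF law] by blast
    have "\<exists>h\<in>L2 \<Omega>. \<forall>g\<in>L2 \<Omega>. L2_inner \<Omega> h g = averaged_form ?\<mu> [] f g"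
    proof (rule L2_riesz[OF finite_measure_\<Omega>, of "averaged_form ?\<mu> [] f" "C * L2_norm \<Omega> f"])
      fix u v assume uv: "u \<in> L2 \<Omega>" "v \<in> L2 \<Omega>"
      show "averaged_form ?\<mu> [] f (\<lambda>x. u x + v x) = averaged_form ?\<mu> [] f u + averaged_form ?\<mu> [] f v"
        using integrable_averaged_form[OF law f uv(1), of "[]"] integrable_averaged_form[OF law f uv(2), of "[]"]
        by (simp add: averaged_form_def green_right uv)
    next
      fix a u assume u: "u \<in> L2 \<Omega>"
      show "averaged_form ?\<mu> [] f (\<lambda>x. a * u x) = a * averaged_form ?\<mu> [] f u"
        by (simp add: averaged_form_def green_right(2)[OF u u])
      show "\<bar>averaged_form ?\<mu> [] f u\<bar> \<le> C * L2_norm \<Omega> f * L2_norm \<Omega> u" using C f u by blast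
    qed
    thus ?thesis using eq by auto
  qed
  from someI_ex[OF this]
  have h: "averaged_green M X \<Omega> q0 V f \<in> L2 \<Omega>"
    "\<forall>g\<in>L2 \<Omega>. L2_inner \<Omega> (averaged_green M X \<Omega> q0 V f) g
      = (\<integral>\<omega>. L2_inner \<Omega> (?G \<omega>) g \<partial>completion M)"
    unfolding averaged_green_def weak_expectation_def by auto
  show "averaged_green M X \<Omega> q0 V f \<in> L2 \<Omega>" by (rule h)
  show "L2_inner \<Omega> (averaged_green M X \<Omega> q0 V f) g = averaged_form ?\<mu> [] f g" if "g \<in> L2 \<Omega>"
    using h(2) eq that by simp
qed

end

theorem proposition5p9:
  fixes \<Omega> U :: "(real^'n::finite) set"
    and q0 :: "real^'n \<Rightarrow> real"
    and V :: "'d::finite \<Rightarrow> real^'n \<Rightarrow> real"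
    and M :: "'a measure" and X :: "'a \<Rightarrow> real^'d"
    and M' :: "'b measure" and X' :: "'b \<Rightarrow> real^'d"
  assumes "2 \<le> CARD('n)"
    and "smooth_bounded_domain \<Omega>"
    and "smooth_closure \<Omega> q0" and "\<And>j. smooth_closure \<Omega> (V j)"
    and "open U" and "U \<noteq> {}" and "compact (closure U)" and "closure U \<subseteq> \<Omega>"
    and "\<And>k. 1 \<le> k \<Longrightarrow>
           lin_indep_on U (multi_indices k) (\<lambda>\<alpha> x. monomial (\<lambda>j. V j x) \<alpha>)"
    and "admissible \<Omega> q0 V M X" and "admissible \<Omega> q0 V M' X'"
    and "L2_operator_eq \<Omega> (averaged_green M X \<Omega> q0 V) (averaged_green M' X' \<Omega> q0 V)"
  shows "(\<forall>\<alpha>. (\<integral>\<omega>. monomial (\<lambda>j. X \<omega> $ j) \<alpha> \<partial>M) = (\<integral>\<omega>. monomial (\<lambda>j. X' \<omega> $ j) \<alpha> \<partial>M'))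
         \<and> distr M borel X = distr M' borel X'"
proof -
  let ?\<mu> = "distr M borel X" and ?\<nu> = "distr M' borel X'"
  interpret affine_potentials \<Omega> q0 V
    by unfold_locales (use assms(2-4) in \<open>auto simp: smooth_bounded_domain_def smooth_closure_def\<close>)
  obtain K where \<mu>: "admissible_law ?\<mu> K" using admissible_imp_law[OF assms(10)] by blast
  obtain K' where \<nu>: "admissible_law ?\<nu> K'" using admissible_imp_law[OF assms(11)] by blast
  define D where "D js f g = averaged_form ?\<mu> js f g - averaged_form ?\<nu> js f g" for js f g
  define mm where "mm \<alpha> = (\<integral>c. monomial (\<lambda>j. c $ j) \<alpha> \<partial>?\<mu>) - (\<integral>c. monomial (\<lambda>j. c $ j) \<alpha> \<partial>?\<nu>)" for \<alpha>
  define m where "m js = mm (count_list js)" for js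
  have m: "m js = (\<integral>c. list_monomial (\<lambda>j. c $ j) js \<partial>?\<mu>) - (\<integral>c. list_monomial (\<lambda>j. c $ j) js \<partial>?\<nu>)" for js
    by (simp add: m_def mm_def list_monomial_eq_monomial)
  \<comment> \<open>The oscillation may be in any coordinate direction, so an arbitrary index is
    chosen.\<close>
  interpret moment_forms \<Omega> q0 V D m "SOME i. True"
  proof
    show "smooth_on \<Omega> q0" "smooth_on \<Omega> (V j)" for j
      using assms(3,4) by (auto simp: smooth_closure_def)
    fix js :: "'d list" and f f' g \<phi> :: "real^'n \<Rightarrow> real" and c :: real
    show "\<exists>C. \<forall>f\<in>L2 \<Omega>. \<forall>g\<in>L2 \<Omega>. \<bar>D js f g\<bar> \<le> C * L2_norm \<Omega> f * L2_norm \<Omega> g"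
    proof -
      obtain C C' where
        C: "\<forall>f\<in>L2 \<Omega>. \<forall>g\<in>L2 \<Omega>. \<bar>averaged_form ?\<mu> js f g\<bar> \<le> C * L2_norm \<Omega> f * L2_norm \<Omega> g" and
        C': "\<forall>f\<in>L2 \<Omega>. \<forall>g\<in>L2 \<Omega>. \<bar>averaged_form ?\<nu> js f g\<bar> \<le> C' * L2_norm \<Omega> f * L2_norm \<Omega> g"
        using averaged_form_bound[OF \<mu>, of js] averaged_form_bound[OF \<nu>, of js] by blast
      have "\<bar>D js f g\<bar> \<le> (C + C') * L2_norm \<Omega> f * L2_norm \<Omega> g" if "f \<in> L2 \<Omega>" "g \<in> L2 \<Omega>" for f g
        using C[rule_format, OF that] C'[rule_format, OF that] by (simp add: D_def distrib_right)
      thus ?thesis by blast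
    qed
    assume g: "g \<in> L2 \<Omega>"
    show "D js (\<lambda>x. - laplacian \<phi> x + q0 x * \<phi> x) g + (\<Sum>j\<in>UNIV. D (j # js) (\<lambda>x. V j x * \<phi> x) g)
        = m js * L2_inner \<Omega> \<phi> g" if "\<phi> \<in> test_functions \<Omega>"
      using averaged_form_resolvent[OF \<mu> that g, of js] averaged_form_resolvent[OF \<nu> that g, of js]
      by (simp add: D_def m sum_subtractf left_diff_distrib)
    assume f: "f \<in> L2 \<Omega>"
    show "D js (\<lambda>x. c * f x) g = c * D js f g"
      by (simp add: D_def averaged_form_scale[OF \<mu> f g] averaged_form_scale[OF \<nu> f g] right_diff_distrib)
    show "D js (\<lambda>x. f x + f' x) g = D js f g + D js f' g" if "f' \<in> L2 \<Omega>"
      by (simp add: D_def averaged_form_add[OF \<mu> f that g] averaged_form_add[OF \<nu> f that g])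
  qed
  have D0: "D [] f g = 0" if f: "f \<in> L2 \<Omega>" and g: "g \<in> L2 \<Omega>" for f g
  proof -
    note G = averaged_green_inner[OF assms(10) f] and G' = averaged_green_inner[OF assms(11) f]
    have "AE x in lebesgue_on \<Omega>. averaged_green M X \<Omega> q0 V f x = averaged_green M' X' \<Omega> q0 V f x"
      using assms(12) f by (auto simp: L2_operator_eq_def)
    hence "AE x in lebesgue_on \<Omega>. averaged_green M X \<Omega> q0 V f x * g x = averaged_green M' X' \<Omega> q0 V f x * g x"
      by eventually_elim simp
    hence "L2_inner \<Omega> (averaged_green M X \<Omega> q0 V f) g = L2_inner \<Omega> (averaged_green M' X' \<Omega> q0 V f) g"
      unfolding L2_inner_def using L2_measurable[OF G(1)] L2_measurable[OF G'(1)] L2_measurable[OF g]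
      by (intro integral_cong_AE) auto
    thus ?thesis using G(2)[OF g] G'(2)[OF g] by (simp add: D_def)
  qed
  have m0: "m js = 0" for js
  proof (rule moments_eq_0[OF D0 m_def _ _ assms(9)])
    \<comment> \<open>Both laws have total mass 1. This settles degree 0, where linear independence
      is not among the hypotheses.\<close>
    show "m [] = 0"
      using \<mu> \<nu> prob_space.prob_space[of ?\<mu>] prob_space.prob_space[of ?\<nu>]
      by (simp add: m admissible_law_def)
    show "U \<subseteq> \<Omega>" using assms(8) closure_subset by blast
  qed
  have X: "X \<in> borel_measurable M" "X' \<in> borel_measurable M'"
    using assms(10,11) by (simp_all add: admissible_def)
  have "(\<integral>\<omega>. monomial (\<lambda>j. X \<omega> $ j) \<alpha> \<partial>M) = (\<integral>\<omega>. monomial (\<lambda>j. X' \<omega> $ j) \<alpha> \<partial>M')" for \<alpha>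
  proof -
    obtain js where js: "count_list js = \<alpha>" using ex_list_with_counts by blast
    have meas: "(\<lambda>c :: real^'d. monomial (\<lambda>j. c $ j) \<alpha>) \<in> borel_measurable borel"
      unfolding js[symmetric] list_monomial_eq_monomial[symmetric]
      by (intro borel_measurable_continuous_onI continuous_intros)
    have "mm \<alpha> = 0" using m0[of js] by (simp add: m_def js)
    thus ?thesis using integral_distr[OF X(1) meas] integral_distr[OF X(2) meas] by (simp add: mm_def)
  qed
  moreover have "?\<mu> = ?\<nu>"
  proof (rule compact_support_moments_determine)
    \<comment> \<open>The union of the two compact sets carries both laws, so one and the same
      polynomial approximates the integrand for both.\<close>
    show "prob_space ?\<mu>" "prob_space ?\<nu>" "compact (K \<union> K')"
      using \<mu> \<nu> by (auto simp: admissible_law_def)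
    show "AE c in ?\<mu>. c \<in> K \<union> K'" "AE c in ?\<nu>. c \<in> K \<union> K'"
      using \<mu> \<nu> unfolding admissible_law_def by (auto elim!: AE_mp)
    show "(\<integral>c. list_monomial (\<lambda>j. c $ j) js \<partial>?\<mu>) = (\<integral>c. list_monomial (\<lambda>j. c $ j) js \<partial>?\<nu>)" for js
      using m0[of js] by (simp add: m)
  qed simp_all
  ultimately show ?thesis by blast
qed

end
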